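(* Assume the standing assumptions (A1) and (A2) below. Then the following hold. (i) For every $v \in C_p(\Omega_{\mathrm{loc}},\mathbb{R})$ there exists a measurable map $\mathbb{P}_0^*:\Omega_{\mathrm{loc}}\times A\to\mathcal{M}_1(\Omega_{\mathrm{loc}})$ such that for all $(x,a)\in\Omega_{\mathrm{loc}}\times A$ we have $\mathbb{P}_0^*(x,a)\in\mathcal{P}(x,a)$ and $$\int_{\Omega_{\mathrm{loc}}} \big(r(x,a,\omega_1)+\alpha v(\omega_1)\big)\,\mathbb{P}_0^*(x,a;d\omega_1)=\inf_{\mathbb{P}_0\in\mathcal{P}(x,a)}\mathbb{E}_{\mathbb{P}_0}\big[r(x,a,X_1)+\alpha v(X_1)\big].$$ Moreover, there exists $a_{\mathrm{loc}}^*\in\mathcal{A}_{\mathrm{loc}}$ such that for every $x\in\Omega_{\mathrm{loc}}$, $$\inf_{\mathbb{P}_0\in\mathcal{P}(x,a^*_{\mathrm{loc}}(x))}\mathbb{E}_{\mathbb{P}_0}\big[r(x,a^*_{\mathrm{loc}}(x),X_1)+\alpha v(X_1)\big]=\sup_{a_{\mathrm{loc}}\in\mathcal{A}_{\mathrm{loc}}}\inf_{\mathbb{P}_0\in\mathcal{P}(x,a_{\mathrm{loc}}(x))}\mathbb{E}_{\mathbb{P}_0}\big[r(x,a_{\mathrm{loc}}(x),X_1)+\alpha v(X_1)\big].$$ Furthermore, defining $\mathbb{P}^*_{\mathrm{loc}}(x):=\mathbb{P}_0^*(x,a^*_{\mathrm{loc}}(x))$ for $x\in\Omega_{\mathrm{loc}}$,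 we have $\mathbb{P}^*_{\mathrm{loc}}\in\mathbf{P}_{a^*_{\mathrm{loc}}}$ and for every $x\in\Omega_{\mathrm{loc}}$ $$\mathcal{T}v(x)=\sup_{a_{\mathrm{loc}}\in\mathcal{A}_{\mathrm{loc}}}\inf_{\mathbb{P}_0\in\mathbf{P}_{a_{\mathrm{loc}}}}\mathbb{E}_{\mathbb{P}_0(x)}\big[r(x,a_{\mathrm{loc}}(x),X_1)+\alpha v(X_1)\big]=\inf_{\mathbb{P}_0\in\mathbf{P}_{a^*_{\mathrm{loc}}}}\mathbb{E}_{\mathbb{P}_0(x)}\big[r(x,a^*_{\mathrm{loc}}(x),X_1)+\alpha v(X_1)\big]=\mathbb{E}_{\mathbb{P}^*_{\mathrm{loc}}(x)}\big[r(x,a^*_{\mathrm{loc}}(x),X_1)+\alpha v(X_1)\big].$$ (ii) $\mathcal{T}v\in C_p(\Omega_{\mathrm{loc}},\mathbb{R})$ for all $v\in C_p(\Omega_{\mathrm{loc}},\mathbb{R})$, and for all $v,w\in C_p(\Omega_{\mathrm{loc}},\mathbb{R})$, $$\|\mathcal{T}v-\mathcal{T}w\|_{C_p}\le \alpha C_P\|v-w\|_{C_p}.$$ In particular there is a unique $v\in C_p(\Omega_{\mathrm{loc}},\mathbb{R})$ with $\mathcal{T}v=v$, and for every $v_0\in C_p(\Omega_{\mathrm{loc}},\mathbb{R})$ one has $v=\lim_{n\to\infty}\mathcal{T}^n v_0$ in $\|\cdot\|_{C_p}$. (iii) Let $v\in C_p(\Omega_{\mathrm{loc}},\mathbb{R})$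 satisfy $\mathcal{T}v=v$, and let $a^*_{\mathrm{loc}}\in\mathcal{A}_{\mathrm{loc}}$ and $\mathbb{P}^*_{\mathrm{loc}}\in\mathbf{P}_{a^*_{\mathrm{loc}}}$ be as in (i) for this $v$. Define $\mathbf{a}^*:=(a^*_{\mathrm{loc}}(X_0),a^*_{\mathrm{loc}}(X_1),\dots)\in\mathcal{A}$ and, for $x\in\Omega_{\mathrm{loc}}$, $\mathbb{P}^*_x:=\delta_x\otimes\mathbb{P}^*_{\mathrm{loc}}\otimes\mathbb{P}^*_{\mathrm{loc}}\otimes\cdots\in\mathfrak{P}_{x,\mathbf{a}^*}$. Then for all $x\in\Omega_{\mathrm{loc}}$, $$\mathbb{E}_{\mathbb{P}^*_x}\Big[\sum_{t=0}^\infty\alpha^t r(X_t,a^*_{\mathrm{loc}}(X_t),X_{t+1})\Big]=\inf_{\mathbb{P}\in\mathfrak{P}_{x,\mathbf{a}^*}}\mathbb{E}_{\mathbb{P}}\Big[\sum_{t=0}^\infty\alpha^t r(X_t,a^*_{\mathrm{loc}}(X_t),X_{t+1})\Big]=V(x)=v(x).$$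
   Context: Setting. Let $d,m\in\mathbb{N}$, let $\Omega_{\mathrm{loc}}\subseteq\mathbb{R}^d$ be closed with Borel $\sigma$-field $\mathcal{F}_{\mathrm{loc}}$, and let $\Omega:=\Omega_{\mathrm{loc}}^{\mathbb{N}_0}$ with product $\sigma$-field $\mathcal{F}$. $X_t(\omega_0,\omega_1,\dots):=\omega_t$ is the canonical process. $\mathcal{M}_1(Y)$ denotes the Borel probability measures on $Y$; $\|\cdot\|$ is the Euclidean norm; $\delta_x$ is the Dirac measure at $x$. Let $A\subseteq\mathbb{R}^m$ be compact. The set of policies is $\mathcal{A}:=\{(a_t(X_t))_{t\in\mathbb{N}_0}: a_t:\Omega_{\mathrm{loc}}\to A \text{ Borel measurable for all } t\}$, and the set of one-step actions is $\mathcal{A}_{\mathrm{loc}}:=\{a_{\mathrm{loc}}:\Omega_{\mathrm{loc}}\to A\text{ measurable}\}$. For $X\subseteq\mathbb{R}^k$ and $p\in\mathbb{N}_0$, $C_p(X,\mathbb{R})$ is the set of continuous $g:X\to\mathbb{R}$ with $\sup_{x\in X}|g(x)|/(1+\|x\|^p)<\infty$; on $C_p(\Omega_{\mathrm{loc}},\mathbb{R})$ set $\|g\|_{C_p}:=\sup_{x\in\Omega_{\mathrm{loc}}}|g(x)|/(1+\|x\|^p)$. $\tau_p$ denotes the topology on $\mathcal{M}_1(\Omega_{\mathrm{loc}})$ in which $\mu_n\to\mu$ iff $\int g\,d\mu_n\to\int g\,d\mu$ for all $g\in C_p(\Omega_{\mathrm{loc}},\mathbb{R})$ ($\tau_0$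 = weak convergence, $\tau_1$ = Wasserstein-1 topology). A correspondence $\varphi:X\twoheadrightarrow Y$ between topological spaces is upper hemicontinuous if $\{x:\varphi(x)\subseteq U\}$ is open for every open $U$, lower hemicontinuous if $\{x:\varphi(x)\cap U\neq\emptyset\}$ is open for every open $U$, and continuous if both. Products of spaces carry the product topology. Standing assumption (A1). Fix $p\in\{0,1\}$. (i) The correspondence $\Omega_{\mathrm{loc}}\times A\ni(x,a)\twoheadrightarrow\mathcal{P}(x,a)\subseteq(\mathcal{M}_1(\Omega_{\mathrm{loc}}),\tau_p)$ is nonempty, compact-valued and continuous. (ii) There is $C_P\ge1$ such that $\int(1+\|y\|^p)\,\mathbb{P}(dy)\le C_P(1+\|x\|^p)$ for all $(x,a)$ and all $\mathbb{P}\in\mathcal{P}(x,a)$. Standing assumption (A2). $r:\Omega_{\mathrm{loc}}\times A\times\Omega_{\mathrm{loc}}\to\mathbb{R}$ satisfies: (i) $r$ is continuous; (ii) there exist $L>0$ and moduli of continuity $\rho_0,\rho_A:[0,\infty]\to[0,\infty]$ (i.e. $\lim_{s\to0}\rho(s)=0=\rho(0)$) with $|r(x_0,a,x_1)-r(x_0',a',x_1)|\le L(1+\|x_1\|^p)(\rho_0(\|x_0-x_0'\|)+\rho_A(\|a-a'\|))$ for all $x_0,x_0',x_1\in\Omega_{\mathrm{loc}}$, $a,a'\in A$; (iii) there is $C_r\ge1$ with $|r(x_0,a,x_1)|\le C_r(1+\|x_0\|^p+\|x_1\|^p)$ for all $x_0,x_1,a$; (iv) the discount factor $\alpha$ satisfies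 $0<\alpha<1/C_P$. Ambiguity sets. For $x\in\Omega_{\mathrm{loc}}$ and $\mathbf{a}=(a_t(X_t))_t\in\mathcal{A}$, $\mathfrak{P}_{x,\mathbf{a}}$ is the set of measures $\delta_x\otimes\mathbb{P}_0\otimes\mathbb{P}_1\otimes\cdots$ on $(\Omega,\mathcal{F})$, where each $\mathbb{P}_t:\Omega_{\mathrm{loc}}\to\mathcal{M}_1(\Omega_{\mathrm{loc}})$ is a Borel measurable kernel with $\mathbb{P}_t(\omega_t)\in\mathcal{P}(\omega_t,a_t(\omega_t))$ for all $\omega_t$, and $(\delta_x\otimes\mathbb{P}_0\otimes\mathbb{P}_1\otimes\cdots)(B):=\int\cdots\int \mathbf{1}_B((\omega_t)_t)\cdots\mathbb{P}_{t-1}(\omega_{t-1};d\omega_t)\cdots\mathbb{P}_0(\omega_0;d\omega_1)\delta_x(d\omega_0)$. For $a_{\mathrm{loc}}\in\mathcal{A}_{\mathrm{loc}}$, $\mathbf{P}_{a_{\mathrm{loc}}}:=\{\mathbb{P}_0:\Omega_{\mathrm{loc}}\to\mathcal{M}_1(\Omega_{\mathrm{loc}})\text{ measurable}:\mathbb{P}_0(x)\in\mathcal{P}(x,a_{\mathrm{loc}}(x))\ \forall x\}$. Value function and operator. $V(x):=\sup_{\mathbf{a}\in\mathcal{A}}\inf_{\mathbb{P}\in\mathfrak{P}_{x,\mathbf{a}}}\mathbb{E}_{\mathbb{P}}[\sum_{t=0}^\infty\alpha^t r(X_t,a_t,X_{t+1})]$. For $v\in C_p(\Omega_{\mathrm{loc}},\mathbb{R})$,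 $\mathcal{T}v(x):=\sup_{a\in A}\inf_{\mathbb{P}\in\mathcal{P}(x,a)}\mathbb{E}_{\mathbb{P}}[r(x,a,X_1)+\alpha v(X_1)]$, where $X_1$ denotes the identity on $\Omega_{\mathrm{loc}}$ under $\mathbb{P}\in\mathcal{M}_1(\Omega_{\mathrm{loc}})$. *)

theory Defs
  imports "HOL-Probability.Probability"
begin

abbreviation locsp :: "'x::euclidean_space set \<Rightarrow> 'x measure" where
  "locsp Om \<equiv> restrict_space borel Om"

definition M1 :: "'x::euclidean_space set \<Rightarrow> 'x measure set" where
  "M1 Om = {M. sets M = sets (locsp Om) \<and> prob_space M}"

definition Cp :: "nat \<Rightarrow> 'x::euclidean_space set \<Rightarrow> ('x \<Rightarrow> real) set" where
  "Cp p Om = {g. continuous_on Om g \<and> (\<exists>C. \<forall>x\<in>Om. \<bar>g x\<bar> \<le> C * (1 + norm x ^ p))}"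

definition cpnorm :: "nat \<Rightarrow> 'x::euclidean_space set \<Rightarrow> ('x \<Rightarrow> real) \<Rightarrow> real" where
  "cpnorm p Om g = (SUP x\<in>Om. \<bar>g x\<bar> / (1 + norm x ^ p))"

text \<open>Probability measures with finite p-th moment (all of M1 when p = 0); the
  topology tau_p lives on this set: it is the coarsest topology making all maps
  mu |-> integral g d mu, g in C_p, continuous.\<close>
definition M1p :: "nat \<Rightarrow> 'x::euclidean_space set \<Rightarrow> 'x measure set" where
  "M1p p Om = {M \<in> M1 Om. integrable M (\<lambda>y. norm y ^ p)}"

definition tau :: "nat \<Rightarrow> 'x::euclidean_space set \<Rightarrow> 'x measure topology" where
  "tau p Om = topology_generated_by
     {{M \<in> M1p p Om. integral\<^sup>L M g \<in> U} | g U. g \<in> Cp p Om \<and> open U}"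

definition uhc :: "'a topology \<Rightarrow> 'b topology \<Rightarrow> ('a \<Rightarrow> 'b set) \<Rightarrow> bool" where
  "uhc X Y \<phi> \<longleftrightarrow> (\<forall>U. openin Y U \<longrightarrow> openin X {z \<in> topspace X. \<phi> z \<subseteq> U})"

definition lhc :: "'a topology \<Rightarrow> 'b topology \<Rightarrow> ('a \<Rightarrow> 'b set) \<Rightarrow> bool" where
  "lhc X Y \<phi> \<longleftrightarrow> (\<forall>U. openin Y U \<longrightarrow> openin X {z \<in> topspace X. \<phi> z \<inter> U \<noteq> {}})"

definition Aloc :: "'x::euclidean_space set \<Rightarrow> 'u::euclidean_space set \<Rightarrow> ('x \<Rightarrow> 'u) set" where
  "Aloc Om A = measurable (locsp Om) (restrict_space borel A)"

text \<open>Policies (a_t(X_t))_t, represented by the sequence of maps a_t.\<close>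
definition Apol :: "'x::euclidean_space set \<Rightarrow> 'u::euclidean_space set \<Rightarrow> (nat \<Rightarrow> 'x \<Rightarrow> 'u) set" where
  "Apol Om A = {a. \<forall>t. a t \<in> Aloc Om A}"

definition Kset :: "'x::euclidean_space set \<Rightarrow> ('x \<Rightarrow> 'u \<Rightarrow> 'x measure set) \<Rightarrow> ('x \<Rightarrow> 'u)
    \<Rightarrow> ('x \<Rightarrow> 'x measure) set" where
  "Kset Om Pc a = {K \<in> measurable (locsp Om) (prob_algebra (locsp Om)). \<forall>x\<in>Om. K x \<in> Pc x (a x)}"

text \<open>Finite-dimensional distributions of delta_x (x) K_0 (x) K_1 (x) ... on the
  coordinates 0..n (K_t is the transition kernel from omega_t to omega_(t+1)).\<close>
fun fdd :: "'x::euclidean_space set \<Rightarrow> 'x \<Rightarrow> (nat \<Rightarrow> 'x \<Rightarrow> 'x measure) \<Rightarrow> nat \<Rightarrow> (nat \<Rightarrow> 'x) measure" where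
  "fdd Om x K 0 = distr (return (locsp Om) x) (PiM {..0} (\<lambda>_. locsp Om)) (\<lambda>y. (\<lambda>i\<in>{..0}. y))"
| "fdd Om x K (Suc n) = bind (fdd Om x K n)
      (\<lambda>\<omega>. distr (K n (\<omega> n)) (PiM {..Suc n} (\<lambda>_. locsp Om))
              (\<lambda>y. (\<lambda>i\<in>{..Suc n}. if i = Suc n then y else \<omega> i)))"

text \<open>The measure delta_x (x) K_0 (x) K_1 (x) ... on (Om^N, product sigma-field):
  the (unique) probability measure on the path space with these finite-dimensional
  distributions (Ionescu-Tulcea).\<close>
definition pathmeas :: "'x::euclidean_space set \<Rightarrow> 'x \<Rightarrow> (nat \<Rightarrow> 'x \<Rightarrow> 'x measure) \<Rightarrow> (nat \<Rightarrow> 'x) measure" where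
  "pathmeas Om x K = (THE M. sets M = sets (PiM UNIV (\<lambda>_. locsp Om)) \<and> prob_space M \<and>
      (\<forall>n. distr M (PiM {..n} (\<lambda>_. locsp Om)) (\<lambda>\<omega>. restrict \<omega> {..n}) = fdd Om x K n))"

definition Pfrak :: "'x::euclidean_space set \<Rightarrow> ('x \<Rightarrow> 'u \<Rightarrow> 'x measure set) \<Rightarrow> 'x
    \<Rightarrow> (nat \<Rightarrow> 'x \<Rightarrow> 'u) \<Rightarrow> (nat \<Rightarrow> 'x) measure set" where
  "Pfrak Om Pc x a = {pathmeas Om x K | K. \<forall>t. K t \<in> measurable (locsp Om) (prob_algebra (locsp Om))
                                              \<and> (\<forall>y\<in>Om. K t y \<in> Pc y (a t y))}"

definition stageval :: "('x \<Rightarrow> 'u \<Rightarrow> 'x \<Rightarrow> real) \<Rightarrow> real \<Rightarrow> ('x \<Rightarrow> real) \<Rightarrow> 'x \<Rightarrow> 'u \<Rightarrow> 'x measure \<Rightarrow> real" where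
  "stageval r \<alpha> v x a Q = integral\<^sup>L Q (\<lambda>y. r x a y + \<alpha> * v y)"

definition Tb :: "'u set \<Rightarrow> ('x \<Rightarrow> 'u \<Rightarrow> 'x measure set) \<Rightarrow> ('x \<Rightarrow> 'u \<Rightarrow> 'x \<Rightarrow> real) \<Rightarrow> real
    \<Rightarrow> ('x \<Rightarrow> real) \<Rightarrow> 'x \<Rightarrow> real" where
  "Tb A Pc r \<alpha> v x = (SUP a\<in>A. INF Q\<in>Pc x a. stageval r \<alpha> v x a Q)"

definition totrew :: "('x \<Rightarrow> 'u \<Rightarrow> 'x \<Rightarrow> real) \<Rightarrow> real \<Rightarrow> (nat \<Rightarrow> 'x \<Rightarrow> 'u) \<Rightarrow> (nat \<Rightarrow> 'x) \<Rightarrow> real" where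
  "totrew r \<alpha> a \<omega> = (\<Sum>t. \<alpha> ^ t * r (\<omega> t) (a t (\<omega> t)) (\<omega> (Suc t)))"

definition Vfun :: "'x::euclidean_space set \<Rightarrow> 'u::euclidean_space set \<Rightarrow> ('x \<Rightarrow> 'u \<Rightarrow> 'x measure set)
    \<Rightarrow> ('x \<Rightarrow> 'u \<Rightarrow> 'x \<Rightarrow> real) \<Rightarrow> real \<Rightarrow> 'x \<Rightarrow> real" where
  "Vfun Om A Pc r \<alpha> x = (SUP a\<in>Apol Om A. INF P\<in>Pfrak Om Pc x a. integral\<^sup>L P (totrew r \<alpha> a))"

definition optkernel :: "'x::euclidean_space set \<Rightarrow> 'u::euclidean_space set \<Rightarrow> ('x \<Rightarrow> 'u \<Rightarrow> 'x measure set)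
    \<Rightarrow> ('x \<Rightarrow> 'u \<Rightarrow> 'x \<Rightarrow> real) \<Rightarrow> real \<Rightarrow> ('x \<Rightarrow> real) \<Rightarrow> ('x \<times> 'u \<Rightarrow> 'x measure) \<Rightarrow> bool" where
  "optkernel Om A Pc r \<alpha> v P0 \<longleftrightarrow>
     P0 \<in> measurable (restrict_space borel (Om \<times> A)) (prob_algebra (locsp Om)) \<and>
     (\<forall>x\<in>Om. \<forall>a\<in>A. P0 (x, a) \<in> Pc x a \<and>
        stageval r \<alpha> v x a (P0 (x, a)) = (INF Q\<in>Pc x a. stageval r \<alpha> v x a Q))"

definition optaction :: "'x::euclidean_space set \<Rightarrow> 'u::euclidean_space set \<Rightarrow> ('x \<Rightarrow> 'u \<Rightarrow> 'x measure set)
    \<Rightarrow> ('x \<Rightarrow> 'u \<Rightarrow> 'x \<Rightarrow> real) \<Rightarrow> real \<Rightarrow> ('x \<Rightarrow> real) \<Rightarrow> ('x \<Rightarrow> 'u) \<Rightarrow> bool" where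
  "optaction Om A Pc r \<alpha> v as \<longleftrightarrow> as \<in> Aloc Om A \<and>
     (\<forall>x\<in>Om. (INF Q\<in>Pc x (as x). stageval r \<alpha> v x (as x) Q)
            = (SUP a'\<in>Aloc Om A. INF Q\<in>Pc x (a' x). stageval r \<alpha> v x (a' x) Q))"

end

theory Submission
  imports Defs
begin

text \<open>
  Berge's maximum theorem makes the inner infimum continuous in state and action and \<open>\<T> v\<close>
  continuous in the state; (A1)(ii) makes \<open>\<T>\<close> a contraction for the weighted norm.
  Measurable minimisers are obtained without a general selection theorem: minimise the objective
  over the compact set \<open>\<P>(x,a)\<close>, then, among its minimisers, successively the integrals of a
  countable family of continuous functions that determines measurability of kernels. Each iterated
  minimum is a limit of penalised minima \<open>INF (h + k f) - k INF f\<close> over the previous set, hence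
  measurable, and compactness leaves a common minimiser. The same argument, with the coordinates of
  \<open>a\<close> in place of the integrals, selects the optimal action.
  For (iii), the path measures are Ionescu-Tulcea limits. If \<open>v = \<T> v\<close>, then
  \<open>E[r(X\<^sub>t, a\<^sub>t, X\<^sub>t\<^sub>+\<^sub>1) + \<alpha> v(X\<^sub>t\<^sub>+\<^sub>1) | X\<^sub>t]\<close> is at least \<open>v(X\<^sub>t)\<close> for the optimal action under every
  admissible kernel, and at most \<open>v(X\<^sub>t)\<close> for every action under the minimising kernel. The
  discounted sum telescopes, and \<open>\<alpha>\<^sup>n E[v(X\<^sub>n)]\<close> vanishes because \<open>\<alpha> C\<^sub>P < 1\<close>.
\<close>

section \<open>Measurable selection by lexicographic minimisation\<close>

text \<open>\<open>tau\<close> enters only as the coarsest topology that makes integrals of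
  \<open>Cp\<close> functions continuous; no metric or Hausdorff property of it is invoked, so
  compactness of the values is the one source of minimisers. Argmin sets need not vary continuously
  with the parameter, so Berge's theorem does not apply to infima over them. The penalty limit sends
  every such infimum back to infima over the original correspondence, at the price of replacing an
  objective \<open>h\<close> by \<open>h + k f\<close>; hence the insistence on classes of
  objectives closed under such combinations. Integrands have to move uniformly in the next state
  relative to the weight 1 + |y|^p, because the moment bound then controls the effect for every
  admissible measure at once. Functions live on the whole type while only their values on
  \<open>Om\<close> matter, so the fixed point is constructed by hand and equalities on
  \<open>Om\<close> replace equalities of functions.\<close>

lemma compactin_attains_inf_real:
  fixes f :: "'y \<Rightarrow> real"
  assumes "compactin Y S" "S \<noteq> {}" "continuous_map Y euclideanreal f"
  obtains y where "y \<in> S" "f y = (INF y\<in>S. f y)" "\<And>y'. y' \<in> S \<Longrightarrow> f y \<le> f y'"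
proof -
  have "compact (f ` S)"
    using image_compactin[OF assms(1,3)] by simp
  then obtain y where y: "y \<in> S" "\<And>y'. y' \<in> S \<Longrightarrow> f y \<le> f y'"
    using compact_attains_inf[of "f ` S"] assms(2) by auto
  moreover have "(INF y\<in>S. f y) = f y"
    using y by (intro cInf_eq_minimum) auto
  ultimately show thesis using that by simp
qed

lemma compactin_bdd_below_image_real:
  fixes f :: "'y \<Rightarrow> real"
  assumes "compactin Y S" "continuous_map Y euclideanreal f"
  shows "bdd_below (f ` S)"
  using image_compactin[OF assms] by (auto intro: bounded_imp_bdd_below compact_imp_bounded)

lemma compactin_argmin:
  fixes f :: "'y \<Rightarrow> real"
  assumes "compactin Y S" "S \<noteq> {}" "continuous_map Y euclideanreal f"
  shows "compactin Y {y\<in>S. f y = (INF y\<in>S. f y)}" "{y\<in>S. f y = (INF y\<in>S. f y)} \<noteq> {}"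
proof -
  let ?m = "INF y\<in>S. f y"
  have "closedin Y {y \<in> topspace Y. f y \<in> {?m}}"
    by (rule closedin_continuous_map_preimage[OF assms(3)]) auto
  then have "compactin Y (S \<inter> {y \<in> topspace Y. f y \<in> {?m}})"
    using assms(1) compact_Int_closedin by blast
  also have "S \<inter> {y \<in> topspace Y. f y \<in> {?m}} = {y\<in>S. f y = ?m}"
    using compactin_subset_topspace[OF assms(1)] by auto
  finally show "compactin Y {y\<in>S. f y = ?m}" .
  show "{y\<in>S. f y = ?m} \<noteq> {}"
    using compactin_attains_inf_real[OF assms] by (metis (mono_tags, lifting) empty_iff mem_Collect_eq)
qed

text \<open>A minimiser of \<open>f\<close> makes the penalty \<open>k (f - m)\<close> vanish, so no
  penalised infimum exceeds the limit. Conversely, the points where \<open>h\<close> lies clearly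
  below the limit form a compact set that misses the argmin, so \<open>f - m\<close> is bounded away
  from zero there and a large \<open>k\<close> rules them out.\<close>

lemma INF_penalty_tendsto_INF_argmin:
  fixes f h :: "'y \<Rightarrow> real"
  assumes S: "compactin Y S" "S \<noteq> {}"
    and f: "continuous_map Y euclideanreal f" and h: "continuous_map Y euclideanreal h"
  defines "m \<equiv> (INF y\<in>S. f y)"
  shows "(\<lambda>k. (INF y\<in>S. h y + real k * f y) - real k * m) \<longlonglongrightarrow> (INF y\<in>{y\<in>S. f y = m}. h y)"
proof -
  define S' where "S' = {y\<in>S. f y = m}"
  define I where "I = (INF y\<in>S'. h y)"
  have S': "compactin Y S'" "S' \<noteq> {}" "S' \<subseteq> S"
    using compactin_argmin[OF S f] by (auto simp: S'_def m_def)
  obtain y0 where y0: "y0 \<in> S'" "h y0 = I"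
    using compactin_attains_inf_real[OF S'(1,2) h] unfolding I_def by metis
  obtain y1 where y1: "y1 \<in> S" "\<And>y. y \<in> S \<Longrightarrow> h y1 \<le> h y"
    using compactin_attains_inf_real[OF S h] by metis
  have fm: "m \<le> f y" if "y \<in> S" for y
    unfolding m_def by (rule cINF_lower[OF compactin_bdd_below_image_real[OF S(1) f] that])
  have hk: "continuous_map Y euclideanreal (\<lambda>y. h y + real k * f y)" for k
    by (intro continuous_intros f h)
  have upper: "(INF y\<in>S. h y + real k * f y) - real k * m \<le> I" for k
  proof -
    have "(INF y\<in>S. h y + real k * f y) \<le> h y0 + real k * f y0"
      using compactin_bdd_below_image_real[OF S(1) hk] y0 S' by (intro cINF_lower) auto
    then show ?thesis using y0 by (simp add: S'_def)
  qed
  have lower: "\<forall>\<^sub>F k in sequentially. I - e < (INF y\<in>S. h y + real k * f y) - real k * m"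
    if e: "e > 0" for e
  proof -
    define T where "T = S \<inter> {y \<in> topspace Y. h y \<in> {..I - e}}"
    have "closedin Y {y \<in> topspace Y. h y \<in> {..I - e}}"
      by (rule closedin_continuous_map_preimage[OF h]) auto
    then have T: "compactin Y T"
      unfolding T_def using S(1) compact_Int_closedin by blast
    \<comment> \<open>For empty \<open>T\<close> any gap serves. Otherwise the minimum of
      \<open>f\<close> over \<open>T\<close> is attained, and attaining \<open>m\<close> there would
      put an argmin point below the infimum \<open>I\<close> of \<open>h\<close>.\<close>
    have "\<exists>d>0. \<forall>y\<in>T. m + d \<le> f y"
    proof (cases "T = {}")
      case False
      obtain t where t: "t \<in> T" "\<And>y. y \<in> T \<Longrightarrow> f t \<le> f y"
        using compactin_attains_inf_real[OF T False f] by metis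
      have "f t \<noteq> m"
      proof
        assume "f t = m"
        then have "t \<in> S'" using t by (auto simp: S'_def T_def)
        then have "I \<le> h t"
          unfolding I_def by (intro cINF_lower compactin_bdd_below_image_real[OF S'(1) h])
        then show False using t e by (auto simp: T_def)
      qed
      moreover have "m \<le> f t" using fm t by (auto simp: T_def)
      ultimately show ?thesis
        using t by (intro exI[of _ "f t - m"]) auto
    qed (auto intro: exI[of _ 1])
    then obtain d where d: "d > 0" "\<And>y. y \<in> T \<Longrightarrow> m + d \<le> f y" by auto
    \<comment> \<open>\<open>h y1\<close> is the least that \<open>h\<close> can contribute on
      \<open>S\<close>, so a penalty above \<open>I - h y1\<close> compensates for it at every point
      of \<open>T\<close>.\<close>
    obtain N where N: "real N > (I - h y1) / d"
      using reals_Archimedean2 by blast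
    show ?thesis
    proof (rule eventually_sequentiallyI[of N])
      fix k assume k: "k \<ge> N"
      obtain y where y: "y \<in> S" "h y + real k * f y = (INF y\<in>S. h y + real k * f y)"
        using compactin_attains_inf_real[OF S hk] by metis
      have "I - e < h y + real k * (f y - m)"
      proof (cases "y \<in> T")
        case True
        have "(I - h y1) < real N * d" using N d(1) by (simp add: field_simps)
        also have "\<dots> \<le> real k * (f y - m)"
          using k d(1) d(2)[OF True] by (intro mult_mono) auto
        finally show ?thesis using y1(2)[OF y(1)] e by linarith
      next
        case False
        then have "I - e < h y"
          using y compactin_subset_topspace[OF S(1)] by (auto simp: T_def)
        moreover have "0 \<le> real k * (f y - m)" using fm[OF y(1)] by simp
        ultimately show ?thesis by linarith
      qed
      then show "I - e < (INF y\<in>S. h y + real k * f y) - real k * m"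
        using y(2) by (simp add: algebra_simps)
    qed
  qed
  show ?thesis
    unfolding S'_def[symmetric] I_def[symmetric]
  proof (rule order_tendstoI)
    fix a assume "a < I"
    with lower[of "I - a"] show "\<forall>\<^sub>F k in sequentially. a < (INF y\<in>S. h y + real k * f y) - real k * m"
      by simp
  next
    fix a assume "I < a"
    then have "(INF y\<in>S. h y + real k * f y) - real k * m < a" for k
      using upper[of k] by simp
    then show "\<forall>\<^sub>F k in sequentially. (INF y\<in>S. h y + real k * f y) - real k * m < a"
      by simp
  qed
qed

text \<open>By nestedness inside \<open>S\<close>, the member of largest index lies in the whole of
  a finite subfamily, and the finite intersection property does the rest.\<close>

lemma decseq_compactin_INT_nonempty:
  assumes cl: "\<And>n. closedin Y (C n)" and S: "compactin Y S"
    and ne: "\<And>n. S \<inter> C n \<noteq> {}" and dec: "\<And>m n. m \<le> n \<Longrightarrow> S \<inter> C n \<subseteq> C m"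
  shows "S \<inter> (\<Inter>n::nat. C n) \<noteq> {}"
proof -
  have "S \<inter> \<Inter>\<F> \<noteq> {}" if F: "finite \<F>" "\<F> \<subseteq> range C" for \<F>
  proof -
    obtain J where J: "finite J" "\<F> = C ` J"
      using F by (meson finite_subset_image)
    \<comment> \<open>Inserting 0 keeps the maximum defined for the empty family.\<close>
    define n where "n = Max (insert 0 J)"
    have "S \<inter> C n \<subseteq> C j" if "j \<in> J" for j
      using J(1) that by (intro dec) (simp add: n_def)
    then have "S \<inter> C n \<subseteq> \<Inter>\<F>"
      unfolding J(2) by blast
    then show ?thesis using ne[of n] by blast
  qed
  moreover have "\<forall>C\<in>range C. closedin Y C" using cl by blast
  ultimately show ?thesis
    using S[unfolded compactin_fip, THEN conjunct2, rule_format, of "range C"] by simp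
qed

text \<open>Minimise \<open>f 0\<close>, \<open>f 1\<close>, \<dots> lexicographically; measurability of the successive minima is
  inherited through the penalty limit.\<close>
lemma measurable_lexicographic_selection:
  fixes M :: "'z measure" and \<phi> :: "'z \<Rightarrow> 'y set" and H :: "('z \<Rightarrow> 'y \<Rightarrow> real) set"
  assumes cpt: "\<And>z. z \<in> space M \<Longrightarrow> compactin Y (\<phi> z)" "\<And>z. z \<in> space M \<Longrightarrow> \<phi> z \<noteq> {}"
    and cont: "\<And>h z. h \<in> H \<Longrightarrow> z \<in> space M \<Longrightarrow> continuous_map Y euclideanreal (h z)"
    and closed: "\<And>h g k. h \<in> H \<Longrightarrow> g \<in> H \<Longrightarrow> (\<lambda>z y. h z y + real k * g z y) \<in> H"
    and meas: "\<And>h. h \<in> H \<Longrightarrow> (\<lambda>z. INF y\<in>\<phi> z. h z y) \<in> borel_measurable M"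
    and f: "\<And>n::nat. f n \<in> H"
  obtains s where "\<And>z. z \<in> space M \<Longrightarrow> s z \<in> \<phi> z"
    "\<And>z. z \<in> space M \<Longrightarrow> f 0 z (s z) = (INF y\<in>\<phi> z. f 0 z y)"
    "\<And>n. (\<lambda>z. f n z (s z)) \<in> borel_measurable M"
proof -
  \<comment> \<open>\<open>S n z\<close> has been cut down by the objectives with index below
    \<open>n\<close>, so the minimum of \<open>f n\<close> is taken over \<open>S n z\<close>, and
    minimisers of \<open>f n\<close> are singled out only in \<open>S (Suc n) z\<close>.\<close>
  define S where "S = rec_nat \<phi> (\<lambda>n T z. {y\<in>T z. f n z y = (INF y\<in>T z. f n z y)})"
  have S_0: "S 0 = \<phi>" and S_Suc: "S (Suc n) z = {y\<in>S n z. f n z y = (INF y\<in>S n z. f n z y)}" for n z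
    by (simp_all add: S_def)
  have S_cpt: "compactin Y (S n z) \<and> S n z \<noteq> {}" if z: "z \<in> space M" for n z
  proof (induction n)
    case (Suc n)
    then show ?case
      unfolding S_Suc using compactin_argmin[OF _ _ cont[OF f z]] by blast
  qed (simp add: S_0 cpt z)
  \<comment> \<open>The claim is proved for all of \<open>H\<close> at once: one stage later, the
    infimum of \<open>h\<close> is a limit of infima of \<open>h + k f n\<close> over the earlier
    sets.\<close>
  have S_meas: "(\<lambda>z. INF y\<in>S n z. h z y) \<in> borel_measurable M" if "h \<in> H" for n h
    using that
  proof (induction n arbitrary: h)
    case (Suc n)
    have [measurable]: "(\<lambda>z. (INF y\<in>S n z. h z y + real k * f n z y) - real k * (INF y\<in>S n z. f n z y))
      \<in> borel_measurable M" for k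
      using Suc.IH[OF closed[OF Suc.prems f]] Suc.IH[OF f] by measurable
    show ?case
    proof (rule borel_measurable_LIMSEQ_real)
      fix z assume "z \<in> space M"
      then show "(\<lambda>k. (INF y\<in>S n z. h z y + real k * f n z y) - real k * (INF y\<in>S n z. f n z y))
          \<longlonglongrightarrow> (INF y\<in>S (Suc n) z. h z y)"
        unfolding S_Suc using S_cpt Suc.prems
        by (intro INF_penalty_tendsto_INF_argmin[of Y]) (auto intro: cont f)
    qed measurable
  qed (simp add: S_0 meas)
  have S_dec: "S n z \<subseteq> S m z" if "m \<le> n" for m n z
    using that by (induction rule: dec_induct) (auto simp: S_Suc)
  have "\<exists>y. \<forall>n. y \<in> S n z" if z: "z \<in> space M" for z
  proof -
    \<comment> \<open>Compact sets need not be closed in \<open>Y\<close>, so the finite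
      intersection argument is run with these closed sets, whose traces on \<open>S 0 z\<close> are
      the \<open>S n z\<close>.\<close>
    define C where "C n = {y \<in> topspace Y. \<forall>i<n. f i z y \<in> {INF y\<in>S i z. f i z y}}" for n
    have SC: "S n z = S 0 z \<inter> C n" for n
      using compactin_subset_topspace[OF cpt(1)[OF z]]
      by (induction n) (auto simp: C_def S_0 S_Suc less_Suc_eq)
    have "closedin Y (C n)" for n
    proof -
      have "C n = topspace Y \<inter> (\<Inter>i\<in>{..<n}. {y \<in> topspace Y. f i z y \<in> {INF y\<in>S i z. f i z y}})"
        by (auto simp: C_def)
      also have "closedin Y \<dots>"
      proof (cases "n = 0")
        case False
        have "closedin Y {y \<in> topspace Y. f i z y \<in> {INF y\<in>S i z. f i z y}}" for i
          by (rule closedin_continuous_map_preimage[OF cont[OF f z]]) simp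
        with False show ?thesis by (intro closedin_Int closedin_INT) auto
      qed simp
      finally show ?thesis .
    qed
    then have "S 0 z \<inter> (\<Inter>n. C n) \<noteq> {}"
      using S_cpt[OF z] SC S_dec by (intro decseq_compactin_INT_nonempty[of Y]) blast+
    then show ?thesis using SC by blast
  qed
  then obtain s where s: "\<And>z n. z \<in> space M \<Longrightarrow> s z \<in> S n z" by metis
  \<comment> \<open>Surviving stage \<open>Suc n\<close> pins the value of \<open>f n\<close> to the
    stage minimum, whichever common minimiser was picked; this is how a mere choice function
    acquires measurable values.\<close>
  have eq: "f n z (s z) = (INF y\<in>S n z. f n z y)" if "z \<in> space M" for n z
    using s[OF that, of "Suc n"] by (simp add: S_Suc)
  show thesis
  proof (rule that)
    show "s z \<in> \<phi> z" if "z \<in> space M" for z using s[OF that, of 0] by (simp add: S_0)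
    show "f 0 z (s z) = (INF y\<in>\<phi> z. f 0 z y)" if "z \<in> space M" for z
      using eq[OF that, of 0] by (simp add: S_0)
    show "(\<lambda>z. f n z (s z)) \<in> borel_measurable M" for n
      using S_meas[OF f] eq by (subst measurable_cong[OF eq]) auto
  qed
qed

text \<open>Near \<open>x0\<close> the parameters lie in a compact piece of \<open>X\<close>, so
  \<open>h\<close> is uniformly continuous on its product with \<open>A\<close> and
  \<open>h (x, a)\<close> moves by less than e/2 for all \<open>a\<close> simultaneously; each
  minimiser is then tested at the other parameter. This serves the choice of actions, where the
  constraint set is constant.\<close>

lemma continuous_on_INF_compact:
  fixes h :: "'a::heine_borel \<times> 'b::heine_borel \<Rightarrow> real"
  assumes X: "closed X" and A: "compact A" "A \<noteq> {}" and h: "continuous_on (X \<times> A) h"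
  shows "continuous_on X (\<lambda>x. INF a\<in>A. h (x, a))"
  unfolding continuous_on_iff
proof (intro ballI allI impI)
  fix x e :: real and x0 assume x0: "x0 \<in> X" and e: "(0::real) < e"
  define K where "K = (cball x0 1 \<inter> X) \<times> A"
  have "compact K"
    unfolding K_def by (intro compact_Times compact_Int_closed X A compact_cball)
  moreover have "continuous_on K h"
    by (rule continuous_on_subset[OF h]) (auto simp: K_def)
  ultimately have "uniformly_continuous_on K h"
    by (rule compact_uniformly_continuous[rotated])
  then obtain d where d: "d > 0" "\<And>u u'. u \<in> K \<Longrightarrow> u' \<in> K \<Longrightarrow> dist u' u < d \<Longrightarrow> dist (h u') (h u) < e / 2"
    unfolding uniformly_continuous_on_def using e by (metis half_gt_zero)
  have att: "\<exists>a\<in>A. h (x, a) = (INF a\<in>A. h (x, a)) \<and> (\<forall>b\<in>A. h (x, a) \<le> h (x, b))" if "x \<in> X" for x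
  proof -
    have "continuous_on A (\<lambda>a. h (x, a))"
      using that by (intro continuous_on_compose2[OF h] continuous_intros) auto
    then have "continuous_map (top_of_set A) euclideanreal (\<lambda>a. h (x, a))"
      by simp
    moreover have "compactin (top_of_set A) A"
      using A by (simp add: compactin_subtopology)
    ultimately show ?thesis
      using compactin_attains_inf_real[of "top_of_set A" A "\<lambda>a. h (x, a)"] A by metis
  qed
  show "\<exists>d>0. \<forall>x'\<in>X. dist x' x0 < d \<longrightarrow> dist (INF a\<in>A. h (x', a)) (INF a\<in>A. h (x0, a)) < e"
  proof (intro exI[of _ "min d 1"] conjI ballI impI)
    fix x assume x: "x \<in> X" "dist x x0 < min d 1"
    have close: "\<bar>h (x, a) - h (x0, a)\<bar> < e / 2" if "a \<in> A" for a
      using d(2)[of "(x0, a)" "(x, a)"] x x0 that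
      by (simp add: K_def dist_Pair_Pair dist_real_def dist_commute)
    obtain a where a: "a \<in> A" "h (x, a) = (INF a\<in>A. h (x, a))" "\<And>b. b \<in> A \<Longrightarrow> h (x, a) \<le> h (x, b)"
      using att[OF x(1)] by blast
    obtain b where b: "b \<in> A" "h (x0, b) = (INF a\<in>A. h (x0, a))" "\<And>c. c \<in> A \<Longrightarrow> h (x0, b) \<le> h (x0, c)"
      using att[OF x0] by blast
    show "dist (INF a\<in>A. h (x, a)) (INF a\<in>A. h (x0, a)) < e"
      using a(3)[OF b(1)] b(3)[OF a(1)] close[OF a(1)] close[OF b(1)] e
      unfolding a(2)[symmetric] b(2)[symmetric] dist_real_def by linarith
  qed (use d in auto)
qed

section \<open>Countably many test functions for the measurability of kernels\<close>

text \<open>A countable basis need not be a pi-system; closing it under finite intersections makes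
  it one without losing countability.\<close>

lemma Int_stable_countable_generator_borel:
  obtains G :: "'a::second_countable_topology set set"
  where "countable G" "G \<noteq> {}" "\<And>U. U \<in> G \<Longrightarrow> open U" "Int_stable G" "sets borel = sigma_sets UNIV G"
proof -
  obtain B :: "'a set set" where B: "countable B" "topological_basis B"
    using ex_countable_basis by blast
  define G where "G = Inter ` {F. finite F \<and> F \<subseteq> B}"
  have countable: "countable G"
    unfolding G_def by (intro countable_image countable_Collect_finite_subset B)
  have op: "open U" if "U \<in> G" for U
    using that B(2) by (auto simp: G_def topological_basis_open intro!: open_Inter)
  have "B \<subseteq> G"
    unfolding G_def by (auto intro!: image_eqI[of _ _ "{_}"])
  then have "topological_basis G"
    using B(2) op unfolding topological_basis_def by (meson subset_trans)
  then have "sets borel = sigma_sets UNIV G"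
    using borel_eq_countable_basis[OF countable] sets_measure_of[of G UNIV] by (metis Pow_UNIV top_greatest)
  moreover have "Int_stable G"
  proof (rule Int_stableI)
    fix U V assume "U \<in> G" "V \<in> G"
    then obtain E F where "finite E" "E \<subseteq> B" "U = \<Inter>E" "finite F" "F \<subseteq> B" "V = \<Inter>F"
      by (auto simp: G_def)
    then show "U \<inter> V \<in> G"
      unfolding G_def by (intro image_eqI[of _ _ "E \<union> F"]) auto
  qed
  moreover have "G \<noteq> {}" by (auto simp: G_def)
  ultimately show thesis using that countable op by blast
qed

lemma open_indicator_limit_continuous:
  fixes U :: "'a::metric_space set"
  assumes "open U"
  obtains g :: "nat \<Rightarrow> 'a \<Rightarrow> real"
  where "\<And>k. continuous_on UNIV (g k)" "\<And>k x. 0 \<le> g k x" "\<And>k x. g k x \<le> 1"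
    "\<And>x. (\<lambda>k. g k x) \<longlonglongrightarrow> indicator U x"
proof (cases "U = UNIV")
  \<comment> \<open>\<open>infdist\<close> to the empty set is 0 by convention, so the truncated
    distance used for proper open sets would give the zero function here.\<close>
  case True
  show thesis by (rule that[of "\<lambda>_ _. 1"]) (auto simp: True)
next
  case False
  define g where "g k x = min 1 (real k * infdist x (- U))" for k x
  show thesis
  proof (rule that[of g])
    show "continuous_on UNIV (g k)" for k
      unfolding g_def by (intro continuous_intros)
    show "0 \<le> g k x" "g k x \<le> 1" for k x by (auto simp: g_def infdist_nonneg)
    fix x
    show "(\<lambda>k. g k x) \<longlonglongrightarrow> indicator U x"
    proof (cases "x \<in> U")
      case True
      have "closed (- U)" "- U \<noteq> {}" using assms False by auto
      then have pos: "infdist x (- U) > 0"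
        using infdist_pos_not_in_closed[of "- U" x] True by simp
      obtain N where N: "real N > 1 / infdist x (- U)"
        using reals_Archimedean2 by blast
      have "g k x = 1" if "k \<ge> N" for k
      proof -
        have "1 < real N * infdist x (- U)" using N pos by (simp add: field_simps)
        also have "\<dots> \<le> real k * infdist x (- U)" using that pos by (intro mult_right_mono) auto
        finally show ?thesis by (simp add: g_def)
      qed
      then have "\<forall>\<^sub>F k in sequentially. g k x = indicator U x"
        using True by (auto simp: eventually_sequentially)
      then show ?thesis by (rule tendsto_eventually)
    qed (simp add: g_def)
  qed
qed

text \<open>The measures of the sets in a countable pi-system determine measurability into
  \<open>prob_algebra\<close>, and each of them is a limit of integrals of continuous functions with
  values in [0,1]. Continuity and boundedness put these functions into \<open>Cp\<close>, so their
  integrals are admissible objectives for the lexicographic selection.\<close>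

lemma countable_family_measurable_kernel:
  fixes Om :: "'x::euclidean_space set" and M :: "'z measure"
  assumes Om: "Om \<in> sets borel"
  obtains g :: "nat \<Rightarrow> 'x \<Rightarrow> real"
  where "\<And>n. continuous_on UNIV (g n)" "\<And>n x. 0 \<le> g n x" "\<And>n x. g n x \<le> 1"
    "\<And>K. (\<And>z. z \<in> space M \<Longrightarrow> K z \<in> M1 Om) \<Longrightarrow>
      (\<And>n. (\<lambda>z. integral\<^sup>L (K z) (g n)) \<in> borel_measurable M) \<Longrightarrow> K \<in> measurable M (prob_algebra (locsp Om))"
proof -
  obtain G :: "'x set set" where G: "countable G" "G \<noteq> {}" "\<And>U. U \<in> G \<Longrightarrow> open U"
      "Int_stable G" "sets borel = sigma_sets UNIV G"
    by (rule Int_stable_countable_generator_borel) blast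
  have "\<exists>g. (\<forall>k. continuous_on UNIV (g k)) \<and> (\<forall>k x. 0 \<le> g k x \<and> g k x \<le> 1) \<and>
      (\<forall>x. (\<lambda>k. g k x) \<longlonglongrightarrow> (indicator U x :: real))" if "U \<in> G" for U
    using open_indicator_limit_continuous[OF G(3)[OF that]] by metis
  then obtain g where g: "\<And>U k. U \<in> G \<Longrightarrow> continuous_on UNIV (g U k)"
      "\<And>U k x. U \<in> G \<Longrightarrow> 0 \<le> g U k x \<and> g U k x \<le> 1"
      "\<And>U x. U \<in> G \<Longrightarrow> (\<lambda>k. g U k x) \<longlonglongrightarrow> (indicator U x :: real)"
    by metis
  \<comment> \<open>One index encodes a generator together with a stage of its
    approximation.\<close>
  define e where "e n = g (from_nat_into G (fst (prod_decode n))) (snd (prod_decode n))" for n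
  have inG: "from_nat_into G i \<in> G" for i using G(2) by (rule from_nat_into)
  have e: "\<exists>n. e n = g U k" if "U \<in> G" for U k
    using from_nat_into_to_nat_on[OF G(1) that] by (intro exI[of _ "prod_encode (to_nat_on G U, k)"]) (simp add: e_def)
  show thesis
  proof (rule that[of e])
    show "continuous_on UNIV (e n)" "0 \<le> e n x" "e n x \<le> 1" for n x
      using g(1,2)[OF inG] by (auto simp: e_def)
    fix K assume K: "\<And>z. z \<in> space M \<Longrightarrow> K z \<in> M1 Om"
      and int: "\<And>n. (\<lambda>z. integral\<^sup>L (K z) (e n)) \<in> borel_measurable M"
    have Ksets: "sets (K z) = sets (locsp Om)" "prob_space (K z)" if "z \<in> space M" for z
      using K[OF that] by (auto simp: M1_def)
    show "K \<in> measurable M (prob_algebra (locsp Om))"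
    proof (rule measurable_prob_algebra_generated)
      show "sets (locsp Om) = sigma_sets Om ((\<inter>) Om ` G)"
        unfolding sets_restrict_space G(5) using Om G(5) by (intro sigma_sets_Int) auto
      show "Int_stable ((\<inter>) Om ` G)"
      proof (rule Int_stableI)
        fix a b assume "a \<in> (\<inter>) Om ` G" "b \<in> (\<inter>) Om ` G"
        then obtain U V where "U \<in> G" "V \<in> G" "a \<inter> b = Om \<inter> (U \<inter> V)" by auto
        then show "a \<inter> b \<in> (\<inter>) Om ` G"
          using G(4) by (auto simp: Int_stable_def)
      qed
      show "(\<inter>) Om ` G \<subseteq> Pow Om" by auto
      show "prob_space (K z)" "sets (K z) = sets (locsp Om)" if "z \<in> space M" for z
        using Ksets[OF that] by auto
      fix a assume "a \<in> (\<inter>) Om ` G"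
      then obtain U where U: "U \<in> G" "a = Om \<inter> U" by auto
      have aset: "a \<in> sets (locsp Om)"
        using U G(3)[OF U(1)] by (auto simp: sets_restrict_space)
      \<comment> \<open>The integrand is \<open>indicator U\<close> instead of
        \<open>indicator a\<close>, because the approximants converge to it on the whole
        type.\<close>
      have m: "measure (K z) a = (\<integral>y. indicator U y \<partial>K z)" if z: "z \<in> space M" for z
      proof -
        have "space (K z) = Om" using sets_eq_imp_space_eq[OF Ksets(1)[OF z]] by (simp add: space_restrict_space)
        then have "(\<integral>y. indicator U y \<partial>K z) = (\<integral>y. indicator a y \<partial>K z)"
          using U by (intro Bochner_Integration.integral_cong) (auto simp: indicator_def)
        also have "\<dots> = measure (K z) a"
          using aset Ksets(1)[OF z] sets.sets_into_space[of a "K z"] by (simp add: Int_absorb2)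
        finally show ?thesis by simp
      qed
      have "(\<lambda>z. measure (K z) a) \<in> borel_measurable M"
      proof (rule borel_measurable_LIMSEQ_real)
        fix z assume z: "z \<in> space M"
        interpret prob_space "K z" using Ksets(2)[OF z] .
        have bm: "f \<in> borel_measurable (K z)" if "f \<in> borel_measurable borel" for f :: "'x \<Rightarrow> real"
          using that Ksets(1)[OF z] measurable_restrict_space1 measurable_cong_sets by blast
        show "(\<lambda>k. \<integral>y. g U k y \<partial>K z) \<longlonglongrightarrow> measure (K z) a"
          unfolding m[OF z]
        proof (rule integral_dominated_convergence[where w = "\<lambda>_. 1"])
          show "g U k \<in> borel_measurable (K z)" for k
            using g(1)[OF U(1)] by (intro bm borel_measurable_continuous_onI)
          show "(indicator U :: 'x \<Rightarrow> real) \<in> borel_measurable (K z)"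
            using G(3)[OF U(1)] by (intro bm) simp
        qed (use g(2,3)[OF U(1)] in auto)
      next
        fix k
        obtain n where "e n = g U k" using e[OF U(1)] by blast
        then show "(\<lambda>z. \<integral>y. g U k y \<partial>K z) \<in> borel_measurable M"
          using int[of n] by simp
      qed
      then have "(\<lambda>z. ennreal (measure (K z) a)) \<in> borel_measurable M" by measurable
      then show "(\<lambda>z. emeasure (K z) a) \<in> borel_measurable M"
        by (subst measurable_cong[where g = "\<lambda>z. ennreal (measure (K z) a)"])
           (auto intro!: finite_measure.emeasure_eq_measure prob_space.finite_measure Ksets(2))
    qed
  qed
qed

section \<open>Path measures of Markov kernels\<close>

text \<open>Tonelli turns the summable L1 norms into almost sure absolute summability, the pointwise
  hypothesis of \<open>sums_integral\<close>.\<close>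

lemma sums_integral_real:
  fixes f :: "nat \<Rightarrow> 'a \<Rightarrow> real"
  assumes int: "\<And>i. integrable M (f i)" and sm: "summable (\<lambda>i. \<integral>x. \<bar>f i x\<bar> \<partial>M)"
  shows "(\<lambda>i. integral\<^sup>L M (f i)) sums (\<integral>x. (\<Sum>i. f i x) \<partial>M)"
proof (rule sums_integral[OF int])
  have [measurable]: "f i \<in> borel_measurable M" for i using int by (rule borel_measurable_integrable)
  have "(\<integral>\<^sup>+x. (\<Sum>i. ennreal \<bar>f i x\<bar>) \<partial>M) = (\<Sum>i. \<integral>\<^sup>+x. ennreal \<bar>f i x\<bar> \<partial>M)"
    by (rule nn_integral_suminf) measurable
  also have "\<dots> = (\<Sum>i. ennreal (\<integral>x. \<bar>f i x\<bar> \<partial>M))"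
    using int by (intro suminf_cong nn_integral_eq_integral) auto
  also have "\<dots> \<noteq> \<infinity>"
    unfolding infinity_ennreal_def by (rule ennreal_suminf_neq_top[OF sm]) simp
  finally have "AE x in M. (\<Sum>i. ennreal \<bar>f i x\<bar>) \<noteq> \<infinity>"
    by (rule nn_integral_PInf_AE[rotated]) measurable
  then show "AE x in M. summable (\<lambda>i. norm (f i x))"
    by (rule eventually_mono) (simp add: summable_suminf_not_top)
  show "summable (\<lambda>i. \<integral>x. norm (f i x) \<partial>M)" using sm by simp
qed

locale kernel_path =
  fixes Om :: "'x::euclidean_space set" and x :: 'x and K :: "nat \<Rightarrow> 'x \<Rightarrow> 'x measure"
  assumes x: "x \<in> Om" and K: "\<And>t. K t \<in> measurable (locsp Om) (prob_algebra (locsp Om))"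
begin

abbreviation "S \<equiv> locsp Om"

lemma space_S [simp]: "space S = Om" by (simp add: space_restrict_space)

lemma K_subprob [measurable]: "K t \<in> measurable S (subprob_algebra S)"
  using K by (rule measurable_prob_algebraD)

lemma K_prob: "y \<in> Om \<Longrightarrow> prob_space (K t y)"
  using measurable_space[OF K, of y] by (simp add: space_prob_algebra)

lemma sets_K: "y \<in> Om \<Longrightarrow> sets (K t y) = sets S"
  using measurable_space[OF K, of y] by (simp add: space_prob_algebra)

lemma space_K: "y \<in> Om \<Longrightarrow> space (K t y) = Om"
  using sets_eq_imp_space_eq[OF sets_K] by simp

lemma measurable_PiM_coord:
  "t \<in> I \<Longrightarrow> f \<in> measurable S L \<Longrightarrow> (\<lambda>\<omega>. f (\<omega> t)) \<in> measurable (PiM I (\<lambda>_. S)) L"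
  by (rule measurable_compose[of "\<lambda>\<omega>. \<omega> t" _ S]) (auto intro: measurable_component_singleton)

text \<open>In the Ionescu-Tulcea construction kernel \<open>i\<close> produces coordinate
  \<open>i\<close> from the coordinates below \<open>i\<close>, so \<open>K j\<close> sits at index
  \<open>Suc j\<close> and index 0 holds the Dirac measure at \<open>x\<close>.\<close>

definition IT_kernel :: "nat \<Rightarrow> (nat \<Rightarrow> 'x) \<Rightarrow> 'x measure" where
  "IT_kernel i \<omega> = (case i of 0 \<Rightarrow> return S x | Suc j \<Rightarrow> K j (\<omega> j))"

sublocale IT: Ionescu_Tulcea IT_kernel "\<lambda>_. S"
proof (rule Ionescu_Tulcea.intro, goal_cases)
  case (1 i)
  show ?case
  proof (cases i)
    case 0
    have "return S x \<in> space (subprob_algebra S)"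
      using x by (simp add: space_subprob_algebra prob_space_imp_subprob_space prob_space_return)
    then show ?thesis by (simp add: IT_kernel_def[abs_def] 0)
  next
    case (Suc j)
    then show ?thesis
      by (auto simp: IT_kernel_def[abs_def] intro!: measurable_PiM_coord K_subprob)
  qed
next
  case (2 i \<omega>)
  show ?case
  proof (cases i)
    case 0
    then show ?thesis using prob_space_return[of x S] x by (simp add: IT_kernel_def)
  next
    case (Suc j)
    with 2 have "\<omega> j \<in> Om" by (auto simp: space_PiM PiE_iff)
    then show ?thesis using K_prob[of "\<omega> j" j] Suc by (simp add: IT_kernel_def)
  qed
qed

text \<open>\<open>IT.C 0 (Suc n)\<close> builds the \<open>Suc n\<close> coordinates 0 to n, hence
  the shift. The function \<open>\<lambda>_. undefined\<close> is the only point of the product over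
  the empty index set and stands for the empty history.\<close>

lemma IT_C_eq_fdd: "IT.C 0 (Suc n) (\<lambda>_. undefined) = fdd Om x K n"
proof (induction n)
  case 0
  have "IT.C 0 (Suc 0) (\<lambda>_. undefined) = IT.eP 0 (\<lambda>_. undefined)"
    using bind_return[OF IT.measurable_eP[of 0], of "\<lambda>_. undefined"] by (simp add: space_PiM)
  also have "\<dots> = fdd Om x K 0"
    by (simp add: IT.eP_def IT_kernel_def) (rule distr_cong, auto simp: fun_eq_iff)
  finally show ?case .
next
  case (Suc n)
  have u: "(\<lambda>_. undefined) \<in> space (PiM {0..<0} (\<lambda>_::nat. S))" by (simp add: space_PiM)
  have sp: "space (IT.C 0 (Suc n) (\<lambda>_. undefined)) = space (PiM {..n} (\<lambda>_. S))"
    using IT.space_C[OF u, of "Suc n"] by (simp add: atLeast0LessThan lessThan_Suc_atMost)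
  have "IT.C 0 (Suc (Suc n)) (\<lambda>_. undefined) = IT.C 0 (Suc n) (\<lambda>_. undefined) \<bind> IT.eP (Suc n)"
    by simp
  also have "\<dots> = fdd Om x K (Suc n)"
    unfolding fdd.simps
  proof (rule bind_cong[OF Suc.IH])
    fix \<omega> assume "\<omega> \<in> space (IT.C 0 (Suc n) (\<lambda>_. undefined))"
    \<comment> \<open>Histories are extensional, so updating at \<open>Suc n\<close> agrees with the
      restricted function in \<open>fdd\<close>.\<close>
    then have "\<omega> \<in> extensional {..n}" unfolding sp by (simp add: space_PiM PiE_iff)
    then have "fun_upd \<omega> (Suc n) = (\<lambda>y. \<lambda>i\<in>{..Suc n}. if i = Suc n then y else \<omega> i)"
      by (auto simp: fun_eq_iff extensional_def)
    then show "IT.eP (Suc n) \<omega> = distr (K n (\<omega> n)) (PiM {..Suc n} (\<lambda>_. S))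
        (\<lambda>y. \<lambda>i\<in>{..Suc n}. if i = Suc n then y else \<omega> i)"
      by (simp add: IT.eP_def IT_kernel_def atLeast0LessThan lessThan_Suc_atMost)
  qed
  finally show ?case .
qed

lemma sets_fdd: "sets (fdd Om x K n) = sets (PiM {..n} (\<lambda>_. S))"
  using IT.sets_C[of "\<lambda>_. undefined" 0 "Suc n"] unfolding IT_C_eq_fdd
  by (simp add: space_PiM atLeast0LessThan lessThan_Suc_atMost)

lemma distr_lim_eq_fdd:
  "distr IT.PF.lim (PiM {..n} (\<lambda>_. S)) (\<lambda>\<omega>. restrict \<omega> {..n}) = fdd Om x K n"
proof (rule measure_eqI)
  show "sets (distr IT.PF.lim (PiM {..n} (\<lambda>_. S)) (\<lambda>\<omega>. restrict \<omega> {..n})) = sets (fdd Om x K n)"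
    by (simp add: sets_fdd)
  fix X assume "X \<in> sets (distr IT.PF.lim (PiM {..n} (\<lambda>_. S)) (\<lambda>\<omega>. restrict \<omega> {..n}))"
  then have X: "X \<in> sets (PiM {..n} (\<lambda>_. S))" by simp
  have "emeasure (distr IT.PF.lim (PiM {..n} (\<lambda>_. S)) (\<lambda>\<omega>. restrict \<omega> {..n})) X
      = emeasure IT.PF.lim (prod_emb UNIV (\<lambda>_. S) {..n} X)"
    using X by (intro emeasure_distr_restrict) auto
  also have "\<dots> = emeasure (IT.CI {..n}) X" using X by (intro IT.lim) auto
  also have "\<dots> = emeasure (IT.C 0 (Suc n) (\<lambda>_. undefined)) (prod_emb {0..<Suc n} (\<lambda>_. S) {..n} X)"
    using X by (intro IT.emeasure_CI) auto
  also have "prod_emb {0..<Suc n} (\<lambda>_. S) {..n} X = X"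
    using X sets.sets_into_space[OF X]
    by (simp add: atLeast0LessThan lessThan_Suc_atMost prod_emb_id space_PiM)
  finally show "emeasure (distr IT.PF.lim (PiM {..n} (\<lambda>_. S)) (\<lambda>\<omega>. restrict \<omega> {..n})) X = emeasure (fdd Om x K n) X"
    unfolding IT_C_eq_fdd .
qed

text \<open>Total mass is inherited from the marginal on coordinate 0.\<close>

lemma prob_space_lim: "prob_space IT.PF.lim"
proof -
  have u: "(\<lambda>_. undefined) \<in> space (PiM {0..<0} (\<lambda>_::nat. S))" by (simp add: space_PiM)
  have "prob_space (fdd Om x K 0)"
    using IT.prob_space_C[OF u, of "Suc 0"] unfolding IT_C_eq_fdd .
  then have "prob_space (distr IT.PF.lim (PiM {..0} (\<lambda>_. S)) (\<lambda>\<omega>. restrict \<omega> {..0}))"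
    unfolding distr_lim_eq_fdd .
  then show ?thesis
    by (rule prob_space_distrD[rotated]) (simp add: measurable_cong_sets[OF IT.PF.sets_lim refl] measurable_restrict_subset)
qed

text \<open>Every finite set of coordinates lies in some \<open>{..n}\<close>, so the marginals fix
  the measure of all cylinders, which generate the product sigma-field. This justifies the definite
  description in \<open>pathmeas\<close>.\<close>

lemma path_measure_unique:
  assumes M: "sets M = sets (PiM UNIV (\<lambda>_. S))" "prob_space M"
      "\<And>n. distr M (PiM {..n} (\<lambda>_. S)) (\<lambda>\<omega>. restrict \<omega> {..n}) = fdd Om x K n"
    and N: "sets N = sets (PiM UNIV (\<lambda>_. S))"
      "\<And>n. distr N (PiM {..n} (\<lambda>_. S)) (\<lambda>\<omega>. restrict \<omega> {..n}) = fdd Om x K n"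
  shows "M = N"
proof (rule measure_eqI_PiM_infinite[OF M(1) N(1)])
  show "finite_measure M" using M(2) by (rule prob_space.finite_measure)
  fix B and J :: "nat set" assume J: "finite J" and B: "\<And>i. i \<in> J \<Longrightarrow> B i \<in> sets S"
  obtain n where n: "J \<subseteq> {..n}" using J finite_nat_iff_bounded_le by auto
  let ?X = "prod_emb {..n} (\<lambda>_. S) J (Pi\<^sub>E J B)"
  have X: "?X \<in> sets (PiM {..n} (\<lambda>_. S))" using J B n by (intro sets_PiM_I) auto
  have "emeasure P (prod_emb UNIV (\<lambda>_. S) J (Pi\<^sub>E J B)) = emeasure (fdd Om x K n) ?X"
    if P: "sets P = sets (PiM UNIV (\<lambda>_. S))" "distr P (PiM {..n} (\<lambda>_. S)) (\<lambda>\<omega>. restrict \<omega> {..n}) = fdd Om x K n" for P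
    using emeasure_distr_restrict[OF _ P(1) X] n by (simp add: P(2))
  then show "emeasure M (prod_emb UNIV (\<lambda>_. S) J (Pi\<^sub>E J B)) = emeasure N (prod_emb UNIV (\<lambda>_. S) J (Pi\<^sub>E J B))"
    using M N by simp
qed

lemma pathmeas_eq_lim: "pathmeas Om x K = IT.PF.lim"
  unfolding pathmeas_def
proof (rule the_equality)
  show "sets IT.PF.lim = sets (PiM UNIV (\<lambda>_. S)) \<and> prob_space IT.PF.lim \<and>
      (\<forall>n. distr IT.PF.lim (PiM {..n} (\<lambda>_. S)) (\<lambda>\<omega>. restrict \<omega> {..n}) = fdd Om x K n)"
    using prob_space_lim distr_lim_eq_fdd by simp
next
  fix M assume "sets M = sets (PiM UNIV (\<lambda>_. S)) \<and> prob_space M \<and>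
      (\<forall>n. distr M (PiM {..n} (\<lambda>_. S)) (\<lambda>\<omega>. restrict \<omega> {..n}) = fdd Om x K n)"
  then show "M = IT.PF.lim"
    by (elim conjE) (rule path_measure_unique[OF _ _ _ IT.PF.sets_lim distr_lim_eq_fdd], blast+)
qed

abbreviation "P \<equiv> pathmeas Om x K"

lemma sets_pathmeas [measurable_cong]: "sets P = sets (PiM UNIV (\<lambda>_. S))"
  by (simp add: pathmeas_eq_lim)

lemma space_pathmeas: "space P = UNIV \<rightarrow> Om"
  using sets_eq_imp_space_eq[OF sets_pathmeas] by (simp add: space_PiM PiE_UNIV_domain)

sublocale path: prob_space P
  unfolding pathmeas_eq_lim by (rule prob_space_lim)

section \<open>Integration along the path, one step at a time\<close>

lemma nn_integral_pathmeas_fdd: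
  assumes f: "f \<in> borel_measurable (PiM {..n} (\<lambda>_. S))"
  shows "(\<integral>\<^sup>+\<omega>. f (restrict \<omega> {..n}) \<partial>P) = (\<integral>\<^sup>+\<omega>. f \<omega> \<partial>fdd Om x K n)"
proof -
  have "(\<lambda>\<omega>. restrict \<omega> {..n}) \<in> measurable P (PiM {..n} (\<lambda>_. S))"
    unfolding measurable_cong_sets[OF sets_pathmeas refl] by (rule measurable_restrict_subset) simp
  from nn_integral_distr[OF this, of f] f show ?thesis
    using distr_lim_eq_fdd[of n] by (simp add: pathmeas_eq_lim measurable_cong_sets[OF sets_fdd refl])
qed

lemma nn_integral_initial:
  assumes f[measurable]: "f \<in> borel_measurable S"
  shows "(\<integral>\<^sup>+\<omega>. f (\<omega> 0) \<partial>P) = f x"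
proof -
  have m: "(\<lambda>y. \<lambda>i\<in>{..0::nat}. y) \<in> measurable S (PiM {..0} (\<lambda>_. S))"
    by (intro measurable_restrict) simp
  have "(\<integral>\<^sup>+\<omega>. f (\<omega> 0) \<partial>P) = (\<integral>\<^sup>+\<omega>. f ((restrict \<omega> {..0}) 0) \<partial>P)" by simp
  also have "\<dots> = (\<integral>\<^sup>+\<omega>. f (\<omega> 0) \<partial>fdd Om x K 0)"
    by (rule nn_integral_pathmeas_fdd) (auto intro!: measurable_PiM_coord f)
  also have "\<dots> = (\<integral>\<^sup>+y. f y \<partial>return S x)"
    unfolding fdd.simps using m
    by (subst nn_integral_distr) (auto intro!: measurable_PiM_coord f)
  also have "\<dots> = f x" using x by (intro nn_integral_return) auto
  finally show ?thesis .
qed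

text \<open>The integrand sees only coordinates \<open>t\<close> and \<open>Suc t\<close>, so it can
  be integrated against the marginal up to \<open>Suc t\<close>, a bind of the marginal up to
  \<open>t\<close> with \<open>K t\<close>; the inner integral again depends on coordinate
  \<open>t\<close> alone. Nonnegative integrals spare all integrability conditions.\<close>

lemma nn_integral_step:
  assumes f: "case_prod f \<in> borel_measurable (S \<Otimes>\<^sub>M S)"
  shows "(\<integral>\<^sup>+\<omega>. f (\<omega> t) (\<omega> (Suc t)) \<partial>P) = (\<integral>\<^sup>+\<omega>. (\<integral>\<^sup>+y. f (\<omega> t) y \<partial>K t (\<omega> t)) \<partial>P)"
proof -
  let ?S = "\<lambda>n. PiM {..n::nat} (\<lambda>_. S)"
  let ?upd = "\<lambda>\<omega> y. \<lambda>i\<in>{..Suc t}. if i = Suc t then y else \<omega> i"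
  have [measurable]: "(\<lambda>\<omega>. K t (\<omega> t)) \<in> measurable (?S t) (subprob_algebra S)"
    by (intro measurable_PiM_coord K_subprob) simp
  have upd: "case_prod ?upd \<in> measurable (?S t \<Otimes>\<^sub>M S) (?S (Suc t))"
    unfolding case_prod_beta'
  proof (rule measurable_restrict)
    fix i assume "i \<in> {..Suc t}"
    then show "(\<lambda>z. if i = Suc t then snd z else fst z i) \<in> measurable (?S t \<Otimes>\<^sub>M S) S"
      by (cases "i = Suc t")
         (auto intro!: measurable_compose[OF measurable_fst measurable_PiM_coord[of i _ "\<lambda>y. y"]])
  qed
  have ker: "(\<lambda>\<omega>. distr (K t (\<omega> t)) (?S (Suc t)) (?upd \<omega>)) \<in> measurable (?S t) (subprob_algebra (?S (Suc t)))"
    by (rule measurable_distr2[OF upd]) measurable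
  have fm: "(\<lambda>\<omega>. f (\<omega> t) (\<omega> (Suc t))) \<in> borel_measurable (?S (Suc t))"
  proof -
    have "(\<lambda>\<omega>. (\<omega> t, \<omega> (Suc t))) \<in> measurable (?S (Suc t)) (S \<Otimes>\<^sub>M S)"
      by (intro measurable_Pair measurable_component_singleton) auto
    from measurable_compose[OF this f] show ?thesis by simp
  qed
  have "(\<integral>\<^sup>+\<omega>. f (\<omega> t) (\<omega> (Suc t)) \<partial>P)
      = (\<integral>\<^sup>+\<omega>. (\<lambda>\<omega>. f (\<omega> t) (\<omega> (Suc t))) (restrict \<omega> {..Suc t}) \<partial>P)" by simp
  also have "\<dots> = (\<integral>\<^sup>+\<omega>. f (\<omega> t) (\<omega> (Suc t)) \<partial>fdd Om x K (Suc t))"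
    by (rule nn_integral_pathmeas_fdd[OF fm])
  also have "\<dots> = (\<integral>\<^sup>+\<omega>. (\<integral>\<^sup>+\<omega>'. f (\<omega>' t) (\<omega>' (Suc t)) \<partial>distr (K t (\<omega> t)) (?S (Suc t)) (?upd \<omega>)) \<partial>fdd Om x K t)"
    unfolding fdd.simps
    using ker by (intro nn_integral_bind[OF fm]) (simp add: measurable_cong_sets[OF sets_fdd refl])
  also have "\<dots> = (\<integral>\<^sup>+\<omega>. (\<integral>\<^sup>+y. f (\<omega> t) y \<partial>K t (\<omega> t)) \<partial>fdd Om x K t)"
  proof (rule nn_integral_cong)
    fix \<omega> assume "\<omega> \<in> space (fdd Om x K t)"
    then have \<omega>: "\<omega> \<in> space (?S t)" using sets_eq_imp_space_eq[OF sets_fdd] by blast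
    then have "\<omega> t \<in> Om" by (auto simp: space_PiM)
    have "?upd \<omega> \<in> measurable S (?S (Suc t))"
      using measurable_compose[OF measurable_Pair1'[OF \<omega>] upd] by simp
    then have m: "?upd \<omega> \<in> measurable (K t (\<omega> t)) (?S (Suc t))"
      using sets_K[OF \<open>\<omega> t \<in> Om\<close>] by (simp add: measurable_cong_sets[OF sets_K[OF \<open>\<omega> t \<in> Om\<close>] refl])
    show "(\<integral>\<^sup>+\<omega>'. f (\<omega>' t) (\<omega>' (Suc t)) \<partial>distr (K t (\<omega> t)) (?S (Suc t)) (?upd \<omega>)) = (\<integral>\<^sup>+y. f (\<omega> t) y \<partial>K t (\<omega> t))"
      using fm by (subst nn_integral_distr[OF m]) auto
  qed
  also have "\<dots> = (\<integral>\<^sup>+\<omega>. (\<lambda>\<omega>. \<integral>\<^sup>+y. f (\<omega> t) y \<partial>K t (\<omega> t)) (restrict \<omega> {..t}) \<partial>P)"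
  proof (rule nn_integral_pathmeas_fdd[symmetric])
    have "(\<lambda>u. \<integral>\<^sup>+y. f u y \<partial>K t u) \<in> borel_measurable S"
      using f by (intro nn_integral_measurable_subprob_algebra2[OF _ K_subprob]) simp
    then show "(\<lambda>\<omega>. \<integral>\<^sup>+y. f (\<omega> t) y \<partial>K t (\<omega> t)) \<in> borel_measurable (?S t)"
      by (intro measurable_PiM_coord) auto
  qed
  finally show ?thesis by simp
qed

lemma measurable_coord: "(\<lambda>\<omega>. \<omega> t) \<in> measurable P S"
  unfolding measurable_cong_sets[OF sets_pathmeas refl] by (rule measurable_component_singleton) simp

lemma integral_step_nonneg:
  fixes f :: "'x \<Rightarrow> 'x \<Rightarrow> real"
  assumes f: "case_prod f \<in> borel_measurable (S \<Otimes>\<^sub>M S)" and nn: "\<And>u y. u \<in> Om \<Longrightarrow> y \<in> Om \<Longrightarrow> 0 \<le> f u y"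
    and int: "\<And>u. u \<in> Om \<Longrightarrow> integrable (K t u) (f u)"
    and intP: "integrable P (\<lambda>\<omega>. f (\<omega> t) (\<omega> (Suc t)))"
  shows "integrable P (\<lambda>\<omega>. \<integral>y. f (\<omega> t) y \<partial>K t (\<omega> t))"
    and "(\<integral>\<omega>. f (\<omega> t) (\<omega> (Suc t)) \<partial>P) = (\<integral>\<omega>. (\<integral>y. f (\<omega> t) y \<partial>K t (\<omega> t)) \<partial>P)"
proof -
  have coord: "\<omega> s \<in> Om" if "\<omega> \<in> space P" for \<omega> s
    using that unfolding space_pathmeas by (rule funcset_mem) simp
  note m1 = borel_measurable_integrable[OF intP]
  have inner: "(\<integral>\<^sup>+y. ennreal (f u y) \<partial>K t u) = ennreal (\<integral>y. f u y \<partial>K t u)" if "u \<in> Om" for u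
    using that nn by (intro nn_integral_eq_integral int AE_I2) (auto simp: space_K)
  have fe: "(\<lambda>(u, y). ennreal (f u y)) \<in> borel_measurable (S \<Otimes>\<^sub>M S)"
    using measurable_compose[OF f measurable_ennreal] by (simp add: case_prod_beta')
  \<comment> \<open>Measurability in \<open>u\<close> is available for the nonnegative integral
    against a subprobability kernel and is carried over to the Bochner integral by
    \<open>enn2real\<close>.\<close>
  have inner': "(\<integral>y. f u y \<partial>K t u) = enn2real (\<integral>\<^sup>+y. ennreal (f u y) \<partial>K t u)" if "u \<in> space S" for u
    using that nn by (subst inner) (auto intro!: enn2real_ennreal[symmetric] integral_nonneg_AE simp: space_K)
  have "(\<lambda>u. \<integral>\<^sup>+y. ennreal (f u y) \<partial>K t u) \<in> borel_measurable S"
    using fe by (intro nn_integral_measurable_subprob_algebra2[OF _ K_subprob]) simp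
  then have "(\<lambda>u. \<integral>y. f u y \<partial>K t u) \<in> borel_measurable S"
    by (subst measurable_cong[OF inner']) auto
  from measurable_compose[OF measurable_coord this]
  have m2: "(\<lambda>\<omega>. \<integral>y. f (\<omega> t) y \<partial>K t (\<omega> t)) \<in> borel_measurable P" .
  have inn: "0 \<le> (\<integral>y. f (\<omega> t) y \<partial>K t (\<omega> t))" if "\<omega> \<in> space P" for \<omega>
    using nn coord[OF that] by (intro integral_nonneg_AE AE_I2) (auto simp: space_K)
  have "(\<integral>\<^sup>+\<omega>. ennreal (f (\<omega> t) (\<omega> (Suc t))) \<partial>P) = (\<integral>\<^sup>+\<omega>. (\<integral>\<^sup>+y. ennreal (f (\<omega> t) y) \<partial>K t (\<omega> t)) \<partial>P)"
    using nn_integral_step[OF fe, of t] by simp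
  also have "\<dots> = (\<integral>\<^sup>+\<omega>. ennreal (\<integral>y. f (\<omega> t) y \<partial>K t (\<omega> t)) \<partial>P)"
    using inner coord by (intro nn_integral_cong) auto
  finally have eq: "(\<integral>\<^sup>+\<omega>. ennreal (f (\<omega> t) (\<omega> (Suc t))) \<partial>P)
      = (\<integral>\<^sup>+\<omega>. ennreal (\<integral>y. f (\<omega> t) y \<partial>K t (\<omega> t)) \<partial>P)" .
  have "(\<integral>\<^sup>+\<omega>. ennreal (f (\<omega> t) (\<omega> (Suc t))) \<partial>P) = ennreal (\<integral>\<omega>. f (\<omega> t) (\<omega> (Suc t)) \<partial>P)"
    using nn coord by (intro nn_integral_eq_integral intP AE_I2) auto
  then show "integrable P (\<lambda>\<omega>. \<integral>y. f (\<omega> t) y \<partial>K t (\<omega> t))"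
    unfolding eq using inn by (intro integrableI_nn_integral_finite[OF m2] AE_I2) auto
  have "(\<integral>\<omega>. f (\<omega> t) (\<omega> (Suc t)) \<partial>P) = enn2real (\<integral>\<^sup>+\<omega>. ennreal (f (\<omega> t) (\<omega> (Suc t))) \<partial>P)"
    using nn coord by (intro integral_eq_nn_integral m1 AE_I2) auto
  also have "\<dots> = (\<integral>\<omega>. (\<integral>y. f (\<omega> t) y \<partial>K t (\<omega> t)) \<partial>P)"
    unfolding eq using inn by (intro integral_eq_nn_integral[symmetric] m2 AE_I2) auto
  finally show "(\<integral>\<omega>. f (\<omega> t) (\<omega> (Suc t)) \<partial>P) = (\<integral>\<omega>. (\<integral>y. f (\<omega> t) y \<partial>K t (\<omega> t)) \<partial>P)" .
qed

text \<open>The signed case: \<open>f\<close> is the difference of \<open>f + h\<close> and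
  \<open>h\<close>, both nonnegative because of the bound by \<open>h\<close>, which also supplies
  every integrability claim.\<close>

lemma integral_step:
  fixes f h :: "'x \<Rightarrow> 'x \<Rightarrow> real"
  assumes f: "case_prod f \<in> borel_measurable (S \<Otimes>\<^sub>M S)" and h: "case_prod h \<in> borel_measurable (S \<Otimes>\<^sub>M S)"
    and le: "\<And>u y. u \<in> Om \<Longrightarrow> y \<in> Om \<Longrightarrow> \<bar>f u y\<bar> \<le> h u y"
    and int: "\<And>u. u \<in> Om \<Longrightarrow> integrable (K t u) (h u)"
    and intP: "integrable P (\<lambda>\<omega>. h (\<omega> t) (\<omega> (Suc t)))"
  shows "integrable P (\<lambda>\<omega>. f (\<omega> t) (\<omega> (Suc t)))"
    and "integrable P (\<lambda>\<omega>. \<integral>y. f (\<omega> t) y \<partial>K t (\<omega> t))"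
    and "(\<integral>\<omega>. f (\<omega> t) (\<omega> (Suc t)) \<partial>P) = (\<integral>\<omega>. (\<integral>y. f (\<omega> t) y \<partial>K t (\<omega> t)) \<partial>P)"
proof -
  have coord: "\<omega> s \<in> Om" if "\<omega> \<in> space P" for \<omega> s
    using that unfolding space_pathmeas by (rule funcset_mem) simp
  have intf: "integrable (K t u) (f u)" if u: "u \<in> Om" for u
  proof (rule Bochner_Integration.integrable_bound[OF int[OF u]])
    have "f u \<in> borel_measurable S"
      using measurable_compose[OF measurable_Pair1'[of u S S] f] u by simp
    then show "f u \<in> borel_measurable (K t u)"
      unfolding measurable_cong_sets[OF sets_K[OF u] refl] .
    show "AE y in K t u. norm (f u y) \<le> norm (h u y)"
      using le u space_K[OF u] by (intro AE_I2) (auto intro: order_trans[OF _ abs_ge_self])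
  qed
  show intPf: "integrable P (\<lambda>\<omega>. f (\<omega> t) (\<omega> (Suc t)))"
  proof (rule Bochner_Integration.integrable_bound[OF intP])
    have "(\<lambda>\<omega>. (\<omega> t, \<omega> (Suc t))) \<in> measurable P (S \<Otimes>\<^sub>M S)"
      by (intro measurable_Pair measurable_coord)
    from measurable_compose[OF this f] show "(\<lambda>\<omega>. f (\<omega> t) (\<omega> (Suc t))) \<in> borel_measurable P" by simp
    show "AE \<omega> in P. norm (f (\<omega> t) (\<omega> (Suc t))) \<le> norm (h (\<omega> t) (\<omega> (Suc t)))"
      using le coord by (intro AE_I2) (auto intro: order_trans[OF _ abs_ge_self])
  qed
  have fh: "(\<lambda>(u, y). f u y + h u y) \<in> borel_measurable (S \<Otimes>\<^sub>M S)"
    using borel_measurable_add[OF f h] by (simp add: case_prod_beta')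
  have nn: "0 \<le> h u y" "0 \<le> f u y + h u y" if "u \<in> Om" "y \<in> Om" for u y
    using le[OF that] by auto
  note s1 = integral_step_nonneg[OF fh nn(2) Bochner_Integration.integrable_add[OF intf int]
      Bochner_Integration.integrable_add[OF intPf intP]]
  note s2 = integral_step_nonneg[OF h nn(1) int intP]
  have split: "(\<integral>y. f (\<omega> t) y \<partial>K t (\<omega> t)) = (\<integral>y. f (\<omega> t) y + h (\<omega> t) y \<partial>K t (\<omega> t)) - (\<integral>y. h (\<omega> t) y \<partial>K t (\<omega> t))"
    if "\<omega> \<in> space P" for \<omega>
    using intf[OF coord[OF that]] int[OF coord[OF that]] by simp
  have "integrable P (\<lambda>\<omega>. (\<integral>y. f (\<omega> t) y + h (\<omega> t) y \<partial>K t (\<omega> t)) - (\<integral>y. h (\<omega> t) y \<partial>K t (\<omega> t)))"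
    by (intro Bochner_Integration.integrable_diff s1 s2)
  then show "integrable P (\<lambda>\<omega>. \<integral>y. f (\<omega> t) y \<partial>K t (\<omega> t))"
    by (subst Bochner_Integration.integrable_cong[OF refl split])
  have "(\<integral>\<omega>. (\<integral>y. f (\<omega> t) y \<partial>K t (\<omega> t)) \<partial>P)
      = (\<integral>\<omega>. (\<integral>y. f (\<omega> t) y + h (\<omega> t) y \<partial>K t (\<omega> t)) - (\<integral>y. h (\<omega> t) y \<partial>K t (\<omega> t)) \<partial>P)"
    by (rule Bochner_Integration.integral_cong[OF refl split])
  also have "\<dots> = (\<integral>\<omega>. f (\<omega> t) (\<omega> (Suc t)) + h (\<omega> t) (\<omega> (Suc t)) \<partial>P) - (\<integral>\<omega>. h (\<omega> t) (\<omega> (Suc t)) \<partial>P)"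
    using Bochner_Integration.integral_diff[OF s1(1) s2(1)] s1(2) s2(2) by simp
  also have "\<dots> = (\<integral>\<omega>. f (\<omega> t) (\<omega> (Suc t)) \<partial>P)"
    using intPf intP by simp
  finally show "(\<integral>\<omega>. f (\<omega> t) (\<omega> (Suc t)) \<partial>P) = (\<integral>\<omega>. (\<integral>y. f (\<omega> t) y \<partial>K t (\<omega> t)) \<partial>P)" ..
qed

text \<open>The nonnegative function \<open>\<bar>f (\<omega> 0) - f x\<bar>\<close> has integral
  zero, so \<open>f (\<omega> 0)\<close> equals \<open>f x\<close> almost surely.\<close>

lemma integral_initial:
  fixes f :: "'x \<Rightarrow> real"
  assumes f[measurable]: "f \<in> borel_measurable S"
  shows "(\<integral>\<omega>. f (\<omega> 0) \<partial>P) = f x"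
proof -
  have m: "(\<lambda>\<omega>. f (\<omega> 0)) \<in> borel_measurable P"
    by (rule measurable_compose[OF measurable_coord f])
  have "(\<integral>\<^sup>+\<omega>. ennreal \<bar>f (\<omega> 0) - f x\<bar> \<partial>P) = ennreal \<bar>f x - f x\<bar>"
    by (rule nn_integral_initial) measurable
  moreover have "(\<lambda>\<omega>. ennreal \<bar>f (\<omega> 0) - f x\<bar>) \<in> borel_measurable P" using m by measurable
  ultimately have "AE \<omega> in P. ennreal \<bar>f (\<omega> 0) - f x\<bar> = 0"
    using nn_integral_0_iff_AE[of "\<lambda>\<omega>. ennreal \<bar>f (\<omega> 0) - f x\<bar>" P] by simp
  then have "AE \<omega> in P. f (\<omega> 0) = f x" by (rule eventually_mono) simp
  then have "(\<integral>\<omega>. f (\<omega> 0) \<partial>P) = (\<integral>\<omega>. f x \<partial>P)"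
    using m by (intro integral_cong_AE) auto
  then show ?thesis by (simp add: path.prob_space)
qed

end

section \<open>The robust control problem\<close>

locale robust_mdp =
  fixes Om :: "'x::euclidean_space set" and A :: "'u::euclidean_space set"
    and Pc :: "'x \<Rightarrow> 'u \<Rightarrow> 'x measure set"
    and r :: "'x \<Rightarrow> 'u \<Rightarrow> 'x \<Rightarrow> real"
    and rho0 rhoA :: "real \<Rightarrow> ennreal"
    and p :: nat and CP Cr L \<alpha> :: real
  assumes Om: "closed Om" "Om \<noteq> {}"
    and A: "compact A" "A \<noteq> {}"
    and A1_ne_cpt: "\<forall>x\<in>Om. \<forall>a\<in>A. Pc x a \<noteq> {} \<and> compactin (tau p Om) (Pc x a)"
    and A1_uhc: "uhc (top_of_set (Om \<times> A)) (tau p Om) (\<lambda>(x, a). Pc x a)"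
    and A1_lhc: "lhc (top_of_set (Om \<times> A)) (tau p Om) (\<lambda>(x, a). Pc x a)"
    and CP: "CP \<ge> 1"
    and A1_mom: "\<forall>x\<in>Om. \<forall>a\<in>A. \<forall>Q\<in>Pc x a.
        nn_integral Q (\<lambda>y. ennreal (1 + norm y ^ p)) \<le> ennreal (CP * (1 + norm x ^ p))"
    and r_cont: "continuous_on (Om \<times> A \<times> Om) (\<lambda>(x, a, y). r x a y)"
    and L: "L > 0"
    and rho0: "rho0 0 = 0" "(rho0 \<longlongrightarrow> 0) (at_right 0)"
    and rhoA: "rhoA 0 = 0" "(rhoA \<longlongrightarrow> 0) (at_right 0)"
    and r_mod: "\<forall>x0\<in>Om. \<forall>x0'\<in>Om. \<forall>x1\<in>Om. \<forall>a\<in>A. \<forall>a'\<in>A.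
        ennreal \<bar>r x0 a x1 - r x0' a' x1\<bar>
          \<le> ennreal (L * (1 + norm x1 ^ p)) * (rho0 (dist x0 x0') + rhoA (dist a a'))"
    and Cr: "Cr \<ge> 1"
    and r_growth: "\<forall>x0\<in>Om. \<forall>a\<in>A. \<forall>x1\<in>Om. \<bar>r x0 a x1\<bar> \<le> Cr * (1 + norm x0 ^ p + norm x1 ^ p)"
    and alpha: "0 < \<alpha>" "\<alpha> < 1 / CP"
begin

section \<open>Weighted function spaces and moment bounds\<close>

abbreviation w :: "'x \<Rightarrow> real" where "w x \<equiv> 1 + norm x ^ p"

lemma w_ge_1: "1 \<le> w x" by simp

lemma w_pos: "0 < w x" by (simp add: add_pos_nonneg)

lemma CpI: "continuous_on Om g \<Longrightarrow> (\<And>x. x \<in> Om \<Longrightarrow> \<bar>g x\<bar> \<le> C * w x) \<Longrightarrow> g \<in> Cp p Om"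
  by (auto simp: Cp_def)

lemma CpE:
  assumes "g \<in> Cp p Om"
  obtains C where "continuous_on Om g" "C \<ge> 0" "\<And>x. x \<in> Om \<Longrightarrow> \<bar>g x\<bar> \<le> C * w x"
proof -
  obtain C where C: "continuous_on Om g" "\<And>x. x \<in> Om \<Longrightarrow> \<bar>g x\<bar> \<le> C * w x"
    using assms by (auto simp: Cp_def)
  have "\<bar>g x\<bar> \<le> \<bar>C\<bar> * w x" if "x \<in> Om" for x
    using C(2)[OF that] w_pos[of x] by (meson abs_ge_self mult_right_mono order_trans less_imp_le)
  then show thesis using that[of "\<bar>C\<bar>"] C(1) by auto
qed

lemma Cp_add: "f \<in> Cp p Om \<Longrightarrow> g \<in> Cp p Om \<Longrightarrow> (\<lambda>x. f x + g x) \<in> Cp p Om"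
proof -
  assume "f \<in> Cp p Om" "g \<in> Cp p Om"
  then obtain C D where "continuous_on Om f" "\<And>x. x \<in> Om \<Longrightarrow> \<bar>f x\<bar> \<le> C * w x"
    "continuous_on Om g" "\<And>x. x \<in> Om \<Longrightarrow> \<bar>g x\<bar> \<le> D * w x" by (metis CpE)
  then show ?thesis
    by (intro CpI[where C = "C + D"]) (auto intro!: continuous_intros order_trans[OF abs_triangle_ineq] add_mono simp: distrib_right)
qed

lemma Cp_cmult: "f \<in> Cp p Om \<Longrightarrow> (\<lambda>x. c * f x) \<in> Cp p Om"
proof -
  assume "f \<in> Cp p Om"
  then obtain C where "continuous_on Om f" "\<And>x. x \<in> Om \<Longrightarrow> \<bar>f x\<bar> \<le> C * w x" by (metis CpE)
  then show ?thesis
    by (intro CpI[where C = "\<bar>c\<bar> * C"]) (auto intro!: continuous_intros mult_left_mono simp: abs_mult mult.assoc)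
qed

lemma Cp_diff: "f \<in> Cp p Om \<Longrightarrow> g \<in> Cp p Om \<Longrightarrow> (\<lambda>x. f x - g x) \<in> Cp p Om"
  using Cp_add[OF _ Cp_cmult, of f g "-1"] by simp

lemma Cp_bounded: "continuous_on Om g \<Longrightarrow> (\<And>x. \<bar>g x\<bar> \<le> 1) \<Longrightarrow> g \<in> Cp p Om"
  by (rule CpI[where C = 1]) (auto intro: order_trans[OF _ w_ge_1])

lemma w_Cp: "w \<in> Cp p Om"
  by (rule CpI[where C = 1]) (auto intro!: continuous_intros)

lemma r_Cp: "x \<in> Om \<Longrightarrow> a \<in> A \<Longrightarrow> r x a \<in> Cp p Om"
proof (rule CpI[where C = "Cr * w x"])
  assume xa: "x \<in> Om" "a \<in> A"
  then have "continuous_on Om (\<lambda>y. case (x, a, y) of (x, a, y) \<Rightarrow> r x a y)"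
    by (intro continuous_on_compose2[OF r_cont] continuous_intros) auto
  then show "continuous_on Om (r x a)" by simp
  fix y assume y: "y \<in> Om"
  have "\<bar>r x a y\<bar> \<le> Cr * (1 + norm x ^ p + norm y ^ p)" using r_growth xa y by auto
  \<comment> \<open>For nonnegative s and t, 1 + s + t is at most (1 + s)(1 + t); the current state
    then enters only through the constant.\<close>
  also have "\<dots> \<le> Cr * (w x * w y)"
    using Cr by (intro mult_left_mono) (auto simp: distrib_left distrib_right)
  finally show "\<bar>r x a y\<bar> \<le> Cr * w x * w y" by (simp add: mult.assoc)
qed

text \<open>The subbasis covers \<open>M1p\<close> because the zero function with the open set
  \<open>UNIV\<close> is among its generators.\<close>

lemma topspace_tau: "topspace (tau p Om) = M1p p Om"
proof -
  have "(\<lambda>_. 0) \<in> Cp p Om" by (rule CpI[where C = 0]) auto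
  then have "M1p p Om \<subseteq> \<Union>{{M \<in> M1p p Om. integral\<^sup>L M g \<in> U} | g U. g \<in> Cp p Om \<and> open U}"
    by (intro Union_upper) (auto intro!: exI[of _ UNIV])
  then show ?thesis
    unfolding tau_def topology_generated_by_topspace by auto
qed

lemma continuous_map_tau_integral:
  assumes "g \<in> Cp p Om"
  shows "continuous_map (tau p Om) euclideanreal (\<lambda>Q. integral\<^sup>L Q g)"
  unfolding continuous_map topspace_tau
proof (intro conjI allI impI)
  fix U :: "real set" assume "openin euclideanreal U"
  then show "openin (tau p Om) {Q \<in> M1p p Om. integral\<^sup>L Q g \<in> U}"
    unfolding tau_def using assms by (intro topology_generated_by_Basis) auto
qed simp

lemma Pc_compact: "x \<in> Om \<Longrightarrow> a \<in> A \<Longrightarrow> compactin (tau p Om) (Pc x a)"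
  and Pc_nonempty: "x \<in> Om \<Longrightarrow> a \<in> A \<Longrightarrow> Pc x a \<noteq> {}"
  using A1_ne_cpt by auto

lemma Pc_M1p: "x \<in> Om \<Longrightarrow> a \<in> A \<Longrightarrow> Q \<in> Pc x a \<Longrightarrow> Q \<in> M1p p Om"
  using compactin_subset_topspace[OF Pc_compact] topspace_tau by auto

lemma M1pD:
  assumes "Q \<in> M1p p Om"
  shows "sets Q = sets (locsp Om)" "space Q = Om" "prob_space Q" "Q \<in> M1 Om" "integrable Q w"
proof -
  show s: "sets Q = sets (locsp Om)" "prob_space Q" "Q \<in> M1 Om"
    using assms by (auto simp: M1p_def M1_def)
  show "space Q = Om"
    using sets_eq_imp_space_eq[OF s(1)] by (simp add: space_restrict_space)
  interpret prob_space Q by (rule s)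
  show "integrable Q w" using assms by (auto simp: M1p_def)
qed

lemma borel_measurable_locsp: "continuous_on Om g \<Longrightarrow> g \<in> borel_measurable (locsp Om)"
  by (rule borel_measurable_continuous_on_restrict)

lemma Cp_measurable: "g \<in> Cp p Om \<Longrightarrow> g \<in> borel_measurable (locsp Om)"
  by (auto simp: Cp_def intro: borel_measurable_locsp)

lemma integrable_Cp:
  assumes "g \<in> Cp p Om" "Q \<in> M1p p Om"
  shows "integrable Q g"
proof -
  obtain C where C: "\<And>x. x \<in> Om \<Longrightarrow> \<bar>g x\<bar> \<le> C * w x" using CpE[OF assms(1)] by metis
  show ?thesis
  proof (rule Bochner_Integration.integrable_bound)
    show "integrable Q (\<lambda>x. C * w x)" using M1pD(5)[OF assms(2)] by (rule integrable_mult_right)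
    show "g \<in> borel_measurable Q"
      using Cp_measurable[OF assms(1)] measurable_cong_sets[OF M1pD(1)[OF assms(2)] refl] by blast
    show "AE x in Q. norm (g x) \<le> norm (C * w x)"
      using C M1pD(2)[OF assms(2)] by (intro AE_I2) (auto intro: order_trans[OF _ abs_ge_self])
  qed
qed

lemma integral_w_le:
  assumes "x \<in> Om" "a \<in> A" "Q \<in> Pc x a"
  shows "integral\<^sup>L Q w \<le> CP * w x"
proof -
  have "ennreal (integral\<^sup>L Q w) = nn_integral Q (\<lambda>y. ennreal (w y))"
    using M1pD(5)[OF Pc_M1p[OF assms]] w_pos
    by (intro nn_integral_eq_integral[symmetric] AE_I2) (auto intro: less_imp_le)
  also have "\<dots> \<le> ennreal (CP * w x)" using A1_mom assms by auto
  finally show ?thesis using CP w_pos[of x] by (subst (asm) ennreal_le_iff) (auto intro!: mult_nonneg_nonneg)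
qed

text \<open>Integrating against an admissible measure costs a factor \<open>CP\<close> in the
  weighted norm; this is the origin of the contraction factor \<open>\<alpha> * CP\<close>.\<close>

lemma abs_integral_le:
  assumes "x \<in> Om" "a \<in> A" "Q \<in> Pc x a" "g \<in> Cp p Om" "C \<ge> 0" "\<And>y. y \<in> Om \<Longrightarrow> \<bar>g y\<bar> \<le> C * w y"
  shows "\<bar>integral\<^sup>L Q g\<bar> \<le> C * (CP * w x)"
proof -
  note Q = Pc_M1p[OF assms(1-3)]
  have "\<bar>integral\<^sup>L Q g\<bar> \<le> integral\<^sup>L Q (\<lambda>y. C * w y)"
    using assms(6) M1pD(2)[OF Q] integral_abs_bound[of Q g]
    by (intro order_trans[OF integral_abs_bound] integral_mono integrable_abs integrable_Cp Q assms Cp_cmult w_Cp) auto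
  also have "\<dots> \<le> C * (CP * w x)"
    using integral_w_le[OF assms(1-3)] assms(5) by (simp add: mult_left_mono)
  finally show ?thesis .
qed

text \<open>Integrands \<open>h z y\<close> that depend on \<open>z\<close> uniformly in \<open>y\<close> relative to the weight \<open>1 + \<parallel>y\<parallel>\<^sup>p\<close>;
  this is the linear class on which Berge's maximum theorem and the selection argument operate.\<close>
definition unif_Cp :: "('x \<times> 'u \<Rightarrow> 'x \<Rightarrow> real) set" where
  "unif_Cp = {h. (\<forall>z\<in>Om \<times> A. h z \<in> Cp p Om) \<and>
     (\<forall>z0\<in>Om \<times> A. \<forall>e>0. \<exists>d>0. \<forall>z\<in>Om \<times> A. dist z z0 < d \<longrightarrow> (\<forall>y\<in>Om. \<bar>h z y - h z0 y\<bar> \<le> e * w y))}"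

lemma unif_Cp_const: "g \<in> Cp p Om \<Longrightarrow> (\<lambda>z. g) \<in> unif_Cp"
  using w_pos by (auto simp: unif_Cp_def intro!: exI[of _ 1] mult_nonneg_nonneg less_imp_le)

lemma unif_Cp_add_cmult:
  assumes h: "h \<in> unif_Cp" and g: "g \<in> unif_Cp"
  shows "(\<lambda>z y. h z y + c * g z y) \<in> unif_Cp"
  unfolding unif_Cp_def
proof (intro CollectI conjI ballI allI impI)
  show "(\<lambda>y. h z y + c * g z y) \<in> Cp p Om" if "z \<in> Om \<times> A" for z
    using h g that by (intro Cp_add Cp_cmult) (auto simp: unif_Cp_def)
  fix z0 and e :: real assume z0: "z0 \<in> Om \<times> A" and e: "e > 0"
  \<comment> \<open>Chosen so that the error of \<open>h\<close> and \<open>\<bar>c\<bar>\<close>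
    times the error of \<open>g\<close> add up to \<open>e\<close>.\<close>
  define e' where "e' = e / (1 + \<bar>c\<bar>)"
  have e': "e' > 0" "e' + \<bar>c\<bar> * e' = e"
    using e nonzero_mult_div_cancel_left[of "1 + \<bar>c\<bar>" e] by (auto simp: e'_def distrib_right add_divide_distrib)
  obtain d1 where d1: "d1 > 0" "\<And>z y. z \<in> Om \<times> A \<Longrightarrow> dist z z0 < d1 \<Longrightarrow> y \<in> Om \<Longrightarrow> \<bar>h z y - h z0 y\<bar> \<le> e' * w y"
    using h z0 e'(1) unfolding unif_Cp_def mem_Collect_eq by meson
  obtain d2 where d2: "d2 > 0" "\<And>z y. z \<in> Om \<times> A \<Longrightarrow> dist z z0 < d2 \<Longrightarrow> y \<in> Om \<Longrightarrow> \<bar>g z y - g z0 y\<bar> \<le> e' * w y"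
    using g z0 e'(1) unfolding unif_Cp_def mem_Collect_eq by meson
  show "\<exists>d>0. \<forall>z\<in>Om \<times> A. dist z z0 < d \<longrightarrow> (\<forall>y\<in>Om. \<bar>h z y + c * g z y - (h z0 y + c * g z0 y)\<bar> \<le> e * w y)"
  proof (intro exI[of _ "min d1 d2"] conjI ballI impI)
    fix z y assume z: "z \<in> Om \<times> A" "dist z z0 < min d1 d2" and y: "y \<in> Om"
    have "\<bar>h z y + c * g z y - (h z0 y + c * g z0 y)\<bar> = \<bar>(h z y - h z0 y) + c * (g z y - g z0 y)\<bar>"
      by (simp add: algebra_simps)
    also have "\<dots> \<le> \<bar>h z y - h z0 y\<bar> + \<bar>c\<bar> * \<bar>g z y - g z0 y\<bar>"
      using abs_triangle_ineq by (metis abs_mult)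
    also have "\<dots> \<le> e' * w y + \<bar>c\<bar> * (e' * w y)"
      using d1 d2 z y by (intro add_mono mult_left_mono) auto
    also have "\<dots> = (e' + \<bar>c\<bar> * e') * w y" by (simp add: algebra_simps)
    also have "\<dots> = e * w y" unfolding e'(2) ..
    finally show "\<bar>h z y + c * g z y - (h z0 y + c * g z0 y)\<bar> \<le> e * w y" .
  qed (use d1 d2 in auto)
qed

text \<open>\<open>at_right 0\<close> says nothing about the point 0 itself, where
  \<open>\<rho> 0 = 0\<close> takes over; this covers equal states or equal actions.\<close>

lemma modulus_small:
  assumes "\<rho> 0 = 0" "(\<rho> \<longlongrightarrow> (0::ennreal)) (at_right (0::real))" "e > 0"
  shows "\<exists>d>0. \<forall>t. 0 \<le> t \<longrightarrow> t < d \<longrightarrow> \<rho> t \<le> ennreal e"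
proof -
  have "\<forall>\<^sub>F t in at_right 0. \<rho> t < ennreal e"
    using assms(2,3) by (intro order_tendstoD) auto
  then obtain d where d: "d > 0" "\<And>t. 0 < t \<Longrightarrow> t < d \<Longrightarrow> \<rho> t < ennreal e"
    by (auto simp: eventually_at_right_field)
  have "\<rho> t \<le> ennreal e" if "0 \<le> t" "t < d" for t
    using d(2)[of t] that assms(1) by (cases "t = 0") (auto intro: less_imp_le)
  with d(1) show ?thesis by blast
qed

text \<open>(A2)(ii) carries the weight as an explicit factor; joint continuity of \<open>r\<close>
  would not by itself be uniform over a possibly unbounded range of \<open>y\<close>.\<close>

lemma unif_Cp_r: "(\<lambda>(x, a). r x a) \<in> unif_Cp"
  unfolding unif_Cp_def
proof (intro CollectI conjI ballI allI impI)
  show "(case z of (x, a) \<Rightarrow> r x a) \<in> Cp p Om" if "z \<in> Om \<times> A" for z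
    using that r_Cp by auto
  fix z0 and e :: real assume z0: "z0 \<in> Om \<times> A" and e: "e > 0"
  \<comment> \<open>The factor 2 shares \<open>e\<close> between the two moduli, and
    \<open>L\<close> cancels the constant in (A2)(ii).\<close>
  define e' where "e' = e / (2 * L)"
  have e': "e' > 0" "L * (e' + e') = e" using e L by (auto simp: e'_def field_simps)
  obtain d1 where d1: "d1 > 0" "\<And>t. 0 \<le> t \<Longrightarrow> t < d1 \<Longrightarrow> rho0 t \<le> ennreal e'"
    using modulus_small[OF rho0 e'(1)] by blast
  obtain d2 where d2: "d2 > 0" "\<And>t. 0 \<le> t \<Longrightarrow> t < d2 \<Longrightarrow> rhoA t \<le> ennreal e'"
    using modulus_small[OF rhoA e'(1)] by blast
  obtain x0 a0 where z0': "z0 = (x0, a0)" "x0 \<in> Om" "a0 \<in> A" using z0 by auto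
  show "\<exists>d>0. \<forall>z\<in>Om \<times> A. dist z z0 < d \<longrightarrow>
      (\<forall>y\<in>Om. \<bar>(case z of (x, a) \<Rightarrow> r x a) y - (case z0 of (x, a) \<Rightarrow> r x a) y\<bar> \<le> e * w y)"
  proof (intro exI[of _ "min d1 d2"] conjI ballI impI)
    fix z y assume z: "z \<in> Om \<times> A" "dist z z0 < min d1 d2" and y: "y \<in> Om"
    obtain x a where z': "z = (x, a)" "x \<in> Om" "a \<in> A" using z by auto
    have "dist x x0 < d1" "dist a a0 < d2"
      using z(2) dist_fst_le[of z z0] dist_snd_le[of z z0] by (auto simp: z' z0')
    then have small: "rho0 (dist x x0) + rhoA (dist a a0) \<le> ennreal e' + ennreal e'"
      using d1(2) d2(2) by (intro add_mono) auto
    \<comment> \<open>The moduli may take the value infinity, so the estimate stays in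
      \<open>ennreal\<close> until their finite bounds have been inserted.\<close>
    have "ennreal \<bar>r x a y - r x0 a0 y\<bar> \<le> ennreal (L * w y) * (rho0 (dist x x0) + rhoA (dist a a0))"
      using r_mod z' z0' y by auto
    also have "\<dots> \<le> ennreal (L * w y) * (ennreal e' + ennreal e')"
      using small by (intro mult_left_mono) auto
    also have "\<dots> = ennreal (L * w y * (e' + e'))"
      using e' L w_pos[of y] by (simp add: ennreal_mult' ennreal_plus[symmetric] del: ennreal_plus)
    also have "L * w y * (e' + e') = e * w y" unfolding e'(2)[symmetric] by (simp add: algebra_simps)
    finally have "\<bar>r x a y - r x0 a0 y\<bar> \<le> e * w y"
      using e w_pos[of y] by (subst (asm) ennreal_le_iff) auto
    then show "\<bar>(case z of (x, a) \<Rightarrow> r x a) y - (case z0 of (x, a) \<Rightarrow> r x a) y\<bar> \<le> e * w y"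
      by (simp add: z' z0')
  qed (use d1 d2 in auto)
qed

text \<open>Berge's theorem with both the set and the integrand moving. Replacing \<open>h z\<close>
  by \<open>h z0\<close> costs at most e/2 under every measure admissible at \<open>z\<close>; for
  the fixed integrand, upper hemicontinuity bounds the infimum from below and lower hemicontinuity
  bounds it from above.\<close>

lemma continuous_on_INF_integral:
  assumes h: "h \<in> unif_Cp"
  shows "continuous_on (Om \<times> A) (\<lambda>z. INF Q\<in>Pc (fst z) (snd z). integral\<^sup>L Q (h z))"
  unfolding continuous_on_iff
proof (intro ballI allI impI)
  fix z0 and e :: real assume z0: "z0 \<in> Om \<times> A" and e: "e > 0"
  let ?Z = "Om \<times> A" and ?P = "\<lambda>z. Pc (fst z) (snd z)"
  let ?I = "\<lambda>z. INF Q\<in>?P z. integral\<^sup>L Q (h z)"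
  have hCp: "h z \<in> Cp p Om" if "z \<in> ?Z" for z using h that by (auto simp: unif_Cp_def)
  note ct = continuous_map_tau_integral[OF hCp]
  have P: "compactin (tau p Om) (?P z)" "?P z \<noteq> {}" if "z \<in> ?Z" for z
    using that Pc_compact Pc_nonempty by auto
  have inf_att: "\<exists>Q\<in>?P z. integral\<^sup>L Q (h z) = ?I z" if "z \<in> ?Z" for z
    using compactin_attains_inf_real[OF P ct] that by metis
  have inf_low: "?I z \<le> integral\<^sup>L Q (h z)" if "z \<in> ?Z" "Q \<in> ?P z" for z Q
    using that by (intro cINF_lower compactin_bdd_below_image_real[OF P(1) ct])
  \<comment> \<open>\<open>2 * W\<close> dominates \<open>CP * w (fst z)\<close> for all
    \<open>z\<close> within distance 1 of \<open>z0\<close>, so the moment bound becomes locally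
    uniform.\<close>
  define W where "W = CP * (2 + norm (fst z0)) ^ p"
  define e' where "e' = e / (2 * (2 * W))"
  have "W > 0" using CP by (auto simp: W_def intro!: mult_pos_pos zero_less_power add_pos_nonneg)
  then have e': "e' > 0" "e' * (2 * W) = e / 2" using e by (auto simp: e'_def)
  obtain d1 where d1: "d1 > 0" "\<And>z y. z \<in> ?Z \<Longrightarrow> dist z z0 < d1 \<Longrightarrow> y \<in> Om \<Longrightarrow> \<bar>h z y - h z0 y\<bar> \<le> e' * w y"
    using h z0 e'(1) unfolding unif_Cp_def mem_Collect_eq by meson
  have change: "\<bar>integral\<^sup>L Q (h z) - integral\<^sup>L Q (h z0)\<bar> \<le> e / 2"
    if z: "z \<in> ?Z" "dist z z0 < d1" "dist z z0 < 1" and Q: "Q \<in> ?P z" for z Q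
  proof -
    have QM: "Q \<in> M1p p Om" using Pc_M1p Q z by auto
    have zin: "fst z \<in> Om" "snd z \<in> A" using z by auto
    have dCp: "(\<lambda>y. h z y + (-1) * h z0 y) \<in> Cp p Om"
      by (intro Cp_add Cp_cmult hCp z z0)
    have "integral\<^sup>L Q (h z) - integral\<^sup>L Q (h z0) = integral\<^sup>L Q (\<lambda>y. h z y + (-1) * h z0 y)"
      using integrable_Cp[OF hCp QM] z z0 by (simp add: integral_diff)
    moreover have "\<bar>integral\<^sup>L Q (\<lambda>y. h z y + (-1) * h z0 y)\<bar> \<le> e' * (CP * w (fst z))"
      using d1(2)[OF z(1,2)] e' by (intro abs_integral_le[OF zin Q dCp]) auto
    moreover have "w (fst z) \<le> 2 * (2 + norm (fst z0)) ^ p"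
    proof -
      have "norm (fst z) \<le> norm (fst z0) + dist z z0"
        using dist_fst_le[of z z0] norm_triangle_sub[of "fst z" "fst z0"] by (simp add: dist_norm)
      then have "norm (fst z) ^ p \<le> (2 + norm (fst z0)) ^ p"
        using z(3) by (intro power_mono) auto
      moreover have "1 \<le> (2 + norm (fst z0)) ^ p" by (intro one_le_power) auto
      ultimately show ?thesis by linarith
    qed
    then have "e' * (CP * w (fst z)) \<le> e' * (2 * W)"
      using e' CP unfolding W_def by (auto intro!: mult_left_mono simp: mult.left_commute[of 2])
    ultimately show ?thesis using e'(2) by linarith
  qed
  \<comment> \<open>Near \<open>z0\<close> the whole set of admissible measures stays inside
    \<open>Ul\<close>, whereas it only keeps meeting \<open>Uu\<close>: a lower bound on an infimum
    concerns all measures, an upper bound just one.\<close>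
  define Ul where "Ul = {Q \<in> topspace (tau p Om). integral\<^sup>L Q (h z0) \<in> {?I z0 - e / 2 <..}}"
  define Uu where "Uu = {Q \<in> topspace (tau p Om). integral\<^sup>L Q (h z0) \<in> {..< ?I z0 + e / 2}}"
  have op: "openin (tau p Om) Ul" "openin (tau p Om) Uu"
    unfolding Ul_def Uu_def by (auto intro!: openin_continuous_map_preimage[OF ct[OF z0]] simp del: greaterThan_iff lessThan_iff)
  let ?Vl = "{z \<in> ?Z. ?P z \<subseteq> Ul}" and ?Vu = "{z \<in> ?Z. ?P z \<inter> Uu \<noteq> {}}"
  have opV: "openin (top_of_set ?Z) ?Vl" "openin (top_of_set ?Z) ?Vu"
    using A1_uhc A1_lhc op unfolding uhc_def lhc_def by (auto simp: case_prod_beta')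
  have "z0 \<in> ?Vl"
    using z0 compactin_subset_topspace[OF P(1)[OF z0]] inf_low[OF z0] e by (fastforce simp: Ul_def)
  moreover have "z0 \<in> ?Vu"
    using z0 compactin_subset_topspace[OF P(1)[OF z0]] inf_att[OF z0] e by (fastforce simp: Uu_def)
  ultimately have "z0 \<in> ?Vl \<inter> ?Vu" by blast
  moreover have "openin (top_of_set ?Z) (?Vl \<inter> ?Vu)" using opV by (rule openin_Int)
  ultimately obtain d2 where d2: "d2 > 0" "\<And>z. z \<in> ?Z \<Longrightarrow> dist z z0 < d2 \<Longrightarrow> z \<in> ?Vl \<inter> ?Vu"
    unfolding openin_euclidean_subtopology_iff by meson
  show "\<exists>d>0. \<forall>z\<in>?Z. dist z z0 < d \<longrightarrow> dist (?I z) (?I z0) < e"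
  proof (intro exI[of _ "min 1 (min d1 d2)"] conjI ballI impI)
    fix z assume z: "z \<in> ?Z" "dist z z0 < min 1 (min d1 d2)"
    obtain Q where Q: "Q \<in> ?P z" "integral\<^sup>L Q (h z) = ?I z" using inf_att[OF z(1)] by blast
    have "?I z0 - e / 2 < integral\<^sup>L Q (h z0)" using Q d2(2)[OF z(1)] z(2) by (auto simp: Ul_def)
    moreover have "\<bar>integral\<^sup>L Q (h z) - integral\<^sup>L Q (h z0)\<bar> \<le> e / 2" using change[OF z(1) _ _ Q(1)] z(2) by auto
    ultimately have "?I z0 - e < ?I z" using Q(2) by linarith
    moreover obtain Q' where Q': "Q' \<in> ?P z" "integral\<^sup>L Q' (h z0) < ?I z0 + e / 2"
      using d2(2)[OF z(1)] z(2) by (auto simp: Uu_def)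
    moreover have "\<bar>integral\<^sup>L Q' (h z) - integral\<^sup>L Q' (h z0)\<bar> \<le> e / 2" using change[OF z(1) _ _ Q'(1)] z(2) by auto
    moreover have "?I z \<le> integral\<^sup>L Q' (h z)" using inf_low[OF z(1) Q'(1)] .
    ultimately show "dist (?I z) (?I z0) < e" unfolding dist_real_def by linarith
  qed (use d1 d2 in auto)
qed

end

section \<open>The Bellman operator\<close>

context robust_mdp begin

lemma stage_unif_Cp:
  assumes "v \<in> Cp p Om"
  shows "(\<lambda>z y. r (fst z) (snd z) y + \<alpha> * v y) \<in> unif_Cp"
  using unif_Cp_add_cmult[OF unif_Cp_r unif_Cp_const[OF assms], of \<alpha>] by (simp add: case_prod_beta')

lemma stage_Cp: "v \<in> Cp p Om \<Longrightarrow> x \<in> Om \<Longrightarrow> a \<in> A \<Longrightarrow> (\<lambda>y. r x a y + \<alpha> * v y) \<in> Cp p Om"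
  by (intro Cp_add Cp_cmult r_Cp)

definition worst_value :: "('x \<Rightarrow> real) \<Rightarrow> 'x \<Rightarrow> 'u \<Rightarrow> real" where
  "worst_value v x a = (INF Q\<in>Pc x a. stageval r \<alpha> v x a Q)"

lemma worst_value_le:
  assumes "v \<in> Cp p Om" "x \<in> Om" "a \<in> A" "Q \<in> Pc x a"
  shows "worst_value v x a \<le> stageval r \<alpha> v x a Q"
  unfolding worst_value_def stageval_def using assms
  by (intro cINF_lower compactin_bdd_below_image_real[OF Pc_compact] continuous_map_tau_integral stage_Cp)

lemma worst_value_attained:
  assumes "v \<in> Cp p Om" "x \<in> Om" "a \<in> A"
  obtains Q where "Q \<in> Pc x a" "stageval r \<alpha> v x a Q = worst_value v x a"
  using compactin_attains_inf_real[OF Pc_compact[OF assms(2,3)] Pc_nonempty[OF assms(2,3)]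
      continuous_map_tau_integral[OF stage_Cp[OF assms]]]
  unfolding worst_value_def stageval_def by metis

lemma continuous_on_worst_value:
  "v \<in> Cp p Om \<Longrightarrow> continuous_on (Om \<times> A) (\<lambda>z. worst_value v (fst z) (snd z))"
  using continuous_on_INF_integral[OF stage_unif_Cp] by (simp add: worst_value_def stageval_def)

section \<open>Measurable optimal kernels and actions\<close>

text \<open>Objective 0 is the stage value, which makes the selection optimal; the later objectives
  are integrals of the test functions, which make it a measurable kernel.\<close>

lemma optkernel_exists:
  assumes v: "v \<in> Cp p Om"
  shows "\<exists>P0. optkernel Om A Pc r \<alpha> v P0"
proof -
  let ?M = "restrict_space borel (Om \<times> A) :: ('x \<times> 'u) measure"
  have sp: "space ?M = Om \<times> A" by (simp add: space_restrict_space)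
  obtain g :: "nat \<Rightarrow> 'x \<Rightarrow> real" where g: "\<And>n. continuous_on UNIV (g n)" "\<And>n x. 0 \<le> g n x" "\<And>n x. g n x \<le> 1"
    and ker: "\<And>K. (\<And>z. z \<in> space ?M \<Longrightarrow> K z \<in> M1 Om) \<Longrightarrow>
      (\<And>n. (\<lambda>z. integral\<^sup>L (K z) (g n)) \<in> borel_measurable ?M) \<Longrightarrow> K \<in> measurable ?M (prob_algebra (locsp Om))"
    using countable_family_measurable_kernel[of Om ?M] Om(1) by (metis borel_closed)
  \<comment> \<open>Agreement with an integral is demanded on \<open>M1p\<close> only: additivity,
    on which closure under \<open>F + k G\<close> rests, presupposes that both integrals
    exist.\<close>
  define H where "H = {F. \<exists>h\<in>unif_Cp. \<forall>z\<in>Om \<times> A. \<forall>Q\<in>M1p p Om. F z Q = integral\<^sup>L Q (h z)}"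
  define f where "f n z Q = integral\<^sup>L Q (case n of 0 \<Rightarrow> (\<lambda>y. r (fst z) (snd z) y + \<alpha> * v y) | Suc m \<Rightarrow> g m)"
    for n :: nat and z Q
  obtain s where s: "\<And>z. z \<in> space ?M \<Longrightarrow> s z \<in> Pc (fst z) (snd z)"
    "\<And>z. z \<in> space ?M \<Longrightarrow> f 0 z (s z) = (INF Q\<in>Pc (fst z) (snd z). f 0 z Q)"
    "\<And>n. (\<lambda>z. f n z (s z)) \<in> borel_measurable ?M"
  proof (rule measurable_lexicographic_selection[where M = ?M and Y = "tau p Om" and \<phi> = "\<lambda>z. Pc (fst z) (snd z)"
        and H = H and f = f])
    show "compactin (tau p Om) (Pc (fst z) (snd z))" "Pc (fst z) (snd z) \<noteq> {}" if "z \<in> space ?M" for z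
      using that Pc_compact Pc_nonempty by (auto simp: sp)
    show "continuous_map (tau p Om) euclideanreal (F z)" if F: "F \<in> H" and z: "z \<in> space ?M" for F z
    proof -
      obtain h where h: "h \<in> unif_Cp" "\<And>Q. Q \<in> M1p p Om \<Longrightarrow> F z Q = integral\<^sup>L Q (h z)"
        using F z by (auto simp: H_def sp)
      have "h z \<in> Cp p Om" using h(1) z by (auto simp: unif_Cp_def sp)
      from continuous_map_tau_integral[OF this] show ?thesis
        by (rule continuous_map_eq) (use h(2) in \<open>auto simp: topspace_tau\<close>)
    qed
    show "(\<lambda>z Q. F z Q + real k * G z Q) \<in> H" if FG: "F \<in> H" "G \<in> H" for F G k
    proof -
      obtain h j where h: "h \<in> unif_Cp" "\<And>z Q. z \<in> Om \<times> A \<Longrightarrow> Q \<in> M1p p Om \<Longrightarrow> F z Q = integral\<^sup>L Q (h z)"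
        and j: "j \<in> unif_Cp" "\<And>z Q. z \<in> Om \<times> A \<Longrightarrow> Q \<in> M1p p Om \<Longrightarrow> G z Q = integral\<^sup>L Q (j z)"
        using FG unfolding H_def by blast
      have "F z Q + real k * G z Q = integral\<^sup>L Q (\<lambda>y. h z y + real k * j z y)"
        if z: "z \<in> Om \<times> A" "Q \<in> M1p p Om" for z Q
      proof -
        have "integrable Q (h z)" "integrable Q (j z)"
          using h(1) j(1) z by (auto simp: unif_Cp_def intro!: integrable_Cp)
        then show ?thesis using h(2)[OF z] j(2)[OF z] by simp
      qed
      then show ?thesis
        unfolding H_def using unif_Cp_add_cmult[OF h(1) j(1)]
        by (intro CollectI bexI[of _ "\<lambda>z y. h z y + real k * j z y"]) auto
    qed
    show "(\<lambda>z. INF Q\<in>Pc (fst z) (snd z). F z Q) \<in> borel_measurable ?M" if F: "F \<in> H" for F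
    proof -
      obtain h where h: "h \<in> unif_Cp" "\<And>z Q. z \<in> Om \<times> A \<Longrightarrow> Q \<in> M1p p Om \<Longrightarrow> F z Q = integral\<^sup>L Q (h z)"
        using F by (auto simp: H_def)
      have eq: "(INF Q\<in>Pc (fst z) (snd z). F z Q) = (INF Q\<in>Pc (fst z) (snd z). integral\<^sup>L Q (h z))"
        if "z \<in> space ?M" for z
        using that Pc_M1p h(2) by (intro INF_cong) (auto simp: sp)
      show ?thesis
        using borel_measurable_continuous_on_restrict[OF continuous_on_INF_integral[OF h(1)]]
        by (subst measurable_cong[OF eq])
    qed
    show "f n \<in> H" for n
    proof (cases n)
      case 0
      then show ?thesis
        unfolding H_def f_def using stage_unif_Cp[OF v]
        by (intro CollectI bexI[of _ "\<lambda>z y. r (fst z) (snd z) y + \<alpha> * v y"]) auto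
    next
      case (Suc m)
      have "g m \<in> Cp p Om"
        using g by (intro Cp_bounded) (auto intro: continuous_on_subset)
      from unif_Cp_const[OF this] show ?thesis unfolding H_def f_def Suc by auto
    qed
  qed auto
  have "s \<in> measurable ?M (prob_algebra (locsp Om))"
  proof (rule ker)
    show "s z \<in> M1 Om" if "z \<in> space ?M" for z
      using s(1)[OF that] that Pc_M1p by (auto simp: sp intro: M1pD(4))
    show "(\<lambda>z. integral\<^sup>L (s z) (g n)) \<in> borel_measurable ?M" for n
      using s(3)[of "Suc n"] by (simp add: f_def)
  qed
  then show ?thesis
    using s(1,2) unfolding optkernel_def sp
    by (intro exI[of _ s]) (auto simp: f_def stageval_def)
qed

lemma measurable_argmax_exists:
  assumes v: "v \<in> Cp p Om"
  obtains s where "s \<in> Aloc Om A" "\<And>x a. x \<in> Om \<Longrightarrow> a \<in> A \<Longrightarrow> worst_value v x a \<le> worst_value v x (s x)"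
proof -
  let ?M = "locsp Om" and ?Y = "top_of_set A"
  have sp: "space ?M = Om" by (simp add: space_restrict_space)
  define H where "H = {h::'x \<Rightarrow> 'u \<Rightarrow> real. continuous_on (Om \<times> A) (\<lambda>z. h (fst z) (snd z))}"
  \<comment> \<open>The sign turns the maximisation into the first minimisation. On the finite set
    \<open>Basis\<close>, \<open>from_nat_into\<close> reaches every basis vector and only repeats
    vectors at surplus indices.\<close>
  define f where "f n x a = (case n of 0 \<Rightarrow> - worst_value v x a | Suc m \<Rightarrow> a \<bullet> from_nat_into Basis m)"
    for n :: nat and x a
  have Ycpt: "compactin ?Y A" using A by (simp add: compactin_subtopology)
  have cont: "continuous_map ?Y euclideanreal (h x)" if "h \<in> H" "x \<in> Om" for h x
  proof -
    have "continuous_on (Om \<times> A) (\<lambda>z. h (fst z) (snd z))" using that by (simp add: H_def)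
    then have "continuous_on A (\<lambda>a. h (fst (x, a)) (snd (x, a)))"
      by (rule continuous_on_compose2) (use that(2) in \<open>auto intro!: continuous_intros\<close>)
    then show ?thesis by simp
  qed
  have fH: "f n \<in> H" for n
    using continuous_on_worst_value[OF v]
    by (cases n) (auto simp: H_def f_def intro!: continuous_intros)
  obtain s where s: "\<And>x. x \<in> space ?M \<Longrightarrow> s x \<in> A"
    "\<And>x. x \<in> space ?M \<Longrightarrow> f 0 x (s x) = (INF a\<in>A. f 0 x a)"
    "\<And>n. (\<lambda>x. f n x (s x)) \<in> borel_measurable ?M"
  proof (rule measurable_lexicographic_selection[where M = ?M and Y = ?Y and \<phi> = "\<lambda>_. A" and H = H and f = f])
    show "compactin ?Y A" "A \<noteq> {}" using Ycpt A by auto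
    show "continuous_map ?Y euclideanreal (h x)" if "h \<in> H" "x \<in> space ?M" for h x
      using cont that sp by auto
    show "(\<lambda>x a. h x a + real k * g x a) \<in> H" if "h \<in> H" "g \<in> H" for h g k
      using that unfolding H_def by (auto intro!: continuous_intros)
    show "(\<lambda>x. INF a\<in>A. h x a) \<in> borel_measurable ?M" if "h \<in> H" for h
      using continuous_on_INF_compact[OF Om(1) A, of "\<lambda>z. h (fst z) (snd z)"] that
      by (intro borel_measurable_locsp) (simp add: H_def)
    show "f n \<in> H" for n by (rule fH)
  qed auto
  have "s \<in> borel_measurable ?M"
  proof (subst borel_measurable_euclidean_space, intro ballI)
    fix b :: 'u assume b: "b \<in> Basis"
    then obtain m where "from_nat_into Basis m = b"
      using from_nat_into_surj[OF countable_finite[OF finite_Basis]] by metis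
    then show "(\<lambda>x. s x \<bullet> b) \<in> borel_measurable ?M"
      using s(3)[of "Suc m"] by (simp add: f_def)
  qed
  then have "s \<in> Aloc Om A"
    unfolding Aloc_def using s(1) by (intro measurable_restrict_space2) auto
  moreover have "worst_value v x a \<le> worst_value v x (s x)" if xa: "x \<in> Om" "a \<in> A" for x a
  proof -
    have "(INF a\<in>A. f 0 x a) \<le> f 0 x a"
      using xa by (intro cINF_lower compactin_bdd_below_image_real[OF Ycpt cont[OF fH]])
    then show ?thesis using s(2)[of x] xa by (simp add: sp f_def)
  qed
  ultimately show thesis using that by blast
qed

lemma Aloc_in: "a \<in> Aloc Om A \<Longrightarrow> x \<in> Om \<Longrightarrow> a x \<in> A"
  unfolding Aloc_def using measurable_space[of a "locsp Om" "restrict_space borel A" x]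
  by (simp add: space_restrict_space)

text \<open>A measurable pointwise maximiser attains the supremum over actions at \<open>x\<close>
  and the supremum over measurable maps together, so the two agree.\<close>

lemma Tb_eq_worst_value_argmax:
  assumes s: "s \<in> Aloc Om A" "\<And>x a. x \<in> Om \<Longrightarrow> a \<in> A \<Longrightarrow> worst_value v x a \<le> worst_value v x (s x)"
    and x: "x \<in> Om"
  shows "Tb A Pc r \<alpha> v x = worst_value v x (s x)"
    "(SUP a\<in>Aloc Om A. worst_value v x (a x)) = worst_value v x (s x)"
  unfolding Tb_def worst_value_def[symmetric]
  using s x by (auto intro!: cSup_eq_maximum intro: Aloc_in)

text \<open>Frees later arguments from the particular maximiser constructed above: they work for
  every optimal action.\<close>

lemma optaction_iff:
  assumes v: "v \<in> Cp p Om"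
  shows "optaction Om A Pc r \<alpha> v as \<longleftrightarrow> as \<in> Aloc Om A \<and> (\<forall>x\<in>Om. worst_value v x (as x) = Tb A Pc r \<alpha> v x)"
proof -
  obtain s where s: "s \<in> Aloc Om A" "\<And>x a. x \<in> Om \<Longrightarrow> a \<in> A \<Longrightarrow> worst_value v x a \<le> worst_value v x (s x)"
    using measurable_argmax_exists[OF v] by metis
  show ?thesis
    unfolding optaction_def worst_value_def[symmetric] using Tb_eq_worst_value_argmax[OF s] by auto
qed

lemma optaction_exists:
  assumes v: "v \<in> Cp p Om"
  shows "\<exists>as. optaction Om A Pc r \<alpha> v as"
proof -
  obtain s where s: "s \<in> Aloc Om A" "\<And>x a. x \<in> Om \<Longrightarrow> a \<in> A \<Longrightarrow> worst_value v x a \<le> worst_value v x (s x)"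
    using measurable_argmax_exists[OF v] by metis
  then have "optaction Om A Pc r \<alpha> v s"
    using Tb_eq_worst_value_argmax(1)[OF s] by (simp add: optaction_iff[OF v])
  then show ?thesis by blast
qed

lemma worst_value_le_Tb:
  assumes "v \<in> Cp p Om" "x \<in> Om" "a \<in> A"
  shows "worst_value v x a \<le> Tb A Pc r \<alpha> v x"
proof -
  obtain s where s: "s \<in> Aloc Om A" "\<And>x a. x \<in> Om \<Longrightarrow> a \<in> A \<Longrightarrow> worst_value v x a \<le> worst_value v x (s x)"
    using measurable_argmax_exists[OF assms(1)] by metis
  show ?thesis using s(2)[OF assms(2,3)] Tb_eq_worst_value_argmax(1)[OF s assms(2)] by simp
qed

lemma Tb_attained:
  assumes "v \<in> Cp p Om" "x \<in> Om"
  obtains a where "a \<in> A" "Tb A Pc r \<alpha> v x = worst_value v x a"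
proof -
  obtain s where s: "s \<in> Aloc Om A" "\<And>x a. x \<in> Om \<Longrightarrow> a \<in> A \<Longrightarrow> worst_value v x a \<le> worst_value v x (s x)"
    using measurable_argmax_exists[OF assms(1)] by metis
  show ?thesis using that[OF Aloc_in[OF s(1) assms(2)]] Tb_eq_worst_value_argmax(1)[OF s assms(2)] by simp
qed

section \<open>Growth and contraction of the Bellman operator\<close>

lemma abs_r_le:
  assumes "x \<in> Om" "a \<in> A" "y \<in> Om"
  shows "\<bar>r x a y\<bar> \<le> Cr * w x + Cr * w y"
proof -
  have "\<bar>r x a y\<bar> \<le> Cr * (1 + norm x ^ p + norm y ^ p)" using r_growth assms by auto
  also have "\<dots> \<le> Cr * (w x + w y)" using Cr by (intro mult_left_mono) auto
  finally show ?thesis by (simp add: distrib_left)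
qed

text \<open>The first \<open>Cr\<close> is the share of the current state; the remaining terms are
  integrated over the next state and pick up \<open>CP\<close>.\<close>

lemma abs_stageval_le:
  assumes v: "v \<in> Cp p Om" "c \<ge> 0" "\<And>y. y \<in> Om \<Longrightarrow> \<bar>v y\<bar> \<le> c * w y"
    and xa: "x \<in> Om" "a \<in> A" and Q: "Q \<in> Pc x a"
  shows "\<bar>stageval r \<alpha> v x a Q\<bar> \<le> (Cr + (Cr + \<alpha> * c) * CP) * w x"
proof -
  have QM: "Q \<in> M1p p Om" using Pc_M1p xa Q by auto
  interpret prob_space Q using M1pD(3)[OF QM] .
  have b: "\<bar>r x a y + \<alpha> * v y\<bar> \<le> Cr * w x + (Cr + \<alpha> * c) * w y" if y: "y \<in> Om" for y
  proof -
    have "\<bar>r x a y\<bar> \<le> Cr * w x + Cr * w y" using abs_r_le xa y by blast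
    moreover have "\<bar>\<alpha> * v y\<bar> \<le> \<alpha> * c * w y"
      using mult_left_mono[OF v(3)[OF y], of \<alpha>] alpha by (simp add: abs_mult mult.assoc)
    ultimately show ?thesis
      using abs_triangle_ineq[of "r x a y" "\<alpha> * v y"] unfolding distrib_right[of Cr] by linarith
  qed
  have iw: "integrable Q (\<lambda>y. (Cr + \<alpha> * c) * w y)"
    by (rule integrable_mult_right[OF M1pD(5)[OF QM]])
  have "\<bar>stageval r \<alpha> v x a Q\<bar> \<le> (\<integral>y. \<bar>r x a y + \<alpha> * v y\<bar> \<partial>Q)"
    unfolding stageval_def by (rule integral_abs_bound)
  also have "\<dots> \<le> (\<integral>y. Cr * w x + (Cr + \<alpha> * c) * w y \<partial>Q)"
    by (rule integral_mono[OF integrable_abs[OF integrable_Cp[OF stage_Cp[OF v(1) xa] QM]]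
          Bochner_Integration.integrable_add[OF integrable_const iw]])
       (use b M1pD(2)[OF QM] in auto)
  also have "\<dots> = Cr * w x + (Cr + \<alpha> * c) * integral\<^sup>L Q w"
    unfolding Bochner_Integration.integral_add[OF integrable_const iw] integral_mult_right_zero lebesgue_integral_const
    by (simp add: prob_space)
  also have "\<dots> \<le> Cr * w x + (Cr + \<alpha> * c) * (CP * w x)"
    using integral_w_le[OF xa Q] Cr alpha v(2) by (intro add_left_mono mult_left_mono) auto
  finally show ?thesis by (simp add: algebra_simps)
qed

lemma Tb_Cp:
  assumes v: "v \<in> Cp p Om"
  shows "Tb A Pc r \<alpha> v \<in> Cp p Om"
proof -
  obtain c where c: "c \<ge> 0" "\<And>y. y \<in> Om \<Longrightarrow> \<bar>v y\<bar> \<le> c * w y" using CpE[OF v] by metis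
  show ?thesis
  proof (rule CpI[where C = "Cr + (Cr + \<alpha> * c) * CP"])
    \<comment> \<open>The supremum is treated as minus an infimum; for reals this is the very
      definition of \<open>Inf\<close>, so the conversion raises no boundedness condition.\<close>
    have "continuous_on Om (\<lambda>x. INF a\<in>A. - worst_value v (fst (x, a)) (snd (x, a)))"
      using continuous_on_worst_value[OF v] by (intro continuous_on_INF_compact Om A continuous_intros)
    then have "continuous_on Om (\<lambda>x. - (INF a\<in>A. - worst_value v x a))"
      by (intro continuous_intros) simp
    moreover have "- (INF a\<in>A. - worst_value v x a) = Tb A Pc r \<alpha> v x" for x
      using Inf_real_def[of "(\<lambda>a. - worst_value v x a) ` A"]
      unfolding Tb_def worst_value_def[symmetric] by (simp add: image_image)
    ultimately show "continuous_on Om (Tb A Pc r \<alpha> v)" by simp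
  next
    fix x assume x: "x \<in> Om"
    obtain a where a: "a \<in> A" "Tb A Pc r \<alpha> v x = worst_value v x a" using Tb_attained[OF v x] by metis
    obtain Q where Q: "Q \<in> Pc x a" "stageval r \<alpha> v x a Q = worst_value v x a"
      using worst_value_attained[OF v x a(1)] by metis
    show "\<bar>Tb A Pc r \<alpha> v x\<bar> \<le> (Cr + (Cr + \<alpha> * c) * CP) * w x"
      using abs_stageval_le[OF v c x a(1) Q(1)] Q(2) a(2) by simp
  qed
qed

text \<open>The choices are mixed: the action is optimal for \<open>v\<close>, the measure is worst
  for \<open>u\<close> at that action. Both replacements err in the favourable direction, and only
  the integral of \<open>v - u\<close> is left.\<close>

lemma Tb_le_Tb_add:
  assumes v: "v \<in> Cp p Om" and u: "u \<in> Cp p Om" and c: "c \<ge> 0" "\<And>y. y \<in> Om \<Longrightarrow> \<bar>v y - u y\<bar> \<le> c * w y"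
    and x: "x \<in> Om"
  shows "Tb A Pc r \<alpha> v x \<le> Tb A Pc r \<alpha> u x + \<alpha> * CP * c * w x"
proof -
  obtain a where a: "a \<in> A" "Tb A Pc r \<alpha> v x = worst_value v x a" using Tb_attained[OF v x] by metis
  obtain Q where Q: "Q \<in> Pc x a" "stageval r \<alpha> u x a Q = worst_value u x a"
    using worst_value_attained[OF u x a(1)] by metis
  have QM: "Q \<in> M1p p Om" using Pc_M1p x a Q by auto
  have dCp: "(\<lambda>y. v y - u y) \<in> Cp p Om" by (intro Cp_diff v u)
  have "Tb A Pc r \<alpha> v x \<le> stageval r \<alpha> v x a Q"
    unfolding a(2) using worst_value_le[OF v x a(1) Q(1)] .
  also have "\<dots> = stageval r \<alpha> u x a Q + \<alpha> * integral\<^sup>L Q (\<lambda>y. v y - u y)"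
  proof -
    note i = integrable_Cp[OF stage_Cp[OF u x a(1)] QM] integrable_Cp[OF dCp QM]
    have "stageval r \<alpha> v x a Q = integral\<^sup>L Q (\<lambda>y. (r x a y + \<alpha> * u y) + \<alpha> * (v y - u y))"
      unfolding stageval_def by (simp add: algebra_simps)
    also have "\<dots> = stageval r \<alpha> u x a Q + \<alpha> * integral\<^sup>L Q (\<lambda>y. v y - u y)"
      unfolding stageval_def
      by (subst Bochner_Integration.integral_add[OF i(1) integrable_mult_right[OF i(2)]]) simp
    finally show ?thesis .
  qed
  also have "\<dots> \<le> stageval r \<alpha> u x a Q + \<alpha> * (c * (CP * w x))"
    using abs_integral_le[OF x a(1) Q(1) dCp c(1)] c(2) alpha
    by (intro add_left_mono mult_left_mono) (auto simp: abs_le_iff)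
  also have "\<dots> \<le> Tb A Pc r \<alpha> u x + \<alpha> * CP * c * w x"
    using worst_value_le_Tb[OF u x a(1)] Q(2) by (simp add: algebra_simps)
  finally show ?thesis .
qed

lemma Tb_diff_le:
  assumes v: "v \<in> Cp p Om" and u: "u \<in> Cp p Om" and c: "c \<ge> 0" "\<And>y. y \<in> Om \<Longrightarrow> \<bar>v y - u y\<bar> \<le> c * w y"
    and x: "x \<in> Om"
  shows "\<bar>Tb A Pc r \<alpha> v x - Tb A Pc r \<alpha> u x\<bar> \<le> \<alpha> * CP * c * w x"
  using Tb_le_Tb_add[OF v u c x] Tb_le_Tb_add[OF u v c(1) _ x] c(2)
  by (simp add: abs_le_iff abs_minus_commute)

lemma cpnorm_le: "(\<And>x. x \<in> Om \<Longrightarrow> \<bar>g x\<bar> \<le> C * w x) \<Longrightarrow> cpnorm p Om g \<le> C"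
  unfolding cpnorm_def using w_pos Om by (intro cSUP_least) (auto simp: divide_le_eq)

lemma abs_le_cpnorm:
  assumes "g \<in> Cp p Om" "x \<in> Om"
  shows "\<bar>g x\<bar> \<le> cpnorm p Om g * w x"
proof -
  obtain C where C: "\<And>x. x \<in> Om \<Longrightarrow> \<bar>g x\<bar> \<le> C * w x" using CpE[OF assms(1)] by metis
  have "\<bar>g x\<bar> / w x \<le> cpnorm p Om g"
    unfolding cpnorm_def using C w_pos assms(2)
    by (intro cSUP_upper bdd_aboveI2[where M = C]) (auto simp: divide_le_eq)
  then show ?thesis using w_pos[of x] by (simp add: divide_le_eq)
qed

lemma cpnorm_nonneg: "g \<in> Cp p Om \<Longrightarrow> 0 \<le> cpnorm p Om g"
proof -
  assume g: "g \<in> Cp p Om"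
  obtain x where "x \<in> Om" using Om by auto
  from abs_le_cpnorm[OF g this] have "0 \<le> cpnorm p Om g * w x" by linarith
  then show ?thesis using w_pos[of x] by (simp add: zero_le_mult_iff)
qed

lemma Tb_contraction:
  assumes "v \<in> Cp p Om" "u \<in> Cp p Om"
  shows "cpnorm p Om (\<lambda>x. Tb A Pc r \<alpha> v x - Tb A Pc r \<alpha> u x) \<le> \<alpha> * CP * cpnorm p Om (\<lambda>x. v x - u x)"
  using Tb_diff_le[OF assms cpnorm_nonneg abs_le_cpnorm] assms by (intro cpnorm_le) (auto intro: Cp_diff)

lemma contraction_factor: "0 < \<alpha> * CP" "\<alpha> * CP < 1"
  using alpha CP by (auto simp: pos_less_divide_eq)

lemma Tb_iterate_diff_le:
  assumes v: "v \<in> Cp p Om" and u: "u \<in> Cp p Om" and c: "c \<ge> 0" "\<And>y. y \<in> Om \<Longrightarrow> \<bar>v y - u y\<bar> \<le> c * w y"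
  shows "(Tb A Pc r \<alpha> ^^ n) v \<in> Cp p Om"
    "x \<in> Om \<Longrightarrow> \<bar>(Tb A Pc r \<alpha> ^^ n) v x - (Tb A Pc r \<alpha> ^^ n) u x\<bar> \<le> (\<alpha> * CP) ^ n * c * w x"
proof -
  have it: "(Tb A Pc r \<alpha> ^^ n) g \<in> Cp p Om" if "g \<in> Cp p Om" for g n
    using that by (induction n) (auto intro: Tb_Cp)
  then show "(Tb A Pc r \<alpha> ^^ n) v \<in> Cp p Om" using v .
  show "\<bar>(Tb A Pc r \<alpha> ^^ n) v x - (Tb A Pc r \<alpha> ^^ n) u x\<bar> \<le> (\<alpha> * CP) ^ n * c * w x" if "x \<in> Om"
    using that
  proof (induction n arbitrary: x)
    case (Suc n)
    show ?case
      using Tb_diff_le[OF it[OF v] it[OF u] _ Suc.IH Suc.prems] contraction_factor c(1)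
      by (simp add: mult.assoc)
  qed (use c in simp)
qed

text \<open>The contraction estimate with constant 0: measures on \<open>Om\<close> do not see
  values elsewhere.\<close>

lemma Tb_cong:
  assumes "\<And>x. x \<in> Om \<Longrightarrow> v x = u x" "v \<in> Cp p Om" "u \<in> Cp p Om" "x \<in> Om"
  shows "Tb A Pc r \<alpha> v x = Tb A Pc r \<alpha> u x"
  using Tb_diff_le[OF assms(2,3), of 0 x] assms by simp

section \<open>The fixed point and convergence of the iterates\<close>

text \<open>Elements of \<open>Cp\<close> are total functions, on which \<open>cpnorm\<close> is
  only a seminorm, so the limit is built explicitly: the increments divided by the weight form a
  uniformly convergent series by the Weierstrass test, and the sum times the weight is the fixed
  point.\<close>

lemma Tb_fixed_point_exists:
  obtains v where "v \<in> Cp p Om" "\<And>x. x \<in> Om \<Longrightarrow> Tb A Pc r \<alpha> v x = v x"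
proof -
  let ?T = "Tb A Pc r \<alpha>" and ?q = "\<alpha> * CP"
  define s where "s n = (?T ^^ n) (\<lambda>_. 0)" for n
  have z: "(\<lambda>_. 0) \<in> Cp p Om" by (rule CpI[where C = 0]) auto
  have s: "s n \<in> Cp p Om" for n
    unfolding s_def using z by (intro Tb_iterate_diff_le(1)[OF z z, of 0]) auto
  obtain c where c: "c \<ge> 0" "\<And>x. x \<in> Om \<Longrightarrow> \<bar>s 1 x - s 0 x\<bar> \<le> c * w x"
    using CpE[OF Cp_diff[OF s s]] by metis
  have step: "\<bar>s (Suc n) x - s n x\<bar> \<le> ?q ^ n * c * w x" if "x \<in> Om" for n x
    using Tb_iterate_diff_le(2)[OF s s c that, of n] by (simp add: s_def funpow_swap1)
  define d where "d n x = (s (Suc n) x - s n x) / w x" for n x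
  have d: "norm (d n x) \<le> ?q ^ n * c" if "x \<in> Om" for n x
    using step[OF that, of n] w_pos[of x] by (simp add: d_def abs_mult divide_le_eq)
  \<comment> \<open>No initial term remains because the iteration starts at the zero
    function.\<close>
  have tel: "(\<Sum>i<n. d i x) = s n x / w x" for n x
    by (induction n) (auto simp: d_def s_def diff_divide_distrib)
  define b where "b x = (\<Sum>i. d i x)" for x
  have sm: "summable (\<lambda>n. ?q ^ n * c)"
    using contraction_factor by (intro summable_mult2 summable_geometric) auto
  have ul: "uniform_limit Om (\<lambda>n x. \<Sum>i<n. d i x) b sequentially"
    unfolding b_def by (rule Weierstrass_m_test[OF d sm])
  have contb: "continuous_on Om b"
  proof (rule uniform_limit_theorem[OF _ ul])
    show "\<forall>\<^sub>F n in sequentially. continuous_on Om (\<lambda>x. \<Sum>i<n. d i x)"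
      unfolding tel using s w_pos
      by (intro always_eventually allI continuous_intros ballI less_imp_neq[THEN not_sym])
         (auto simp: Cp_def)
  qed simp
  define v where "v x = b x * w x" for x
  have cancel: "t / c * c = t" if "0 < c" for t c :: real using that by simp
  \<comment> \<open>Two consecutive iterates are needed: \<open>?T v\<close> is compared with
    \<open>?T (s n)\<close>, which is \<open>s (Suc n)\<close>.\<close>
  have near: "\<exists>n. \<forall>x\<in>Om. \<bar>v x - s n x\<bar> \<le> e * w x \<and> \<bar>v x - s (Suc n) x\<bar> \<le> e * w x" if e: "e > 0" for e
  proof -
    obtain N where N: "\<And>n x. n \<ge> N \<Longrightarrow> x \<in> Om \<Longrightarrow> dist (\<Sum>i<n. d i x) (b x) < e"
      using uniform_limitD[OF ul e] unfolding eventually_sequentially by blast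
    have "\<bar>v x - s n x\<bar> \<le> e * w x" if "n \<ge> N" "x \<in> Om" for n x
    proof -
      have "v x - s n x = (b x - (\<Sum>i<n. d i x)) * w x"
        unfolding v_def tel left_diff_distrib cancel[OF w_pos] ..
      then have "\<bar>v x - s n x\<bar> = \<bar>b x - (\<Sum>i<n. d i x)\<bar> * w x"
        by (simp add: abs_mult)
      also have "\<dots> \<le> e * w x"
        using N[OF that] w_pos[of x] by (intro mult_right_mono) (auto simp: dist_real_def abs_minus_commute)
      finally show ?thesis .
    qed
    then show ?thesis by (intro exI[of _ N]) auto
  qed
  have v: "v \<in> Cp p Om"
  proof -
    obtain n where n: "\<forall>x\<in>Om. \<bar>v x - s n x\<bar> \<le> 1 * w x" using near[of 1] by auto
    obtain C where C: "\<And>x. x \<in> Om \<Longrightarrow> \<bar>s n x\<bar> \<le> C * w x" using CpE[OF s] by metis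
    show ?thesis
    proof (rule CpI[where C = "1 + C"])
      show "continuous_on Om v" unfolding v_def by (intro continuous_intros contb)
      show "\<bar>v x\<bar> \<le> (1 + C) * w x" if "x \<in> Om" for x
        using bspec[OF n that] C[OF that] unfolding distrib_right[of 1] by linarith
    qed
  qed
  have "?T v x = v x" if x: "x \<in> Om" for x
  proof -
    have "\<bar>?T v x - v x\<bar> \<le> e" if e: "e > 0" for e
    proof -
      define e' where "e' = e / 2 / w x"
      have e': "e' > 0" "e' * w x = e / 2"
        unfolding e'_def using e w_pos[of x] cancel[OF w_pos, of "e / 2" x] by (auto intro: divide_pos_pos)
      obtain n where n: "\<And>x. x \<in> Om \<Longrightarrow> \<bar>v x - s n x\<bar> \<le> e' * w x" "\<bar>v x - s (Suc n) x\<bar> \<le> e' * w x"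
        using near[OF e'(1)] x by auto
      have "\<bar>?T v x - ?T (s n) x\<bar> \<le> ?q * (e' * w x)"
        using Tb_diff_le[OF v s less_imp_le[OF e'(1)] n(1) x] unfolding mult.assoc .
      also have "\<dots> \<le> e' * w x"
        using contraction_factor e unfolding e'(2) by (intro mult_left_le_one_le) auto
      finally have "\<bar>?T v x - s (Suc n) x\<bar> \<le> e / 2" unfolding e'(2) by (simp add: s_def)
      then show ?thesis using n(2) unfolding e'(2) by linarith
    qed
    then show ?thesis using field_le_epsilon[of "\<bar>?T v x - v x\<bar>" 0] by auto
  qed
  then show thesis using that v by blast
qed

lemma Tb_fixed_point_unique:
  assumes v: "v \<in> Cp p Om" "\<And>x. x \<in> Om \<Longrightarrow> Tb A Pc r \<alpha> v x = v x"
    and u: "u \<in> Cp p Om" "\<And>x. x \<in> Om \<Longrightarrow> Tb A Pc r \<alpha> u x = u x" and x: "x \<in> Om"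
  shows "u x = v x"
proof -
  let ?c = "cpnorm p Om (\<lambda>x. u x - v x)"
  have d: "(\<lambda>x. u x - v x) \<in> Cp p Om" using u v by (intro Cp_diff)
  have "?c \<le> \<alpha> * CP * ?c"
    using Tb_diff_le[OF u(1) v(1) cpnorm_nonneg[OF d] abs_le_cpnorm[OF d]] u(2) v(2) by (intro cpnorm_le) auto
  then have "?c * (1 - \<alpha> * CP) \<le> 0" by (simp add: algebra_simps)
  then have "?c = 0" using contraction_factor cpnorm_nonneg[OF d] by (simp add: mult_le_0_iff)
  then show ?thesis using abs_le_cpnorm[OF d x] by simp
qed

lemma Tb_iterates_converge:
  assumes v: "v \<in> Cp p Om" "\<And>x. x \<in> Om \<Longrightarrow> Tb A Pc r \<alpha> v x = v x" and u: "u \<in> Cp p Om"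
  shows "(\<lambda>n. cpnorm p Om (\<lambda>x. (Tb A Pc r \<alpha> ^^ n) u x - v x)) \<longlonglongrightarrow> 0"
proof -
  have d: "(\<lambda>x. u x - v x) \<in> Cp p Om" using u v by (intro Cp_diff)
  let ?c = "cpnorm p Om (\<lambda>x. u x - v x)"
  note it = Tb_iterate_diff_le[OF u v(1) cpnorm_nonneg[OF d] abs_le_cpnorm[OF d]]
  have itv: "(Tb A Pc r \<alpha> ^^ n) v \<in> Cp p Om" for n
    using v(1) by (induction n) (auto intro: Tb_Cp)
  \<comment> \<open>\<open>v\<close> is a fixed point on \<open>Om\<close> only, so each iteration
    has to discard the values outside by means of \<open>Tb_cong\<close>.\<close>
  have fixed: "(Tb A Pc r \<alpha> ^^ n) v x = v x" if "x \<in> Om" for n x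
    using that by (induction n arbitrary: x) (auto simp: v(2) intro!: trans[OF Tb_cong[OF _ itv v(1)]])
  have le: "cpnorm p Om (\<lambda>x. (Tb A Pc r \<alpha> ^^ n) u x - v x) \<le> (\<alpha> * CP) ^ n * ?c" for n
    using it(2) fixed by (intro cpnorm_le) auto
  have ge: "0 \<le> cpnorm p Om (\<lambda>x. (Tb A Pc r \<alpha> ^^ n) u x - v x)" for n
    by (intro cpnorm_nonneg Cp_diff it(1) v)
  have "(\<lambda>n. (\<alpha> * CP) ^ n * ?c) \<longlonglongrightarrow> 0"
    using contraction_factor by (intro tendsto_mult_left_zero LIMSEQ_power_zero) auto
  then show ?thesis
    by (rule tendsto_sandwich[OF always_eventually always_eventually tendsto_const, rotated 2])
       (use le ge in blast)+
qed

section \<open>From pointwise optimisers to kernels\<close>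

lemma optkernelD:
  assumes "optkernel Om A Pc r \<alpha> v P0"
  shows "P0 \<in> measurable (restrict_space borel (Om \<times> A)) (prob_algebra (locsp Om))"
    "x \<in> Om \<Longrightarrow> a \<in> A \<Longrightarrow> P0 (x, a) \<in> Pc x a"
    "x \<in> Om \<Longrightarrow> a \<in> A \<Longrightarrow> stageval r \<alpha> v x a (P0 (x, a)) = worst_value v x a"
  using assms by (auto simp: optkernel_def worst_value_def)

text \<open>Joint measurability of \<open>P0\<close> in state and action pays off here: one
  selection serves every measurable action, and so every time-dependent policy.\<close>

lemma optkernel_Kset:
  assumes P0: "optkernel Om A Pc r \<alpha> v P0" and a: "a \<in> Aloc Om A"
  shows "(\<lambda>x. P0 (x, a x)) \<in> Kset Om Pc a"
proof -
  have id: "(\<lambda>x. x) \<in> borel_measurable (locsp Om)"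
    by (rule measurable_restrict_space1) simp
  have "a \<in> borel_measurable (locsp Om)"
    using a unfolding Aloc_def measurable_restrict_space2_iff by simp
  with id have "(\<lambda>x. (x, a x)) \<in> borel_measurable (locsp Om)" by (rule borel_measurable_Pair)
  then have "(\<lambda>x. (x, a x)) \<in> measurable (locsp Om) (restrict_space borel (Om \<times> A))"
    using Aloc_in[OF a] by (intro measurable_restrict_space2) (auto simp: space_restrict_space)
  from measurable_compose[OF this optkernelD(1)[OF P0]] show ?thesis
    unfolding Kset_def using optkernelD(2)[OF P0] Aloc_in[OF a] by auto
qed

text \<open>The kernel induced by an optimal selection attains the pointwise infima at all states
  together, so optimising over kernels gains and loses nothing.\<close>

lemma INF_Kset_eq_worst_value:
  assumes v: "v \<in> Cp p Om" and a: "a \<in> Aloc Om A" and x: "x \<in> Om"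
  shows "(INF K\<in>Kset Om Pc a. stageval r \<alpha> v x (a x) (K x)) = worst_value v x (a x)"
proof -
  obtain P0 where P0: "optkernel Om A Pc r \<alpha> v P0" using optkernel_exists[OF v] by blast
  show ?thesis
  proof (rule cInf_eq_minimum)
    show "worst_value v x (a x) \<in> (\<lambda>K. stageval r \<alpha> v x (a x) (K x)) ` Kset Om Pc a"
      using optkernel_Kset[OF P0 a] optkernelD(3)[OF P0 x Aloc_in[OF a x]] by (intro image_eqI) auto
    show "worst_value v x (a x) \<le> y" if "y \<in> (\<lambda>K. stageval r \<alpha> v x (a x) (K x)) ` Kset Om Pc a" for y
      using that x a by (auto simp: Kset_def intro!: worst_value_le v Aloc_in)
  qed
qed

lemma local_optimality:
  assumes v: "v \<in> Cp p Om" and P0: "optkernel Om A Pc r \<alpha> v P0" and as: "optaction Om A Pc r \<alpha> v as" and x: "x \<in> Om"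
  shows "Tb A Pc r \<alpha> v x = (SUP a'\<in>Aloc Om A. INF K\<in>Kset Om Pc a'. stageval r \<alpha> v x (a' x) (K x))"
    "Tb A Pc r \<alpha> v x = (INF K\<in>Kset Om Pc as. stageval r \<alpha> v x (as x) (K x))"
    "Tb A Pc r \<alpha> v x = stageval r \<alpha> v x (as x) (P0 (x, as x))"
proof -
  have as': "as \<in> Aloc Om A" "\<And>x. x \<in> Om \<Longrightarrow> worst_value v x (as x) = Tb A Pc r \<alpha> v x"
    using as optaction_iff[OF v] by auto
  have "(SUP a'\<in>Aloc Om A. INF K\<in>Kset Om Pc a'. stageval r \<alpha> v x (a' x) (K x))
      = (SUP a'\<in>Aloc Om A. worst_value v x (a' x))"
    by (intro SUP_cong refl INF_Kset_eq_worst_value v x)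
  also have "\<dots> = Tb A Pc r \<alpha> v x"
    using as as'(2)[OF x] x unfolding optaction_def worst_value_def[symmetric] by simp
  finally show "Tb A Pc r \<alpha> v x = (SUP a'\<in>Aloc Om A. INF K\<in>Kset Om Pc a'. stageval r \<alpha> v x (a' x) (K x))" ..
  show "Tb A Pc r \<alpha> v x = (INF K\<in>Kset Om Pc as. stageval r \<alpha> v x (as x) (K x))"
    using INF_Kset_eq_worst_value[OF v as'(1) x] as'(2)[OF x] by simp
  show "Tb A Pc r \<alpha> v x = stageval r \<alpha> v x (as x) (P0 (x, as x))"
    using optkernelD(3)[OF P0 x Aloc_in[OF as'(1) x]] as'(2)[OF x] by simp
qed

end

section \<open>Verification\<close>

locale robust_path =
  robust_mdp Om A Pc r rho0 rhoA p CP Cr L \<alpha> + kernel_path Om x K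
  for Om :: "'x::euclidean_space set" and A :: "'u::euclidean_space set"
    and Pc r rho0 rhoA p CP Cr L \<alpha> x K +
  fixes a :: "nat \<Rightarrow> 'x \<Rightarrow> 'u"
  assumes a: "a \<in> Apol Om A"
    and KPc: "\<And>t y. y \<in> Om \<Longrightarrow> K t y \<in> Pc y (a t y)"
begin

section \<open>Moments along admissible paths\<close>

lemma a_Aloc: "a t \<in> Aloc Om A" using a by (simp add: Apol_def)

lemma a_in: "y \<in> Om \<Longrightarrow> a t y \<in> A" using Aloc_in[OF a_Aloc] .

lemma coord: "\<omega> \<in> space P \<Longrightarrow> \<omega> t \<in> Om"
  using funcset_mem[of \<omega> UNIV Om t] unfolding space_pathmeas by simp

lemma K_M1p: "y \<in> Om \<Longrightarrow> K t y \<in> M1p p Om"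
  using Pc_M1p[OF _ a_in KPc] by blast

lemma w_measurable: "w \<in> borel_measurable S" by (rule Cp_measurable[OF w_Cp])

text \<open>Each step multiplies the weighted moment by at most \<open>CP\<close>. The induction
  runs on nonnegative integrals, since integrability of the weight at time \<open>t\<close> is
  deduced from it.\<close>

lemma nn_integral_w: "(\<integral>\<^sup>+\<omega>. ennreal (w (\<omega> t)) \<partial>P) \<le> ennreal (CP ^ t * w x)"
proof (induction t)
  case 0
  have "(\<lambda>y. ennreal (w y)) \<in> borel_measurable S"
    using measurable_compose[OF w_measurable measurable_ennreal] .
  from nn_integral_initial[OF this] show ?case by simp
next
  case (Suc t)
  have m: "(\<lambda>(u, y). ennreal (w y)) \<in> borel_measurable (S \<Otimes>\<^sub>M S)"
    using measurable_compose[OF measurable_snd measurable_compose[OF w_measurable measurable_ennreal]]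
    by (simp add: case_prod_beta')
  have mw: "(\<lambda>\<omega>. ennreal (w (\<omega> t))) \<in> borel_measurable P"
    using measurable_compose[OF measurable_coord measurable_compose[OF w_measurable measurable_ennreal]] .
  have "(\<integral>\<^sup>+\<omega>. ennreal (w (\<omega> (Suc t))) \<partial>P) = (\<integral>\<^sup>+\<omega>. (\<integral>\<^sup>+y. ennreal (w y) \<partial>K t (\<omega> t)) \<partial>P)"
    using nn_integral_step[OF m, of t] .
  also have "\<dots> \<le> (\<integral>\<^sup>+\<omega>. ennreal CP * ennreal (w (\<omega> t)) \<partial>P)"
  proof (rule nn_integral_mono)
    fix \<omega> assume "\<omega> \<in> space P"
    then have "\<omega> t \<in> Om" by (rule coord)
    then have "(\<integral>\<^sup>+y. ennreal (w y) \<partial>K t (\<omega> t)) \<le> ennreal (CP * w (\<omega> t))"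
      using A1_mom a_in KPc by blast
    then show "(\<integral>\<^sup>+y. ennreal (w y) \<partial>K t (\<omega> t)) \<le> ennreal CP * ennreal (w (\<omega> t))"
      using CP by (simp add: ennreal_mult')
  qed
  also have "\<dots> = ennreal CP * (\<integral>\<^sup>+\<omega>. ennreal (w (\<omega> t)) \<partial>P)" by (rule nn_integral_cmult[OF mw])
  also have "\<dots> \<le> ennreal CP * ennreal (CP ^ t * w x)" using Suc.IH by (rule mult_left_mono) simp
  also have "\<dots> = ennreal (CP ^ Suc t * w x)" using CP by (simp add: ennreal_mult'[symmetric] mult.assoc)
  finally show ?case .
qed

lemma integrable_w: "integrable P (\<lambda>\<omega>. w (\<omega> t))"
proof (rule integrableI_nonneg)
  show "(\<lambda>\<omega>. w (\<omega> t)) \<in> borel_measurable P" by (rule measurable_compose[OF measurable_coord w_measurable])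
  show "AE \<omega> in P. 0 \<le> w (\<omega> t)" using w_pos by (intro AE_I2 less_imp_le)
  show "(\<integral>\<^sup>+\<omega>. ennreal (w (\<omega> t)) \<partial>P) < \<infinity>"
    unfolding infinity_ennreal_def by (rule le_less_trans[OF nn_integral_w ennreal_less_top])
qed

lemma integral_w: "(\<integral>\<omega>. w (\<omega> t) \<partial>P) \<le> CP ^ t * w x"
proof -
  have "ennreal (\<integral>\<omega>. w (\<omega> t) \<partial>P) = (\<integral>\<^sup>+\<omega>. ennreal (w (\<omega> t)) \<partial>P)"
    using w_pos by (intro nn_integral_eq_integral[symmetric] integrable_w AE_I2 less_imp_le)
  then have "ennreal (\<integral>\<omega>. w (\<omega> t) \<partial>P) \<le> ennreal (CP ^ t * w x)" using nn_integral_w by simp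
  moreover have "0 \<le> CP ^ t * w x" using CP w_pos[of x] by (intro mult_nonneg_nonneg) auto
  ultimately show ?thesis by (simp only: ennreal_le_iff)
qed

lemma integrable_Cp_path:
  assumes g: "g \<in> Cp p Om"
  shows "integrable P (\<lambda>\<omega>. g (\<omega> t))"
proof -
  obtain C where C: "\<And>y. y \<in> Om \<Longrightarrow> \<bar>g y\<bar> \<le> C * w y" using CpE[OF g] by metis
  show ?thesis
  proof (rule Bochner_Integration.integrable_bound[OF integrable_mult_right[OF integrable_w[of t], of C]])
    show "(\<lambda>\<omega>. g (\<omega> t)) \<in> borel_measurable P"
      by (rule measurable_compose[OF measurable_coord Cp_measurable[OF g]])
    have "\<bar>g (\<omega> t)\<bar> \<le> \<bar>C * w (\<omega> t)\<bar>" if "\<omega> \<in> space P" for \<omega>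
      using C[OF coord[OF that, of t]] by (rule order_trans) (rule abs_ge_self)
    then show "AE \<omega> in P. norm (g (\<omega> t)) \<le> norm (C * w (\<omega> t))" by (intro AE_I2) simp
  qed
qed

text \<open>The moments grow at most like \<open>CP ^ n\<close>, which the discount outweighs
  because \<open>\<alpha> * CP < 1\<close>.\<close>

lemma discounted_Cp_tendsto_0:
  assumes g: "g \<in> Cp p Om"
  shows "(\<lambda>n. \<alpha> ^ n * (\<integral>\<omega>. g (\<omega> n) \<partial>P)) \<longlonglongrightarrow> 0"
proof -
  obtain C where C: "C \<ge> 0" "\<And>y. y \<in> Om \<Longrightarrow> \<bar>g y\<bar> \<le> C * w y" using CpE[OF g] by metis
  have le: "norm (\<alpha> ^ n * (\<integral>\<omega>. g (\<omega> n) \<partial>P)) \<le> (\<alpha> * CP) ^ n * (C * w x)" for n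
  proof -
    have "\<bar>\<integral>\<omega>. g (\<omega> n) \<partial>P\<bar> \<le> (\<integral>\<omega>. \<bar>g (\<omega> n)\<bar> \<partial>P)" by (rule integral_abs_bound)
    also have "\<dots> \<le> (\<integral>\<omega>. C * w (\<omega> n) \<partial>P)"
      using C(2) coord by (intro integral_mono integrable_abs integrable_Cp_path g integrable_mult_right integrable_w) auto
    also have "\<dots> \<le> C * (CP ^ n * w x)"
      using mult_left_mono[OF integral_w C(1)] by simp
    finally have "\<alpha> ^ n * \<bar>\<integral>\<omega>. g (\<omega> n) \<partial>P\<bar> \<le> \<alpha> ^ n * (C * (CP ^ n * w x))"
      using alpha by (intro mult_left_mono) auto
    then show ?thesis using alpha by (simp add: abs_mult power_mult_distrib mult_ac)
  qed
  have "(\<lambda>n. (\<alpha> * CP) ^ n * (C * w x)) \<longlonglongrightarrow> 0"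
    using contraction_factor by (intro tendsto_mult_left_zero LIMSEQ_power_zero) auto
  then show ?thesis by (rule Lim_null_comparison[OF always_eventually, rotated]) (intro allI le)
qed

section \<open>Expected discounted rewards\<close>

abbreviation "rew t \<omega> \<equiv> r (\<omega> t) (a t (\<omega> t)) (\<omega> (Suc t))"

lemma r_measurable: "(\<lambda>(u, y). r u (a t u) y) \<in> borel_measurable (S \<Otimes>\<^sub>M S)"
proof -
  have id: "(\<lambda>y. y) \<in> borel_measurable S" by (rule measurable_restrict_space1) simp
  have am: "a t \<in> borel_measurable S"
    using a_Aloc[of t] unfolding Aloc_def measurable_restrict_space2_iff by simp
  have "(\<lambda>z. (fst z, a t (fst z), snd z)) \<in> borel_measurable (S \<Otimes>\<^sub>M S)"
    by (intro borel_measurable_Pair measurable_compose[OF measurable_fst id] measurable_compose[OF measurable_snd id]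
        measurable_compose[OF measurable_fst am])
  then have "(\<lambda>z. (fst z, a t (fst z), snd z)) \<in> measurable (S \<Otimes>\<^sub>M S) (restrict_space borel (Om \<times> A \<times> Om))"
    using a_in by (intro measurable_restrict_space2) (auto simp: space_pair_measure)
  from measurable_compose[OF this borel_measurable_continuous_on_restrict[OF r_cont]]
  show ?thesis by (simp add: case_prod_beta')
qed

text \<open>The dominating function for \<open>integral_step\<close>: a current and a next weight,
  each integrable along the path.\<close>

lemma r_dominated:
  defines "h \<equiv> \<lambda>u y. Cr * w u + Cr * w y"
  shows "case_prod h \<in> borel_measurable (S \<Otimes>\<^sub>M S)" "u \<in> Om \<Longrightarrow> integrable (K t u) (h u)"
    "integrable P (\<lambda>\<omega>. h (\<omega> t) (\<omega> (Suc t)))"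
proof -
  show "case_prod h \<in> borel_measurable (S \<Otimes>\<^sub>M S)"
    unfolding h_def case_prod_beta'
    by (intro borel_measurable_add borel_measurable_times borel_measurable_const
        measurable_compose[OF measurable_fst w_measurable] measurable_compose[OF measurable_snd w_measurable])
  show "integrable (K t u) (h u)" if "u \<in> Om"
  proof -
    interpret Ku: prob_space "K t u" using K_prob[OF that] .
    show ?thesis unfolding h_def
      by (intro Bochner_Integration.integrable_add integrable_mult_right Ku.integrable_const M1pD(5)[OF K_M1p[OF that]])
  qed
  show "integrable P (\<lambda>\<omega>. h (\<omega> t) (\<omega> (Suc t)))"
    unfolding h_def by (intro Bochner_Integration.integrable_add integrable_mult_right integrable_w)
qed

lemma reward_step:
  "integrable P (rew t)" "integrable P (\<lambda>\<omega>. \<integral>y. r (\<omega> t) (a t (\<omega> t)) y \<partial>K t (\<omega> t))"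
  "(\<integral>\<omega>. rew t \<omega> \<partial>P) = (\<integral>\<omega>. (\<integral>y. r (\<omega> t) (a t (\<omega> t)) y \<partial>K t (\<omega> t)) \<partial>P)"
  using integral_step[OF r_measurable r_dominated(1) abs_r_le[OF _ a_in] r_dominated(2,3)] by blast+

lemma integral_abs_reward: "(\<integral>\<omega>. \<bar>rew t \<omega>\<bar> \<partial>P) \<le> CP ^ t * (Cr * (1 + CP) * w x)"
proof -
  have "(\<integral>\<omega>. \<bar>rew t \<omega>\<bar> \<partial>P) \<le> (\<integral>\<omega>. Cr * w (\<omega> t) + Cr * w (\<omega> (Suc t)) \<partial>P)"
    using abs_r_le coord a_in by (intro integral_mono integrable_abs reward_step(1) r_dominated(3)) blast
  also have "\<dots> = Cr * (\<integral>\<omega>. w (\<omega> t) \<partial>P) + Cr * (\<integral>\<omega>. w (\<omega> (Suc t)) \<partial>P)"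
    unfolding Bochner_Integration.integral_add[OF integrable_mult_right[OF integrable_w] integrable_mult_right[OF integrable_w]]
      integral_mult_right_zero ..
  \<comment> \<open>The moments at times \<open>t\<close> and \<open>Suc t\<close> together produce
    the factor \<open>1 + CP\<close>.\<close>
  also have "\<dots> \<le> Cr * (CP ^ t * w x) + Cr * (CP ^ Suc t * w x)"
    by (rule add_mono[OF mult_left_mono[OF integral_w] mult_left_mono[OF integral_w]]) (use Cr in auto)
  also have "\<dots> = CP ^ t * (Cr * (1 + CP) * w x)" by (simp add: algebra_simps)
  finally show ?thesis .
qed

lemma summable_reward_bound: "summable (\<lambda>t. (\<alpha> * CP) ^ t * (Cr * (1 + CP) * w x))"
  using contraction_factor by (intro summable_mult2 summable_geometric) auto

lemma discounted_reward_le: "(\<integral>\<omega>. \<bar>\<alpha> ^ t * rew t \<omega>\<bar> \<partial>P) \<le> (\<alpha> * CP) ^ t * (Cr * (1 + CP) * w x)"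
proof -
  have "(\<integral>\<omega>. \<bar>\<alpha> ^ t * rew t \<omega>\<bar> \<partial>P) = \<alpha> ^ t * (\<integral>\<omega>. \<bar>rew t \<omega>\<bar> \<partial>P)"
    using alpha by (simp add: abs_mult)
  also have "\<dots> \<le> \<alpha> ^ t * (CP ^ t * (Cr * (1 + CP) * w x))"
    using alpha by (intro mult_left_mono integral_abs_reward) auto
  finally show ?thesis by (simp only: power_mult_distrib mult.assoc)
qed

lemma totrew_sums: "(\<lambda>t. \<alpha> ^ t * (\<integral>\<omega>. rew t \<omega> \<partial>P)) sums integral\<^sup>L P (totrew r \<alpha> a)"
proof -
  have "summable (\<lambda>t. \<integral>\<omega>. \<bar>\<alpha> ^ t * rew t \<omega>\<bar> \<partial>P)"
    by (rule summable_comparison_test'[OF summable_reward_bound, of 0]) (use discounted_reward_le in simp)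
  from sums_integral_real[OF integrable_mult_right[OF reward_step(1)] this]
  show ?thesis by (simp add: totrew_def[abs_def])
qed

text \<open>The bound depends neither on the kernels nor on the policy. It shows that the expected
  rewards over an ambiguity set are bounded below, without which a real-valued \<open>INF\<close>
  would carry no meaning.\<close>

lemma abs_expected_totrew_le: "\<bar>integral\<^sup>L P (totrew r \<alpha> a)\<bar> \<le> (\<Sum>t. (\<alpha> * CP) ^ t * (Cr * (1 + CP) * w x))"
proof -
  have le: "\<bar>\<alpha> ^ t * (\<integral>\<omega>. rew t \<omega> \<partial>P)\<bar> \<le> (\<alpha> * CP) ^ t * (Cr * (1 + CP) * w x)" for t
    using integral_abs_bound[of P "\<lambda>\<omega>. \<alpha> ^ t * rew t \<omega>"] discounted_reward_le[of t] by simp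
  have s: "summable (\<lambda>t. \<bar>\<alpha> ^ t * (\<integral>\<omega>. rew t \<omega> \<partial>P)\<bar>)"
    by (rule summable_comparison_test'[OF summable_reward_bound, of 0]) (use le in simp)
  have "\<bar>integral\<^sup>L P (totrew r \<alpha> a)\<bar> \<le> (\<Sum>t. \<bar>\<alpha> ^ t * (\<integral>\<omega>. rew t \<omega> \<partial>P)\<bar>)"
    unfolding sums_unique[OF totrew_sums] using summable_rabs[OF s] .
  also have "\<dots> \<le> (\<Sum>t. (\<alpha> * CP) ^ t * (Cr * (1 + CP) * w x))"
    by (rule suminf_le[OF le s summable_reward_bound])
  finally show ?thesis .
qed

lemma Cp_step:
  assumes v: "v \<in> Cp p Om"
  shows "integrable P (\<lambda>\<omega>. \<integral>y. v y \<partial>K t (\<omega> t))"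
    "(\<integral>\<omega>. v (\<omega> (Suc t)) \<partial>P) = (\<integral>\<omega>. (\<integral>y. v y \<partial>K t (\<omega> t)) \<partial>P)"
proof -
  obtain C where C: "\<And>y. y \<in> Om \<Longrightarrow> \<bar>v y\<bar> \<le> C * w y" using CpE[OF v] by metis
  have "(\<lambda>(u, y). v y) \<in> borel_measurable (S \<Otimes>\<^sub>M S)" "(\<lambda>(u, y). C * w y) \<in> borel_measurable (S \<Otimes>\<^sub>M S)"
    unfolding case_prod_beta'
    by (intro borel_measurable_times borel_measurable_const measurable_compose[OF measurable_snd w_measurable]
        measurable_compose[OF measurable_snd Cp_measurable[OF v]])+
  from integral_step[OF this C, of t] show "integrable P (\<lambda>\<omega>. \<integral>y. v y \<partial>K t (\<omega> t))"
    "(\<integral>\<omega>. v (\<omega> (Suc t)) \<partial>P) = (\<integral>\<omega>. (\<integral>y. v y \<partial>K t (\<omega> t)) \<partial>P)"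
    using integrable_mult_right[OF M1pD(5)[OF K_M1p]] integrable_mult_right[OF integrable_w] by blast+
qed

section \<open>Telescoping against the value function\<close>

text \<open>Trades the expected reward for a stage value minus the discounted next value, the form
  in which a comparison with \<open>v\<close> at time \<open>t\<close> leads to
  cancellation.\<close>

lemma reward_eq_stageval:
  assumes v: "v \<in> Cp p Om"
  shows "integrable P (\<lambda>\<omega>. stageval r \<alpha> v (\<omega> t) (a t (\<omega> t)) (K t (\<omega> t)))"
    "(\<integral>\<omega>. rew t \<omega> \<partial>P) = (\<integral>\<omega>. stageval r \<alpha> v (\<omega> t) (a t (\<omega> t)) (K t (\<omega> t)) \<partial>P) - \<alpha> * (\<integral>\<omega>. v (\<omega> (Suc t)) \<partial>P)"
proof -
  have st: "stageval r \<alpha> v (\<omega> t) (a t (\<omega> t)) (K t (\<omega> t))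
      = (\<integral>y. r (\<omega> t) (a t (\<omega> t)) y \<partial>K t (\<omega> t)) + \<alpha> * (\<integral>y. v y \<partial>K t (\<omega> t))" if "\<omega> \<in> space P" for \<omega>
  proof -
    note u = coord[OF that, of t]
    have "integrable (K t (\<omega> t)) (r (\<omega> t) (a t (\<omega> t)))" "integrable (K t (\<omega> t)) v"
      using integrable_Cp[OF r_Cp[OF u a_in[OF u]] K_M1p[OF u]] integrable_Cp[OF v K_M1p[OF u]] by auto
    then show ?thesis unfolding stageval_def by simp
  qed
  note i = reward_step(2)[of t] integrable_mult_right[OF Cp_step(1)[OF v, of t], of \<alpha>]
  show "integrable P (\<lambda>\<omega>. stageval r \<alpha> v (\<omega> t) (a t (\<omega> t)) (K t (\<omega> t)))"
    using Bochner_Integration.integrable_add[OF i] by (subst Bochner_Integration.integrable_cong[OF refl st])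
  have "(\<integral>\<omega>. stageval r \<alpha> v (\<omega> t) (a t (\<omega> t)) (K t (\<omega> t)) \<partial>P)
      = (\<integral>\<omega>. (\<integral>y. r (\<omega> t) (a t (\<omega> t)) y \<partial>K t (\<omega> t)) + \<alpha> * (\<integral>y. v y \<partial>K t (\<omega> t)) \<partial>P)"
    by (rule Bochner_Integration.integral_cong[OF refl st])
  also have "\<dots> = (\<integral>\<omega>. rew t \<omega> \<partial>P) + \<alpha> * (\<integral>\<omega>. v (\<omega> (Suc t)) \<partial>P)"
    unfolding Bochner_Integration.integral_add[OF i] reward_step(3) Cp_step(2)[OF v] by simp
  finally show "(\<integral>\<omega>. rew t \<omega> \<partial>P) = (\<integral>\<omega>. stageval r \<alpha> v (\<omega> t) (a t (\<omega> t)) (K t (\<omega> t)) \<partial>P) - \<alpha> * (\<integral>\<omega>. v (\<omega> (Suc t)) \<partial>P)"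
    by simp
qed

lemma verification_tendsto:
  assumes v: "v \<in> Cp p Om"
  shows "(\<lambda>n. (\<Sum>t<n. \<alpha> ^ t * (\<integral>\<omega>. rew t \<omega> \<partial>P)) + \<alpha> ^ n * (\<integral>\<omega>. v (\<omega> n) \<partial>P)) \<longlonglongrightarrow> integral\<^sup>L P (totrew r \<alpha> a)"
  using tendsto_add[OF totrew_sums[unfolded sums_def] discounted_Cp_tendsto_0[OF v]] by simp

text \<open>The hypothesis makes the finite-horizon values with terminal payoff \<open>v\<close>
  nondecreasing in the horizon; horizon 0 gives \<open>v x\<close> and the limit gives the total
  reward.\<close>

lemma value_le_expected_totrew:
  assumes v: "v \<in> Cp p Om" and le: "\<And>t u. u \<in> Om \<Longrightarrow> v u \<le> stageval r \<alpha> v u (a t u) (K t u)"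
  shows "v x \<le> integral\<^sup>L P (totrew r \<alpha> a)"
proof (rule LIMSEQ_le_const[OF verification_tendsto[OF v]], intro exI allI impI)
  fix n
  show "v x \<le> (\<Sum>t<n. \<alpha> ^ t * (\<integral>\<omega>. rew t \<omega> \<partial>P)) + \<alpha> ^ n * (\<integral>\<omega>. v (\<omega> n) \<partial>P)"
  proof (induction n)
    case 0
    then show ?case using integral_initial[OF Cp_measurable[OF v]] by simp
  next
    case (Suc n)
    have "(\<integral>\<omega>. v (\<omega> n) \<partial>P) \<le> (\<integral>\<omega>. stageval r \<alpha> v (\<omega> n) (a n (\<omega> n)) (K n (\<omega> n)) \<partial>P)"
      using le coord by (intro integral_mono integrable_Cp_path v reward_eq_stageval(1)) auto
    then have "(\<integral>\<omega>. v (\<omega> n) \<partial>P) \<le> (\<integral>\<omega>. rew n \<omega> \<partial>P) + \<alpha> * (\<integral>\<omega>. v (\<omega> (Suc n)) \<partial>P)"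
      using reward_eq_stageval(2)[OF v, of n] by simp
    from mult_left_mono[OF this, of "\<alpha> ^ n"] Suc.IH show ?case
      using alpha by (simp add: distrib_left mult_ac)
  qed
qed

text \<open>With the reversed inequality the same finite-horizon values are nonincreasing.\<close>

lemma expected_totrew_le_value:
  assumes v: "v \<in> Cp p Om" and le: "\<And>t u. u \<in> Om \<Longrightarrow> stageval r \<alpha> v u (a t u) (K t u) \<le> v u"
  shows "integral\<^sup>L P (totrew r \<alpha> a) \<le> v x"
proof (rule LIMSEQ_le_const2[OF verification_tendsto[OF v]], intro exI allI impI)
  fix n
  show "(\<Sum>t<n. \<alpha> ^ t * (\<integral>\<omega>. rew t \<omega> \<partial>P)) + \<alpha> ^ n * (\<integral>\<omega>. v (\<omega> n) \<partial>P) \<le> v x"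
  proof (induction n)
    case 0
    then show ?case using integral_initial[OF Cp_measurable[OF v]] by simp
  next
    case (Suc n)
    have "(\<integral>\<omega>. stageval r \<alpha> v (\<omega> n) (a n (\<omega> n)) (K n (\<omega> n)) \<partial>P) \<le> (\<integral>\<omega>. v (\<omega> n) \<partial>P)"
      using le coord by (intro integral_mono integrable_Cp_path v reward_eq_stageval(1)) auto
    then have "(\<integral>\<omega>. rew n \<omega> \<partial>P) + \<alpha> * (\<integral>\<omega>. v (\<omega> (Suc n)) \<partial>P) \<le> (\<integral>\<omega>. v (\<omega> n) \<partial>P)"
      using reward_eq_stageval(2)[OF v, of n] by simp
    from mult_left_mono[OF this, of "\<alpha> ^ n"] Suc.IH show ?case
      using alpha by (simp add: distrib_left mult_ac)
  qed
qed

end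

context robust_mdp begin

section \<open>Optimality over all policies\<close>

lemma robust_pathI:
  assumes "x \<in> Om" "a \<in> Apol Om A" "\<And>t. K t \<in> Kset Om Pc (a t)"
  shows "robust_path Om A Pc r rho0 rhoA p CP Cr L \<alpha> x K a"
proof (rule robust_path.intro)
  show "robust_mdp Om A Pc r rho0 rhoA p CP Cr L \<alpha>" by (rule robust_mdp_axioms)
  show "kernel_path Om x K" using assms by (intro kernel_path.intro) (auto simp: Kset_def)
  show "robust_path_axioms Om A Pc K a" using assms by (intro robust_path_axioms.intro) (auto simp: Kset_def)
qed

lemma Pfrak_eq: "Pfrak Om Pc x a = {pathmeas Om x K | K. \<forall>t. K t \<in> Kset Om Pc (a t)}"
  by (simp add: Pfrak_def Kset_def)

lemma global_optimality:
  assumes v: "v \<in> Cp p Om" and fixed: "\<And>x. x \<in> Om \<Longrightarrow> Tb A Pc r \<alpha> v x = v x"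
    and P0: "optkernel Om A Pc r \<alpha> v P0" and as: "optaction Om A Pc r \<alpha> v as" and x: "x \<in> Om"
  shows "pathmeas Om x (\<lambda>t y. P0 (y, as y)) \<in> Pfrak Om Pc x (\<lambda>t. as)" (is ?th1)
    "integral\<^sup>L (pathmeas Om x (\<lambda>t y. P0 (y, as y))) (totrew r \<alpha> (\<lambda>t. as))
        = (INF P\<in>Pfrak Om Pc x (\<lambda>t. as). integral\<^sup>L P (totrew r \<alpha> (\<lambda>t. as)))" (is ?th2)
    "(INF P\<in>Pfrak Om Pc x (\<lambda>t. as). integral\<^sup>L P (totrew r \<alpha> (\<lambda>t. as))) = Vfun Om A Pc r \<alpha> x" (is ?th3)
    "Vfun Om A Pc r \<alpha> x = v x" (is ?th4)
proof -
  let ?E = "\<lambda>a P. integral\<^sup>L P (totrew r \<alpha> a)"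
  let ?Ps = "pathmeas Om x (\<lambda>t y. P0 (y, as y))"
  have as': "as \<in> Aloc Om A" "\<And>x. x \<in> Om \<Longrightarrow> worst_value v x (as x) = v x"
    using as optaction_iff[OF v] fixed by auto
  have ap: "(\<lambda>t. as) \<in> Apol Om A" using as' by (simp add: Apol_def)
  have "(\<lambda>y. P0 (y, as y)) \<in> Kset Om Pc as" by (rule optkernel_Kset[OF P0 as'(1)])
  then show mem: ?th1 unfolding Pfrak_eq by (intro CollectI exI[of _ "\<lambda>t y. P0 (y, as y)"]) auto
  \<comment> \<open>Whatever the policy, the adversary answers with \<open>P0\<close> at the action
    prescribed for the current time and state; each stage value is then the worst one, which the
    fixed point equation bounds by \<open>v\<close>.\<close>
  have upper: "\<exists>R\<in>Pfrak Om Pc x a. ?E a R \<le> v x" if a: "a \<in> Apol Om A" for a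
  proof -
    have at: "a t \<in> Aloc Om A" for t using a by (simp add: Apol_def)
    let ?K = "\<lambda>t y. P0 (y, a t y)"
    have Ka: "?K t \<in> Kset Om Pc (a t)" for t by (rule optkernel_Kset[OF P0 at])
    interpret robust_path Om A Pc r rho0 rhoA p CP Cr L \<alpha> x ?K a by (rule robust_pathI[OF x a Ka])
    have "?E a (pathmeas Om x ?K) \<le> v x"
    proof (rule expected_totrew_le_value[OF v])
      fix t u assume u: "u \<in> Om"
      show "stageval r \<alpha> v u (a t u) (P0 (u, a t u)) \<le> v u"
        using optkernelD(3)[OF P0 u Aloc_in[OF at u]] worst_value_le_Tb[OF v u Aloc_in[OF at u]] fixed[OF u] by simp
    qed
    moreover have "pathmeas Om x ?K \<in> Pfrak Om Pc x a"
      unfolding Pfrak_eq using Ka by (intro CollectI exI[of _ ?K]) auto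
    ultimately show ?thesis by (rule bexI)
  qed
  \<comment> \<open>The stationary optimal policy guarantees \<open>v\<close> against every
    admissible sequence of kernels, time-dependent ones included.\<close>
  have lower: "v x \<le> ?E (\<lambda>t. as) R" if mem_R: "R \<in> Pfrak Om Pc x (\<lambda>t. as)" for R
  proof -
    obtain K where R: "R = pathmeas Om x K" "\<And>t. K t \<in> Kset Om Pc as"
      using mem_R by (auto simp: Pfrak_eq)
    interpret robust_path Om A Pc r rho0 rhoA p CP Cr L \<alpha> x K "\<lambda>t. as" by (rule robust_pathI[OF x ap R(2)])
    show ?thesis
      unfolding R(1)
    proof (rule value_le_expected_totrew[OF v])
      fix t u assume u: "u \<in> Om"
      show "v u \<le> stageval r \<alpha> v u (as u) (K t u)"
        using worst_value_le[OF v u Aloc_in[OF as'(1) u] KPc[OF u]] as'(2)[OF u] by simp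
    qed
  qed
  have Ps: "?E (\<lambda>t. as) ?Ps = v x"
  proof (rule antisym[OF _ lower[OF mem]])
    interpret robust_path Om A Pc r rho0 rhoA p CP Cr L \<alpha> x "\<lambda>t y. P0 (y, as y)" "\<lambda>t. as"
      by (rule robust_pathI[OF x ap optkernel_Kset[OF P0 as'(1)]])
    show "?E (\<lambda>t. as) ?Ps \<le> v x"
      using optkernelD(3)[OF P0 _ Aloc_in[OF as'(1)]] as'(2) by (intro expected_totrew_le_value[OF v]) simp
  qed
  have INF: "(INF R\<in>Pfrak Om Pc x (\<lambda>t. as). ?E (\<lambda>t. as) R) = v x"
  proof (rule cInf_eq_minimum)
    show "v x \<in> ?E (\<lambda>t. as) ` Pfrak Om Pc x (\<lambda>t. as)"
      using mem by (rule image_eqI[where x = ?Ps, rotated]) (rule Ps[symmetric])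
    show "v x \<le> z" if "z \<in> ?E (\<lambda>t. as) ` Pfrak Om Pc x (\<lambda>t. as)" for z using that lower by blast
  qed
  show ?th2 using Ps INF by simp
  \<comment> \<open>Required for every policy: comparing its infimum with the single value from
    \<open>upper\<close> needs a set bounded below.\<close>
  have bdd: "bdd_below (?E a ` Pfrak Om Pc x a)" if a: "a \<in> Apol Om A" for a
  proof (rule bdd_belowI2)
    fix R assume "R \<in> Pfrak Om Pc x a"
    then obtain K where R: "R = pathmeas Om x K" "\<And>t. K t \<in> Kset Om Pc (a t)"
      by (auto simp: Pfrak_eq)
    interpret robust_path Om A Pc r rho0 rhoA p CP Cr L \<alpha> x K a by (rule robust_pathI[OF x a R(2)])
    show "- (\<Sum>t. (\<alpha> * CP) ^ t * (Cr * (1 + CP) * w x)) \<le> ?E a R"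
      using abs_expected_totrew_le unfolding R(1) by linarith
  qed
  \<comment> \<open>The stationary policy attains the supremum, and \<open>upper\<close> shows that
    no other policy exceeds it.\<close>
  show V: ?th4
    unfolding Vfun_def
  proof (rule cSup_eq_maximum)
    show "v x \<in> (\<lambda>a. INF P\<in>Pfrak Om Pc x a. ?E a P) ` Apol Om A"
      using INF ap by (intro image_eqI[of _ _ "\<lambda>t. as"]) auto
    fix z assume "z \<in> (\<lambda>a. INF P\<in>Pfrak Om Pc x a. ?E a P) ` Apol Om A"
    then obtain a where a: "a \<in> Apol Om A" "z = (INF R\<in>Pfrak Om Pc x a. ?E a R)" by auto
    obtain R where "R \<in> Pfrak Om Pc x a" "?E a R \<le> v x" using upper[OF a(1)] by blast
    then show "z \<le> v x"
      unfolding a(2) by (rule order_trans[OF cINF_lower[OF bdd[OF a(1)]]])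
  qed
  show ?th3 using INF V by simp
qed

end

theorem mainTheorem1:
  fixes Om :: "'x::euclidean_space set" and A :: "'u::euclidean_space set"
    and Pc :: "'x \<Rightarrow> 'u \<Rightarrow> 'x measure set"
    and r :: "'x \<Rightarrow> 'u \<Rightarrow> 'x \<Rightarrow> real"
    and rho0 rhoA :: "real \<Rightarrow> ennreal"
    and p :: nat and CP Cr L \<alpha> :: real
  assumes p01: "p \<in> {0, 1}"
    and Om: "closed Om" "Om \<noteq> {}"
    and A: "compact A" "A \<noteq> {}"
    \<comment> \<open>(A1)(i)\<close>
    and A1_ne_cpt: "\<forall>x\<in>Om. \<forall>a\<in>A. Pc x a \<noteq> {} \<and> compactin (tau p Om) (Pc x a)"
    and A1_uhc: "uhc (top_of_set (Om \<times> A)) (tau p Om) (\<lambda>(x, a). Pc x a)"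
    and A1_lhc: "lhc (top_of_set (Om \<times> A)) (tau p Om) (\<lambda>(x, a). Pc x a)"
    \<comment> \<open>(A1)(ii)\<close>
    and CP: "CP \<ge> 1"
    and A1_mom: "\<forall>x\<in>Om. \<forall>a\<in>A. \<forall>Q\<in>Pc x a.
        nn_integral Q (\<lambda>y. ennreal (1 + norm y ^ p)) \<le> ennreal (CP * (1 + norm x ^ p))"
    \<comment> \<open>(A2)(i)\<close>
    and r_cont: "continuous_on (Om \<times> A \<times> Om) (\<lambda>(x, a, y). r x a y)"
    \<comment> \<open>(A2)(ii)\<close>
    and L: "L > 0"
    and rho0: "rho0 0 = 0" "(rho0 \<longlongrightarrow> 0) (at_right 0)"
    and rhoA: "rhoA 0 = 0" "(rhoA \<longlongrightarrow> 0) (at_right 0)"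
    and r_mod: "\<forall>x0\<in>Om. \<forall>x0'\<in>Om. \<forall>x1\<in>Om. \<forall>a\<in>A. \<forall>a'\<in>A.
        ennreal \<bar>r x0 a x1 - r x0' a' x1\<bar>
          \<le> ennreal (L * (1 + norm x1 ^ p)) * (rho0 (dist x0 x0') + rhoA (dist a a'))"
    \<comment> \<open>(A2)(iii)\<close>
    and Cr: "Cr \<ge> 1"
    and r_growth: "\<forall>x0\<in>Om. \<forall>a\<in>A. \<forall>x1\<in>Om. \<bar>r x0 a x1\<bar> \<le> Cr * (1 + norm x0 ^ p + norm x1 ^ p)"
    \<comment> \<open>(A2)(iv)\<close>
    and alpha: "0 < \<alpha>" "\<alpha> < 1 / CP"
  shows
    \<comment> \<open>(i)\<close>
    "(\<forall>v\<in>Cp p Om.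
        (\<exists>P0. optkernel Om A Pc r \<alpha> v P0) \<and>
        (\<exists>as. optaction Om A Pc r \<alpha> v as) \<and>
        (\<forall>P0 as. optkernel Om A Pc r \<alpha> v P0 \<longrightarrow> optaction Om A Pc r \<alpha> v as \<longrightarrow>
           (let Ps = (\<lambda>x. P0 (x, as x)) in
              Ps \<in> Kset Om Pc as \<and>
              (\<forall>x\<in>Om.
                 Tb A Pc r \<alpha> v x
                   = (SUP a'\<in>Aloc Om A. INF K\<in>Kset Om Pc a'. stageval r \<alpha> v x (a' x) (K x)) \<and>
                 Tb A Pc r \<alpha> v x
                   = (INF K\<in>Kset Om Pc as. stageval r \<alpha> v x (as x) (K x)) \<and>
                 Tb A Pc r \<alpha> v x = stageval r \<alpha> v x (as x) (Ps x))))) \<and>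
     \<comment> \<open>(ii)\<close>
     (\<forall>v\<in>Cp p Om. Tb A Pc r \<alpha> v \<in> Cp p Om) \<and>
     (\<forall>v\<in>Cp p Om. \<forall>w\<in>Cp p Om.
        cpnorm p Om (\<lambda>x. Tb A Pc r \<alpha> v x - Tb A Pc r \<alpha> w x) \<le> \<alpha> * CP * cpnorm p Om (\<lambda>x. v x - w x)) \<and>
     (\<exists>v\<in>Cp p Om. (\<forall>x\<in>Om. Tb A Pc r \<alpha> v x = v x) \<and>
        (\<forall>w\<in>Cp p Om. (\<forall>x\<in>Om. Tb A Pc r \<alpha> w x = w x) \<longrightarrow> (\<forall>x\<in>Om. w x = v x)) \<and>
        (\<forall>v0\<in>Cp p Om. (\<lambda>n. cpnorm p Om (\<lambda>x. (Tb A Pc r \<alpha> ^^ n) v0 x - v x)) \<longlonglongrightarrow> 0)) \<and>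
     \<comment> \<open>(iii)\<close>
     (\<forall>v\<in>Cp p Om. (\<forall>x\<in>Om. Tb A Pc r \<alpha> v x = v x) \<longrightarrow>
        (\<forall>P0 as. optkernel Om A Pc r \<alpha> v P0 \<longrightarrow> optaction Om A Pc r \<alpha> v as \<longrightarrow>
           (let Ps = (\<lambda>x. P0 (x, as x)); astar = (\<lambda>t::nat. as) in
            \<forall>x\<in>Om. pathmeas Om x (\<lambda>t. Ps) \<in> Pfrak Om Pc x astar \<and>
              integral\<^sup>L (pathmeas Om x (\<lambda>t. Ps)) (totrew r \<alpha> astar)
                = (INF P\<in>Pfrak Om Pc x astar. integral\<^sup>L P (totrew r \<alpha> astar)) \<and>
              (INF P\<in>Pfrak Om Pc x astar. integral\<^sup>L P (totrew r \<alpha> astar)) = Vfun Om A Pc r \<alpha> x \<and>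
              Vfun Om A Pc r \<alpha> x = v x)))"
proof -
  interpret robust_mdp Om A Pc r rho0 rhoA p CP Cr L \<alpha>
    by (rule robust_mdp.intro) (fact assms)+
  obtain v where v: "v \<in> Cp p Om" "\<And>x. x \<in> Om \<Longrightarrow> Tb A Pc r \<alpha> v x = v x"
    using Tb_fixed_point_exists by blast
  have fp: "\<exists>v\<in>Cp p Om. (\<forall>x\<in>Om. Tb A Pc r \<alpha> v x = v x) \<and>
      (\<forall>w\<in>Cp p Om. (\<forall>x\<in>Om. Tb A Pc r \<alpha> w x = w x) \<longrightarrow> (\<forall>x\<in>Om. w x = v x)) \<and>
      (\<forall>v0\<in>Cp p Om. (\<lambda>n. cpnorm p Om (\<lambda>x. (Tb A Pc r \<alpha> ^^ n) v0 x - v x)) \<longlonglongrightarrow> 0)"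
  proof (intro bexI[OF _ v(1)] conjI ballI impI)
    show "Tb A Pc r \<alpha> v x = v x" if "x \<in> Om" for x by (rule v(2)[OF that])
    show "w x = v x" if "w \<in> Cp p Om" "\<forall>x\<in>Om. Tb A Pc r \<alpha> w x = w x" "x \<in> Om" for w x
      by (rule Tb_fixed_point_unique[OF v that(1) bspec[OF that(2)] that(3)])
    show "(\<lambda>n. cpnorm p Om (\<lambda>x. (Tb A Pc r \<alpha> ^^ n) v0 x - v x)) \<longlonglongrightarrow> 0" if "v0 \<in> Cp p Om" for v0
      by (rule Tb_iterates_converge[OF v that])
  qed
  have Ks: "(\<lambda>x. P0 (x, as x)) \<in> Kset Om Pc as"
    if "optkernel Om A Pc r \<alpha> v P0" "optaction Om A Pc r \<alpha> v as" for v P0 as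
    using optkernel_Kset[OF that(1)] that(2) by (simp add: optaction_def)
  show ?thesis
    unfolding Let_def
    by (intro conjI ballI allI impI fp)
       (assumption | rule optkernel_exists optaction_exists Tb_Cp Tb_contraction Ks local_optimality
          global_optimality | erule bspec)+
qed

end
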